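(* Let $(X,\mu,T)$ be an ergodic $\mathbb{G}$-MPS. (1) $(X,\mu,T)$ has discrete spectrum if and only if $L^2(X,\mu)=H_{ms}^c$, i.e. no $f\in L^2(X,\mu)$ is $\mu$-mean sensitive. (2) $(X,\mu,T)$ is weakly mixing if and only if $f\in H_{ms}$ (i.e. $f$ is $\mu$-mean sensitive) for every non-constant $f\in L^2(X,\mu)$.
   Context: $\mathbb{G}$ is a locally compact abelian group (written additively, identity $e$) with Haar measure $\nu$. A $\mathbb{G}$-MPS $(X,\mu,T)$ is a standard probability space $(X,\Sigma,\mu)$ with a (jointly measurable) group action $T:\mathbb{G}\times X\to X$, $(j,x)\mapsto T^jx$, such that every $T^j$ preserves $\mu$; it is ergodic if every measurable set invariant under all $T^j$ has measure $0$ or $1$. A Følner sequence is a sequence $(F_n)_{n\in\mathbb{N}}$ of measurable subsets of $\mathbb{G}$ with $0<\nu(F_n)<\infty$ and $\nu((g+F_n)\triangle F_n)/\nu(F_n)\to 0$ for every $g\in\mathbb{G}$. A Følner sequence $(F_n)$ is fixed that satisfies the pointwise ergodic theorem: for every ergodic $\mathbb{G}$-MPS and every $f\in L^1(X,\mu)$, for $\mu$-a.e. $x$, $\frac{1}{\nu(F_n)}\int_{F_n} f(T^jx)\,d\nu(j)\to\int f\,d\mu$; a point $x$ at which this convergence holds is called generic for $f$. $L^2(X,\mu)$ consists of complex-valued functions. An eigenfunction is a nonzero $f\in L^2(X,\mu)$ for which there is a continuous homomorphism $w:\mathbb{G}\to S^1=\{z\in\mathbb{C}:|z|=1\}$ with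 $f\circ T^j=w(j)f$ for all $j\in\mathbb{G}$. $(X,\mu,T)$ has discrete spectrum if $L^2(X,\mu)$ has an orthonormal basis consisting of eigenfunctions. $(X,\mu,T)$ is weakly mixing if $(X\times X,\mu\times\mu,T\times T)$ is ergodic. "Non-constant" means not $\mu$-a.e. equal to a constant. For $f\in L^2(X,\mu)$ (a fixed representative) define $d_f(x,y)=\limsup_n\left(\frac{1}{\nu(F_n)}\int_{F_n}|f(T^jx)-f(T^jy)|^2d\nu(j)\right)^{1/2}$; whenever $d_f$ is used, only points generic for $|f|^2$ (a set of full measure) are considered. $f$ is $\mu$-mean sensitive if there is $\varepsilon>0$ such that for every $A\in\Sigma$ with $\mu(A)>0$ there exist $x,y\in A$ with $d_f(x,y)>\varepsilon$; $H_{ms}$ is the set of $\mu$-mean sensitive functions in $L^2(X,\mu)$ and $H_{ms}^c$ its complement in $L^2(X,\mu)$. *)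

theory Defs
  imports "HOL-Probability.Probability"
begin

text \<open>Haar measures are Radon measures on the Borel sets. The group is not assumed second countable,
  so the regularity conditions are not automatic.\<close>

definition haar_measure :: "'g::{topological_ab_group_add, t2_space} measure \<Rightarrow> bool" where
  "haar_measure \<nu> \<longleftrightarrow>
     sets \<nu> = sets borel \<and>
     emeasure \<nu> UNIV \<noteq> 0 \<and>
     (\<forall>g. \<forall>A\<in>sets borel. emeasure \<nu> ((+) g ` A) = emeasure \<nu> A) \<and>
     (\<forall>K. compact K \<longrightarrow> emeasure \<nu> K < \<infinity>) \<and>
     (\<forall>A\<in>sets borel. emeasure \<nu> A = (INF U\<in>{U. open U \<and> A \<subseteq> U}. emeasure \<nu> U)) \<and>
     (\<forall>U. open U \<longrightarrow> emeasure \<nu> U = (SUP K\<in>{K. compact K \<and> K \<subseteq> U}. emeasure \<nu> K))"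

definition folner_seq :: "'g::ab_group_add measure \<Rightarrow> (nat \<Rightarrow> 'g set) \<Rightarrow> bool" where
  "folner_seq \<nu> F \<longleftrightarrow>
     (\<forall>n. F n \<in> sets \<nu> \<and> 0 < emeasure \<nu> (F n) \<and> emeasure \<nu> (F n) < \<infinity>) \<and>
     (\<forall>g. (\<lambda>n. measure \<nu> (sym_diff ((+) g ` F n) (F n)) / measure \<nu> (F n)) \<longlonglongrightarrow> 0)"

definition standard_borel :: "'x measure \<Rightarrow> bool" where
  "standard_borel M \<longleftrightarrow>
     (\<exists>\<tau>. topspace \<tau> = space M \<and> completely_metrizable_space \<tau> \<and> second_countable \<tau> \<and>
          sets M = sigma_sets (space M) {U. openin \<tau> U})"

definition mps :: "'x measure \<Rightarrow> ('g::topological_ab_group_add \<Rightarrow> 'x \<Rightarrow> 'x) \<Rightarrow> bool" where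
  "mps M T \<longleftrightarrow>
     prob_space M \<and> standard_borel M \<and>
     (\<lambda>(j, x). T j x) \<in> borel \<Otimes>\<^sub>M M \<rightarrow>\<^sub>M M \<and>
     (\<forall>x\<in>space M. T 0 x = x) \<and>
     (\<forall>i j. \<forall>x\<in>space M. T (i + j) x = T i (T j x)) \<and>
     (\<forall>j. distr M M (T j) = M)"

definition ergodic :: "'x measure \<Rightarrow> ('g \<Rightarrow> 'x \<Rightarrow> 'x) \<Rightarrow> bool" where
  "ergodic M T \<longleftrightarrow>
     (\<forall>A\<in>sets M. (\<forall>j. T j -` A \<inter> space M = A) \<longrightarrow> measure M A = 0 \<or> measure M A = 1)"

definition ergodic_mps :: "'x measure \<Rightarrow> ('g::topological_ab_group_add \<Rightarrow> 'x \<Rightarrow> 'x) \<Rightarrow> bool" where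
  "ergodic_mps M T \<longleftrightarrow> mps M T \<and> ergodic M T"

definition weakly_mixing :: "'x measure \<Rightarrow> ('g \<Rightarrow> 'x \<Rightarrow> 'x) \<Rightarrow> bool" where
  "weakly_mixing M T \<longleftrightarrow> ergodic (M \<Otimes>\<^sub>M M) (\<lambda>j (x, y). (T j x, T j y))"

definition folner_avg ::
    "'g measure \<Rightarrow> 'g set \<Rightarrow> ('g \<Rightarrow> 'b::{banach, second_countable_topology}) \<Rightarrow> 'b" where
  "folner_avg \<nu> A h = (LINT j:A|\<nu>. h j) /\<^sub>R measure \<nu> A"

text \<open>Integrability over each Foelner set is explicit: the Bochner integral of a
  non-integrable function is 0 by convention.\<close>

definition generic_point ::
    "'g measure \<Rightarrow> (nat \<Rightarrow> 'g set) \<Rightarrow> 'x measure \<Rightarrow> ('g \<Rightarrow> 'x \<Rightarrow> 'x) \<Rightarrow>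
     ('x \<Rightarrow> 'b::{banach, second_countable_topology}) \<Rightarrow> 'x \<Rightarrow> bool" where
  "generic_point \<nu> F M T f x \<longleftrightarrow>
     (\<forall>n. set_integrable \<nu> (F n) (\<lambda>j. f (T j x))) \<and>
     (\<lambda>n. folner_avg \<nu> (F n) (\<lambda>j. f (T j x))) \<longlonglongrightarrow> (LINT x|M. f x)"

text \<open>A formula cannot quantify over all carrier types. Every standard Borel space has at most
  continuum many points, and the standard Borel structure need not be related to the
  topology of the reals, so each system is isomorphic to one whose underlying set is a set of reals.
  Quantifying over those systems is therefore quantifying over all of them.\<close>

definition pointwise_ergodic_seq ::
    "'g::topological_ab_group_add measure \<Rightarrow> (nat \<Rightarrow> 'g set) \<Rightarrow> bool" where
  "pointwise_ergodic_seq \<nu> F \<longleftrightarrow>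
     (\<forall>(M :: real measure) T (f :: real \<Rightarrow> complex).
        ergodic_mps M T \<longrightarrow> integrable M f \<longrightarrow> (AE x in M. generic_point \<nu> F M T f x))"

text \<open>Elements of \<open>L2\<close> are functions, not classes; identities between them are
  therefore stated almost everywhere or through the seminorm.\<close>

definition L2 :: "'x measure \<Rightarrow> ('x \<Rightarrow> complex) set" where
  "L2 M = {f \<in> borel_measurable M. integrable M (\<lambda>x. (cmod (f x))\<^sup>2)}"

definition L2_inner :: "'x measure \<Rightarrow> ('x \<Rightarrow> complex) \<Rightarrow> ('x \<Rightarrow> complex) \<Rightarrow> complex" where
  "L2_inner M f g = (LINT x|M. f x * cnj (g x))"

definition L2_norm :: "'x measure \<Rightarrow> ('x \<Rightarrow> complex) \<Rightarrow> real" where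
  "L2_norm M f = sqrt (LINT x|M. (cmod (f x))\<^sup>2)"

definition eigenfunction ::
    "'x measure \<Rightarrow> ('g::topological_ab_group_add \<Rightarrow> 'x \<Rightarrow> 'x) \<Rightarrow> ('x \<Rightarrow> complex) \<Rightarrow> bool" where
  "eigenfunction M T f \<longleftrightarrow>
     f \<in> L2 M \<and> \<not> (AE x in M. f x = 0) \<and>
     (\<exists>w :: 'g \<Rightarrow> complex.
        continuous_on UNIV w \<and> (\<forall>j. cmod (w j) = 1) \<and> (\<forall>i j. w (i + j) = w i * w j) \<and>
        (\<forall>j. AE x in M. f (T j x) = w j * f x))"

definition orthonormal_basis :: "'x measure \<Rightarrow> ('x \<Rightarrow> complex) set \<Rightarrow> bool" where
  "orthonormal_basis M B \<longleftrightarrow>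
     B \<subseteq> L2 M \<and>
     (\<forall>f\<in>B. \<forall>g\<in>B. L2_inner M f g = (if f = g then 1 else 0)) \<and>
     (\<forall>f\<in>L2 M. \<forall>\<epsilon>>0. \<exists>S c. finite S \<and> S \<subseteq> B \<and> L2_norm M (\<lambda>x. f x - (\<Sum>b\<in>S. c b * b x)) < \<epsilon>)"

definition discrete_spectrum ::
    "'x measure \<Rightarrow> ('g::topological_ab_group_add \<Rightarrow> 'x \<Rightarrow> 'x) \<Rightarrow> bool" where
  "discrete_spectrum M T \<longleftrightarrow> (\<exists>B. orthonormal_basis M B \<and> (\<forall>f\<in>B. eigenfunction M T f))"

definition mean_dist ::
    "'g measure \<Rightarrow> (nat \<Rightarrow> 'g set) \<Rightarrow> ('g \<Rightarrow> 'x \<Rightarrow> 'x) \<Rightarrow> ('x \<Rightarrow> complex) \<Rightarrow> 'x \<Rightarrow> 'x \<Rightarrow> ereal" where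
  "mean_dist \<nu> F T f x y =
     limsup (\<lambda>n. ereal (sqrt (folner_avg \<nu> (F n) (\<lambda>j. (cmod (f (T j x) - f (T j y)))\<^sup>2))))"

definition mean_sensitive ::
    "'g measure \<Rightarrow> (nat \<Rightarrow> 'g set) \<Rightarrow> 'x measure \<Rightarrow> ('g \<Rightarrow> 'x \<Rightarrow> 'x) \<Rightarrow> ('x \<Rightarrow> complex) \<Rightarrow> bool" where
  "mean_sensitive \<nu> F M T f \<longleftrightarrow>
     (\<exists>\<epsilon>>0. \<forall>A\<in>sets M. measure M A > 0 \<longrightarrow>
        (\<exists>x\<in>A. \<exists>y\<in>A.
           generic_point \<nu> F M T (\<lambda>z. (cmod (f z))\<^sup>2) x \<and>
           generic_point \<nu> F M T (\<lambda>z. (cmod (f z))\<^sup>2) y \<and>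
           mean_dist \<nu> F T f x y > ereal \<epsilon>))"

definition H_ms ::
    "'g measure \<Rightarrow> (nat \<Rightarrow> 'g set) \<Rightarrow> 'x measure \<Rightarrow> ('g \<Rightarrow> 'x \<Rightarrow> 'x) \<Rightarrow> ('x \<Rightarrow> complex) set" where
  "H_ms \<nu> F M T = {f \<in> L2 M. mean_sensitive \<nu> F M T f}"

end

(* If f is approximated in L2 by a finite combination of eigenfunctions, then on a set of positive
   measure where these eigenfunctions oscillate little the orbits of f stay close together, so discrete
   spectrum excludes mean sensitivity.  If T x T is ergodic, the pointwise ergodic theorem on the square
   gives d_f(x,y)^2 = 2 Var f for almost every pair, so weak mixing forces it.

   Conversely, let E be an invariant set in the square.  The functions x |-> mu(E_x /\ B) satisfy
   |f(T^j x) - f(T^j y)| <= mu(E_x symdiff E_y), and the fibres E_x are nearly constant on sets of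
   positive measure; so these functions are not sensitive, hence constant, and E is trivial.

   Finally let h be orthogonal to all eigenfunctions and let k(x,y) = h(x) cnj(h(y)).  If the Foelner
   averages of k along the product action tend to 0 in L2, then d_h(x,y)^2 >= 2 |h|^2 for almost every
   pair, and h is sensitive.  Otherwise the element of least norm in the closed convex hull of the
   product orbit of (a truncation of) k is an invariant self-adjoint bounded kernel K with
   <K h, h> <> 0.  Normalised even powers of such a kernel converge in Hilbert-Schmidt norm to an
   invariant projection.  An invariant projection P with P h <> 0 of minimal norm commutes with the
   action and cannot be split, so the action is scalar on its range, and P h is an eigenfunction
   correlated with h: a contradiction. *)
theory Submission
  imports Defs
begin

section \<open>The space of square integrable functions\<close>

text \<open>The pointwise ergodic theorem is assumed for ergodic systems only, and on a square that
  is not ergodic it says nothing. The converse half of (1) therefore relies on L2 convergence: the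
  averages of \<open>k\<close> are compared with those of an element of its convex hull by the
  Foelner property alone, and a.e. convergence along a subsequence is enough because d_h is a
  limsup. Even powers appear because an eigenvalue of largest modulus may be negative; the
  projection obtained belongs to the top eigenvalue of the square of the kernel. All kernels are
  bounded at every point, so that compositions are honest integrals. Keeping a bounded kernel as the
  outer factor on both sides bounds the normalised powers uniformly, and their limit is again such a
  kernel. The group need not be second countable, nor its Haar measure sigma-finite. Fubini is
  applied to the normalised restrictions of the measure to the Foelner sets. An eigenvalue is found
  for each group element separately, so its continuity has to be recovered from measurability by a
  Steinhaus argument.\<close>

lemma borel_measurable_cnj [measurable]:
  "f \<in> borel_measurable M \<Longrightarrow> (\<lambda>x. cnj (f x)) \<in> borel_measurable M"
  by (rule borel_measurable_continuous_on[OF continuous_on_cnj[OF continuous_on_id]])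

lemma L2_measurable [measurable_dest]: "f \<in> L2 M \<Longrightarrow> f \<in> borel_measurable M"
  by (simp add: L2_def)

lemma L2_square_integrable: "f \<in> L2 M \<Longrightarrow> integrable M (\<lambda>x. (cmod (f x))\<^sup>2)"
  by (simp add: L2_def)

lemma L2_mult_cnj_integrable:
  assumes "f \<in> L2 M" "g \<in> L2 M"
  shows "integrable M (\<lambda>x. f x * cnj (g x))"
proof (rule Bochner_Integration.integrable_bound)
  show "integrable M (\<lambda>x. (cmod (f x))\<^sup>2 + (cmod (g x))\<^sup>2)"
    using assms by (intro Bochner_Integration.integrable_add L2_square_integrable)
  have [measurable]: "f \<in> borel_measurable M" "g \<in> borel_measurable M"
    using assms by (auto simp: L2_def)
  show "(\<lambda>x. f x * cnj (g x)) \<in> borel_measurable M"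
    by measurable
  have "a * b \<le> a\<^sup>2 + b\<^sup>2" if "a \<ge> 0" "b \<ge> 0" for a b :: real
    using that sum_squares_bound[of a b] mult_nonneg_nonneg[of a b] by linarith
  then show "AE x in M. norm (f x * cnj (g x)) \<le> norm ((cmod (f x))\<^sup>2 + (cmod (g x))\<^sup>2)"
    by (auto simp: norm_mult)
qed

lemma L2_add:
  assumes "f \<in> L2 M" "g \<in> L2 M"
  shows "(\<lambda>x. f x + g x) \<in> L2 M"
proof -
  have [measurable]: "f \<in> borel_measurable M" "g \<in> borel_measurable M"
    using assms by (auto simp: L2_def)
  have "(cmod (a + b))\<^sup>2 \<le> 2 * (cmod a)\<^sup>2 + 2 * (cmod b)\<^sup>2" for a b
  proof -
    have "(cmod (a + b))\<^sup>2 \<le> (cmod a + cmod b)\<^sup>2"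
      by (intro power_mono norm_triangle_ineq) auto
    also have "\<dots> \<le> 2 * (cmod a)\<^sup>2 + 2 * (cmod b)\<^sup>2"
      using sum_squares_bound[of "cmod a" "cmod b"] by (simp add: power2_sum)
    finally show ?thesis .
  qed
  note bound = this
  have "integrable M (\<lambda>x. (cmod (f x + g x))\<^sup>2)"
  proof (rule Bochner_Integration.integrable_bound)
    show "integrable M (\<lambda>x. 2 * (cmod (f x))\<^sup>2 + 2 * (cmod (g x))\<^sup>2)"
      using assms by (simp add: L2_square_integrable)
    show "AE x in M. norm ((cmod (f x + g x))\<^sup>2) \<le> norm (2 * (cmod (f x))\<^sup>2 + 2 * (cmod (g x))\<^sup>2)"
      using bound by (intro AE_I2) simp
  qed measurable
  then show ?thesis
    by (simp add: L2_def)
qed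

lemma L2_scale: "f \<in> L2 M \<Longrightarrow> (\<lambda>x. c * f x) \<in> L2 M"
  by (auto simp: L2_def norm_mult power_mult_distrib)

lemma L2_diff: "f \<in> L2 M \<Longrightarrow> g \<in> L2 M \<Longrightarrow> (\<lambda>x. f x - g x) \<in> L2 M"
  using L2_add[of f M "\<lambda>x. (-1) * g x"] L2_scale[of g M "-1"] by simp

lemma L2_zero: "(\<lambda>x. 0) \<in> L2 M"
  by (simp add: L2_def)

lemma L2_sum: "(\<And>i. i \<in> I \<Longrightarrow> f i \<in> L2 M) \<Longrightarrow> (\<lambda>x. \<Sum>i\<in>I. f i x) \<in> L2 M"
  by (induction I rule: infinite_finite_induct) (auto simp: L2_zero intro: L2_add)

lemma L2_cnj: "f \<in> L2 M \<Longrightarrow> (\<lambda>x. cnj (f x)) \<in> L2 M"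
  by (auto simp: L2_def)

lemma (in finite_measure) L2_bounded:
  assumes "f \<in> borel_measurable M" "\<And>x. x \<in> space M \<Longrightarrow> cmod (f x) \<le> B"
  shows "f \<in> L2 M"
proof -
  have "integrable M (\<lambda>x. (cmod (f x))\<^sup>2)"
    using assms(1) by (intro integrable_const_bound[of _ "B\<^sup>2"])
      (auto intro!: AE_I2 power_mono assms(2))
  with assms show ?thesis by (simp add: L2_def)
qed

lemma (in finite_measure) L2_const: "(\<lambda>x. c) \<in> L2 M"
  by (rule L2_bounded[of _ "cmod c"]) auto

lemma (in finite_measure) L2_integrable:
  assumes "f \<in> L2 M"
  shows "integrable M f"
  using L2_mult_cnj_integrable[OF assms L2_const[of 1]] by simp

lemma L2_norm_nonneg: "0 \<le> L2_norm M f"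
  by (simp add: L2_norm_def)

lemma L2_norm_square: "(L2_norm M f)\<^sup>2 = (LINT x|M. (cmod (f x))\<^sup>2)"
  by (simp add: L2_norm_def)

lemma L2_inner_self: "L2_inner M f f = of_real ((L2_norm M f)\<^sup>2)"
  unfolding L2_norm_square L2_inner_def by (simp flip: complex_norm_square of_real_power)

lemma L2_inner_commute: "L2_inner M g f = cnj (L2_inner M f g)"
  unfolding L2_inner_def by (simp flip: Bochner_Integration.integral_cnj add: mult.commute)

lemma L2_norm_scale: "L2_norm M (\<lambda>x. c * f x) = cmod c * L2_norm M f"
  by (simp add: L2_norm_def norm_mult power_mult_distrib real_sqrt_mult)

lemma L2_norm_minus_commute: "L2_norm M (\<lambda>x. f x - g x) = L2_norm M (\<lambda>x. g x - f x)"
  by (simp add: L2_norm_def norm_minus_commute)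

lemma L2_inner_add_left:
  "\<lbrakk>f \<in> L2 M; g \<in> L2 M; h \<in> L2 M\<rbrakk> \<Longrightarrow>
    L2_inner M (\<lambda>x. f x + g x) h = L2_inner M f h + L2_inner M g h"
  unfolding L2_inner_def
  by (simp add: distrib_right L2_mult_cnj_integrable)

lemma L2_inner_diff_left:
  "\<lbrakk>f \<in> L2 M; g \<in> L2 M; h \<in> L2 M\<rbrakk> \<Longrightarrow>
    L2_inner M (\<lambda>x. f x - g x) h = L2_inner M f h - L2_inner M g h"
  unfolding L2_inner_def
  by (simp add: left_diff_distrib L2_mult_cnj_integrable)

lemma L2_inner_scale_left: "L2_inner M (\<lambda>x. c * f x) h = c * L2_inner M f h"
  unfolding L2_inner_def by (simp add: mult.assoc)

lemma L2_inner_zero_left: "L2_inner M (\<lambda>x. 0) h = 0"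
  unfolding L2_inner_def by simp

lemma L2_inner_add_right:
  "\<lbrakk>f \<in> L2 M; g \<in> L2 M; h \<in> L2 M\<rbrakk> \<Longrightarrow>
    L2_inner M h (\<lambda>x. f x + g x) = L2_inner M h f + L2_inner M h g"
  by (simp add: L2_inner_commute[of M h] L2_inner_add_left)

lemma L2_inner_diff_right:
  "\<lbrakk>f \<in> L2 M; g \<in> L2 M; h \<in> L2 M\<rbrakk> \<Longrightarrow>
    L2_inner M h (\<lambda>x. f x - g x) = L2_inner M h f - L2_inner M h g"
  by (simp add: L2_inner_commute[of M h] L2_inner_diff_left)

lemma L2_inner_scale_right: "L2_inner M h (\<lambda>x. c * f x) = cnj c * L2_inner M h f"
  by (simp add: L2_inner_commute[of M h] L2_inner_scale_left)

lemma L2_inner_sum_left: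
  "\<lbrakk>finite I; \<And>i. i \<in> I \<Longrightarrow> f i \<in> L2 M; h \<in> L2 M\<rbrakk> \<Longrightarrow>
    L2_inner M (\<lambda>x. \<Sum>i\<in>I. f i x) h = (\<Sum>i\<in>I. L2_inner M (f i) h)"
  by (induction I rule: finite_induct) (auto simp: L2_inner_zero_left L2_inner_add_left L2_sum)

lemma L2_inner_cong_AE:
  assumes "AE x in M. f x = f' x" "AE x in M. g x = g' x"
    and "f \<in> borel_measurable M" "f' \<in> borel_measurable M"
        "g \<in> borel_measurable M" "g' \<in> borel_measurable M"
  shows "L2_inner M f g = L2_inner M f' g'"
  unfolding L2_inner_def using assms by (intro integral_cong_AE) auto

lemma L2_norm_cong_AE:
  assumes "AE x in M. f x = f' x" "f \<in> borel_measurable M" "f' \<in> borel_measurable M"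
  shows "L2_norm M f = L2_norm M f'"
proof -
  have "(LINT x|M. (cmod (f x))\<^sup>2) = (LINT x|M. (cmod (f' x))\<^sup>2)"
    using assms by (intro integral_cong_AE) auto
  then show ?thesis
    by (simp add: L2_norm_def)
qed

lemma L2_norm_eq_0_iff:
  assumes "f \<in> L2 M"
  shows "L2_norm M f = 0 \<longleftrightarrow> (AE x in M. f x = 0)"
  using integral_nonneg_eq_0_iff_AE[OF L2_square_integrable[OF assms]] by (simp add: L2_norm_def)

lemma L2_norm_add_square:
  assumes "f \<in> L2 M" "g \<in> L2 M"
  shows "(L2_norm M (\<lambda>x. f x + g x))\<^sup>2 =
    (L2_norm M f)\<^sup>2 + 2 * Re (L2_inner M f g) + (L2_norm M g)\<^sup>2"
proof -
  have "complex_of_real ((L2_norm M (\<lambda>x. f x + g x))\<^sup>2) =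
     L2_inner M f f + L2_inner M f g + (L2_inner M g f + L2_inner M g g)"
    using assms unfolding L2_inner_self[symmetric]
    by (simp add: L2_inner_add_left L2_inner_add_right L2_add)
  then have "Re (complex_of_real ((L2_norm M (\<lambda>x. f x + g x))\<^sup>2)) =
     Re (L2_inner M f f + L2_inner M f g + (L2_inner M g f + L2_inner M g g))"
    by simp
  then show ?thesis
    unfolding L2_inner_self L2_inner_commute[of M g f] by simp
qed

lemma L2_norm_diff_square:
  assumes "f \<in> L2 M" "g \<in> L2 M"
  shows "(L2_norm M (\<lambda>x. f x - g x))\<^sup>2 =
    (L2_norm M f)\<^sup>2 - 2 * Re (L2_inner M f g) + (L2_norm M g)\<^sup>2"
  using L2_norm_add_square[OF assms(1) L2_scale[OF assms(2), of "-1"]]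
  by (simp only: L2_inner_scale_right L2_norm_scale) simp

lemma L2_Cauchy_Schwarz:
  assumes "f \<in> L2 M" "g \<in> L2 M"
  shows "cmod (L2_inner M f g) \<le> L2_norm M f * L2_norm M g"
proof -
  let ?z = "L2_inner M f g" and ?a = "L2_norm M f" and ?b = "L2_norm M g"
  \<comment> \<open>The multiple of \<open>g\<close> subtracted from \<open>f\<close> is
    \<open>of_real t * ?z\<close>: the factor \<open>?z\<close> makes the cross term real, and only
    the real parameter \<open>t\<close> is left to choose.\<close>
  have quad: "0 \<le> ?a\<^sup>2 - 2 * t * (cmod ?z)\<^sup>2 + t\<^sup>2 * (cmod ?z)\<^sup>2 * ?b\<^sup>2" for t :: real
  proof -
    have "0 \<le> (L2_norm M (\<lambda>x. f x - (of_real t * ?z) * g x))\<^sup>2" by simp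
    also have "\<dots> = ?a\<^sup>2 - 2 * Re (cnj (of_real t * ?z) * ?z) + (cmod (of_real t * ?z) * ?b)\<^sup>2"
      using L2_norm_diff_square[OF assms(1) L2_scale[OF assms(2), of "of_real t * ?z"]]
      by (simp only: L2_inner_scale_right L2_norm_scale)
    also have "cnj (of_real t * ?z) * ?z = of_real (t * (cmod ?z)\<^sup>2)"
      by (simp add: complex_norm_square mult_ac del: of_real_power)
    finally show ?thesis by (simp add: norm_mult power_mult_distrib)
  qed
  show ?thesis
  proof (cases "?z = 0")
    case True then show ?thesis by (simp add: L2_norm_nonneg)
  next
    case False
    then have zpos: "(cmod ?z)\<^sup>2 > 0" by simp
    have "?b \<noteq> 0"
    proof
      assume "?b = 0"
      \<comment> \<open>With \<open>?b = 0\<close> the bound is linear in \<open>t\<close>, and this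
        \<open>t\<close> makes its right-hand side equal to -1.\<close>
      with quad[of "(?a\<^sup>2 + 1) / (2 * (cmod ?z)\<^sup>2)"] zpos show False by (simp add: field_simps)
    qed
    then have bpos: "?b\<^sup>2 > 0" by simp
    have "(1 / ?b\<^sup>2)\<^sup>2 * (cmod ?z)\<^sup>2 * ?b\<^sup>2 = (cmod ?z)\<^sup>2 / ?b\<^sup>2"
      using bpos by (simp add: power2_eq_square)
    then have "0 \<le> ?a\<^sup>2 - (cmod ?z)\<^sup>2 / ?b\<^sup>2"
      using quad[of "1 / ?b\<^sup>2"] by simp
    then have "(cmod ?z)\<^sup>2 \<le> (?a * ?b)\<^sup>2"
      using bpos by (simp add: field_simps power_mult_distrib)
    then show ?thesis
      by (rule power2_le_imp_le) (simp add: L2_norm_nonneg)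
  qed
qed

lemma L2_norm_triangle:
  assumes "f \<in> L2 M" "g \<in> L2 M"
  shows "L2_norm M (\<lambda>x. f x + g x) \<le> L2_norm M f + L2_norm M g"
proof (rule power2_le_imp_le)
  have "Re (L2_inner M f g) \<le> L2_norm M f * L2_norm M g"
    using L2_Cauchy_Schwarz[OF assms] complex_Re_le_cmod order_trans by blast
  then show "(L2_norm M (\<lambda>x. f x + g x))\<^sup>2 \<le> (L2_norm M f + L2_norm M g)\<^sup>2"
    unfolding L2_norm_add_square[OF assms] by (simp add: power2_sum)
qed (simp add: L2_norm_nonneg)

lemma L2_norm_triangle_diff:
  assumes "f \<in> L2 M" "g \<in> L2 M" "h \<in> L2 M"
  shows "L2_norm M (\<lambda>x. f x - h x) \<le> L2_norm M (\<lambda>x. f x - g x) + L2_norm M (\<lambda>x. g x - h x)"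
  using L2_norm_triangle[OF L2_diff[OF assms(1,2)] L2_diff[OF assms(2,3)]] by simp

lemma L2_norm_diff_bound:
  assumes "f \<in> L2 M" "g \<in> L2 M"
  shows "\<bar>L2_norm M f - L2_norm M g\<bar> \<le> L2_norm M (\<lambda>x. f x - g x)"
  using L2_norm_triangle_diff[OF assms L2_zero] L2_norm_triangle_diff[OF assms(2,1) L2_zero]
    L2_norm_minus_commute[of M f g] by simp

lemma L2_norm_tendsto:
  assumes "\<And>n. u n \<in> L2 M" "v \<in> L2 M" "(\<lambda>n. L2_norm M (\<lambda>x. u n x - v x)) \<longlonglongrightarrow> 0"
  shows "(\<lambda>n. L2_norm M (u n)) \<longlonglongrightarrow> L2_norm M v"
proof (rule LIM_zero_cancel, rule Lim_null_comparison[OF _ assms(3)])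
  show "\<forall>\<^sub>F n in sequentially. norm (L2_norm M (u n) - L2_norm M v) \<le> L2_norm M (\<lambda>x. u n x - v x)"
    using L2_norm_diff_bound[OF assms(1,2)] by simp
qed

lemma L2_inner_tendsto:
  assumes "\<And>n. u n \<in> L2 M" "v \<in> L2 M" "(\<lambda>n. L2_norm M (\<lambda>x. u n x - v x)) \<longlonglongrightarrow> 0" "h \<in> L2 M"
  shows "(\<lambda>n. L2_inner M (u n) h) \<longlonglongrightarrow> L2_inner M v h"
proof (rule LIM_zero_cancel, rule Lim_null_comparison)
  show "\<forall>\<^sub>F n in sequentially. norm (L2_inner M (u n) h - L2_inner M v h)
      \<le> L2_norm M (\<lambda>x. u n x - v x) * L2_norm M h"
    using L2_Cauchy_Schwarz[OF L2_diff[OF assms(1,2)] assms(4)]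
    by (simp add: L2_inner_diff_left assms)
  show "(\<lambda>n. L2_norm M (\<lambda>x. u n x - v x) * L2_norm M h) \<longlonglongrightarrow> 0"
    using tendsto_mult_left_zero[OF assms(3)] .
qed

lemma (in finite_measure) L2_integral_norm_le:
  assumes "f \<in> L2 M"
  shows "(LINT x|M. cmod (f x)) \<le> sqrt (measure M (space M)) * L2_norm M f"
proof -
  have f: "(\<lambda>x. of_real (cmod (f x))) \<in> L2 M"
    using assms by (auto simp: L2_def)
  have "(LINT x|M. cmod (f x)) \<le> cmod (of_real (LINT x|M. cmod (f x)))"
    by simp
  also have "complex_of_real (LINT x|M. cmod (f x)) = L2_inner M (\<lambda>x. of_real (cmod (f x))) (\<lambda>x. 1)"
    by (simp add: L2_inner_def)
  also have "cmod \<dots> \<le> L2_norm M (\<lambda>x. of_real (cmod (f x))) * L2_norm M (\<lambda>x. 1)"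
    by (rule L2_Cauchy_Schwarz[OF f L2_const])
  also have "\<dots> = sqrt (measure M (space M)) * L2_norm M f"
    by (simp add: L2_norm_def)
  finally show ?thesis .
qed

text \<open>Fatou's lemma for the squares. It serves completeness, where only an a.e. convergent
  subsequence is at hand and the limit is not yet known to be square integrable.\<close>

lemma L2_Fatou:
  assumes u: "\<And>n. u n \<in> L2 M" and v: "v \<in> borel_measurable M"
    and lim: "AE x in M. (\<lambda>n. u n x) \<longlonglongrightarrow> v x"
    and le: "\<And>n. L2_norm M (u n) \<le> B"
  shows "v \<in> L2 M" "L2_norm M v \<le> B"
proof -
  have [measurable]: "\<And>n. u n \<in> borel_measurable M" "v \<in> borel_measurable M"
    using u v by (auto simp: L2_def)
  have B: "0 \<le> B" using le[of 0] L2_norm_nonneg[of M "u 0"] by linarith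
  have eq: "(\<integral>\<^sup>+x. ennreal ((cmod (u n x))\<^sup>2) \<partial>M) = ennreal ((L2_norm M (u n))\<^sup>2)" for n
    unfolding L2_norm_square by (rule nn_integral_eq_integral[OF L2_square_integrable[OF u]]) simp
  have "(\<integral>\<^sup>+x. ennreal ((cmod (v x))\<^sup>2) \<partial>M) = (\<integral>\<^sup>+x. liminf (\<lambda>n. ennreal ((cmod (u n x))\<^sup>2)) \<partial>M)"
  proof (rule nn_integral_cong_AE)
    show "AE x in M. ennreal ((cmod (v x))\<^sup>2) = liminf (\<lambda>n. ennreal ((cmod (u n x))\<^sup>2))"
      using lim
    proof eventually_elim
      case (elim x)
      then have "(\<lambda>n. ennreal ((cmod (u n x))\<^sup>2)) \<longlonglongrightarrow> ennreal ((cmod (v x))\<^sup>2)"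
        by (intro tendsto_intros)
      then show ?case
        using lim_imp_Liminf by force
    qed
  qed
  also have "\<dots> \<le> liminf (\<lambda>n. \<integral>\<^sup>+x. ennreal ((cmod (u n x))\<^sup>2) \<partial>M)"
    by (rule nn_integral_liminf) simp
  also have "\<dots> \<le> ennreal (B\<^sup>2)"
    unfolding eq using le
    by (intro order_trans[OF Liminf_le_Limsup] Limsup_bounded)
       (auto intro!: always_eventually ennreal_leI power_mono L2_norm_nonneg)
  finally have *: "(\<integral>\<^sup>+x. ennreal ((cmod (v x))\<^sup>2) \<partial>M) \<le> ennreal (B\<^sup>2)" .
  then show v2: "v \<in> L2 M"
    unfolding L2_def by (auto intro!: integrableI_bounded simp: v order_le_less_trans[OF *])
  have "ennreal ((L2_norm M v)\<^sup>2) \<le> ennreal (B\<^sup>2)"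
    using * unfolding L2_norm_square nn_integral_eq_integral[OF L2_square_integrable[OF v2], simplified]
    by simp
  then show "L2_norm M v \<le> B"
    using B by (simp add: power2_le_iff_abs_le L2_norm_nonneg)
qed

text \<open>The last conclusion holds at every point, not just almost everywhere. It is what makes
  an L2 limit of uniformly bounded kernels a bounded kernel again.\<close>

lemma (in finite_measure) L2_complete:
  assumes u: "\<And>n. u n \<in> L2 M"
    and cauchy: "\<And>e. e > 0 \<Longrightarrow> \<exists>N. \<forall>m\<ge>N. \<forall>n\<ge>N. L2_norm M (\<lambda>x. u m x - u n x) < e"
  obtains v where "v \<in> L2 M" "(\<lambda>n. L2_norm M (\<lambda>x. u n x - v x)) \<longlonglongrightarrow> 0"
    "\<And>x C. (\<And>n. cmod (u n x) \<le> C) \<Longrightarrow> cmod (v x) \<le> C"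
proof -
  have [measurable]: "\<And>n. u n \<in> borel_measurable M"
    using u by (auto simp: L2_def)
  define S where "S = sqrt (measure M (space M)) + 1"
  have S: "S > 0" by (simp add: S_def add_nonneg_pos)
  have "\<exists>N. \<forall>i\<ge>N. \<forall>j\<ge>N. (LINT x|M. cmod (u i x - u j x)) < e" if "e > 0" for e
  proof -
    obtain N where N: "\<And>m n. m \<ge> N \<Longrightarrow> n \<ge> N \<Longrightarrow> L2_norm M (\<lambda>x. u m x - u n x) < e / S"
      using cauchy[of "e / S"] \<open>e > 0\<close> S by auto
    have "(LINT x|M. cmod (u i x - u j x)) < e" if "i \<ge> N" "j \<ge> N" for i j
    proof -
      have "(LINT x|M. cmod (u i x - u j x)) \<le> sqrt (measure M (space M)) * L2_norm M (\<lambda>x. u i x - u j x)"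
        by (rule L2_integral_norm_le[OF L2_diff[OF u u]])
      also have "\<dots> \<le> S * L2_norm M (\<lambda>x. u i x - u j x)"
        by (intro mult_right_mono) (auto simp: S_def L2_norm_nonneg)
      also have "\<dots> < e"
        using N[OF that] S by (simp add: field_simps)
      finally show ?thesis .
    qed
    then show ?thesis by blast
  qed
  then obtain r where r: "strict_mono r" "AE x in M. Cauchy (\<lambda>i. u (r i) x)"
    using cauchy_L1_AE_cauchy_subseq[of M u, OF L2_integrable[OF u]] by metis
  \<comment> \<open>Outside the set of convergence the value 0 respects every bound that the
    sequence obeys.\<close>
  define v where "v x = (if Cauchy (\<lambda>i. u (r i) x) then lim (\<lambda>i. u (r i) x) else 0)" for x
  have [measurable]: "v \<in> borel_measurable M"
    unfolding v_def by measurable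
  have conv: "AE x in M. (\<lambda>i. u (r i) x) \<longlonglongrightarrow> v x"
    using r(2) by eventually_elim (auto simp: v_def Cauchy_convergent_iff convergent_LIMSEQ_iff)
  \<comment> \<open>Fatou along the shifted subsequence \<open>r (i + N)\<close> turns the Cauchy
    estimate for \<open>u\<close> into an estimate for the distance to \<open>v\<close>.\<close>
  have close: "(\<lambda>x. u n x - v x) \<in> L2 M \<and> L2_norm M (\<lambda>x. u n x - v x) \<le> e"
    if N: "\<And>m. m \<ge> N \<Longrightarrow> L2_norm M (\<lambda>x. u n x - u m x) < e" for n N e
  proof -
    have "r (i + N) \<ge> N" for i
      using seq_suble[OF r(1), of "i + N"] by simp
    then have 1: "L2_norm M (\<lambda>x. u n x - u (r (i + N)) x) \<le> e" for i
      using N[of "r (i + N)"] by (simp add: less_imp_le)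
    have 2: "AE x in M. (\<lambda>i. u n x - u (r (i + N)) x) \<longlonglongrightarrow> u n x - v x"
      using conv by eventually_elim (intro tendsto_intros LIMSEQ_ignore_initial_segment)
    show ?thesis
      using L2_Fatou[OF L2_diff[OF u u] _ 2 1] by simp
  qed
  have v: "v \<in> L2 M"
  proof -
    obtain N where "\<forall>m\<ge>N. \<forall>n\<ge>N. L2_norm M (\<lambda>x. u m x - u n x) < 1"
      using cauchy[of 1] by auto
    then have "(\<lambda>x. u N x - v x) \<in> L2 M"
      using close[of N N 1] by simp
    from L2_diff[OF u[of N] this] show ?thesis by simp
  qed
  moreover have "(\<lambda>n. L2_norm M (\<lambda>x. u n x - v x)) \<longlonglongrightarrow> 0"
  proof (rule LIMSEQ_I)
    fix e :: real assume "e > 0"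
    then obtain N where N: "\<forall>m\<ge>N. \<forall>n\<ge>N. L2_norm M (\<lambda>x. u m x - u n x) < e / 2"
      using cauchy[of "e / 2"] by auto
    have "norm (L2_norm M (\<lambda>x. u n x - v x) - 0) < e" if "n \<ge> N" for n
      using close[of N n "e / 2"] N that \<open>e > 0\<close> by (simp add: L2_norm_nonneg)
    then show "\<exists>N. \<forall>n\<ge>N. norm (L2_norm M (\<lambda>x. u n x - v x) - 0) < e" by blast
  qed
  moreover have "cmod (v x) \<le> C" if C: "\<And>n. cmod (u n x) \<le> C" for x C
  proof (cases "Cauchy (\<lambda>i. u (r i) x)")
    case True
    then have "(\<lambda>i. u (r i) x) \<longlonglongrightarrow> v x"
      by (simp add: v_def Cauchy_convergent_iff convergent_LIMSEQ_iff)
    then show ?thesis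
      by (intro LIMSEQ_le_const2[OF tendsto_norm[of "\<lambda>i. u (r i) x"]]) (auto simp: C)
  next
    case False
    then show ?thesis using order_trans[OF norm_ge_zero C] by (simp add: v_def)
  qed
  ultimately show ?thesis by (rule that)
qed

section \<open>Systems and their products\<close>

lemma second_countableE:
  assumes "second_countable X"
  obtains \<B> where "countable \<B>" "\<And>V. V \<in> \<B> \<Longrightarrow> openin X V"
    "\<And>U x. openin X U \<Longrightarrow> x \<in> U \<Longrightarrow> \<exists>V\<in>\<B>. x \<in> V \<and> V \<subseteq> U"
proof -
  obtain \<B> where *: "countable \<B> \<and> (\<forall>V\<in>\<B>. openin X V) \<and>
      (\<forall>U x. openin X U \<and> x \<in> U \<longrightarrow> (\<exists>V\<in>\<B>. x \<in> V \<and> V \<subseteq> U))"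
    using assms unfolding second_countable_def by (rule exE)
  show thesis
    by (rule that[of \<B>]) (use * in simp_all)
qed

text \<open>A point is coded by the set of indices of the base members that contain it. Injectivity
  is all that is asked of the map: its image will receive the transported structure, not the one of
  the reals.\<close>

lemma standard_borel_embedding:
  assumes "standard_borel M"
  obtains e :: "'x \<Rightarrow> real" where "inj_on e (space M)"
proof -
  obtain \<tau> where \<tau>: "topspace \<tau> = space M" "completely_metrizable_space \<tau>" "second_countable \<tau>"
    using assms unfolding standard_borel_def by blast
  have haus: "Hausdorff_space \<tau>"
    by (simp add: \<tau>(2) completely_metrizable_imp_metrizable_space metrizable_imp_Hausdorff_space)
  obtain \<B> where \<B>: "countable \<B>" "\<And>V. V \<in> \<B> \<Longrightarrow> openin \<tau> V"
    "\<And>U x. openin \<tau> U \<Longrightarrow> x \<in> U \<Longrightarrow> \<exists>V\<in>\<B>. x \<in> V \<and> V \<subseteq> U"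
    using second_countableE[OF \<tau>(3)] by metis
  define d where "d x = to_nat_on \<B> ` {V \<in> \<B>. x \<in> V}" for x
  have "inj_on d (space M)"
  proof (rule inj_onI, rule ccontr)
    fix x y assume xy: "x \<in> space M" "y \<in> space M" "d x = d y" "x \<noteq> y"
    then obtain U V where UV: "openin \<tau> U" "openin \<tau> V" "x \<in> U" "y \<in> V" "disjnt U V"
      using haus \<tau>(1) unfolding Hausdorff_space_def by metis
    then obtain W where W: "W \<in> \<B>" "x \<in> W" "W \<subseteq> U" using \<B>(3) by blast
    then have "to_nat_on \<B> W \<in> d y" using xy(3) unfolding d_def by auto
    then obtain W' where "W' \<in> \<B>" "y \<in> W'" "to_nat_on \<B> W' = to_nat_on \<B> W"
      unfolding d_def by auto
    then have "y \<in> W" using \<B>(1) W(1) by (metis from_nat_into_to_nat_on)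
    then show False using W UV by (auto simp: disjnt_def)
  qed
  moreover obtain s :: "nat set \<Rightarrow> real" where "inj s"
    using nat_sets_eqpoll_reals unfolding eqpoll_def bij_betw_def by blast
  ultimately have "inj_on (s \<circ> d) (space M)"
    by (meson comp_inj_on inj_on_subset subset_UNIV)
  then show ?thesis by (rule that)
qed

text \<open>The pullback of the topology along the inverse of \<open>e\<close> makes
  \<open>e\<close> a homeomorphism onto its image, so complete metrizability and second countability
  carry over. The sigma algebra of the image is pulled back in the same way and is generated by the
  new open sets.\<close>

lemma standard_borel_inj_image:
  assumes M: "standard_borel M" and e: "inj_on e (space M)"
  shows "standard_borel (distr M (vimage_algebra (e ` space M) (inv_into (space M) e) M) e)"
proof -
  obtain \<tau> where \<tau>: "topspace \<tau> = space M" "completely_metrizable_space \<tau>" "second_countable \<tau>"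
      "sets M = sigma_sets (space M) {U. openin \<tau> U}"
    using M unfolding standard_borel_def by blast
  define d where "d = inv_into (space M) e"
  define X where "X = e ` space M"
  have de [simp]: "\<And>x. x \<in> space M \<Longrightarrow> d (e x) = x" using e by (simp add: d_def)
  have d: "d \<in> X \<rightarrow> space M" using e by (auto simp: X_def)
  define \<tau>' where "\<tau>' = pullback_topology X d \<tau>"
  have top: "topspace \<tau>' = X"
    using d by (auto simp: \<tau>'_def topspace_pullback_topology \<tau>(1))
  have eX: "\<And>x. x \<in> space M \<Longrightarrow> e x \<in> X" by (simp add: X_def)
  have "homeomorphic_maps \<tau> \<tau>' e d"
    unfolding homeomorphic_maps_def
  proof (intro conjI)
    have "topspace \<tau> \<inter> e -` (d -` U \<inter> X) = U" if "openin \<tau> U" for U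
      using openin_subset[OF that] eX by (auto simp: \<tau>(1))
    then show "continuous_map \<tau> \<tau>' e"
      unfolding \<tau>'_def by (intro continuous_map_pullback')
        (auto simp: \<tau>(1) X_def o_def intro: continuous_map_eq[of \<tau> \<tau> "\<lambda>x. x"])
    show "continuous_map \<tau>' \<tau> d"
      using continuous_map_pullback[of \<tau> \<tau> id X d] unfolding \<tau>'_def by simp
  qed (auto simp: top \<tau>(1) X_def)
  then have h: "\<tau> homeomorphic_space \<tau>'"
    unfolding homeomorphic_space_def by blast
  have "sets (vimage_algebra X d M) = {d -` A \<inter> X | A. A \<in> sets M}"
    using d by (rule sets_vimage_algebra2)
  also have "\<dots> = sigma_sets X {d -` A \<inter> X | A. A \<in> {U. openin \<tau> U}}"
    unfolding \<tau>(4) using sigma_sets_vimage_commute[OF d] by simp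
  also have "{d -` A \<inter> X | A. A \<in> {U. openin \<tau> U}} = {U. openin \<tau>' U}"
    by (auto simp: \<tau>'_def openin_pullback_topology)
  finally have "sets (vimage_algebra X d M) = sigma_sets X {U. openin \<tau>' U}" .
  then show ?thesis
    unfolding standard_borel_def using h \<tau>(2,3) top
    by (intro exI[of _ \<tau>']) (simp flip: X_def d_def add: homeomorphic_completely_metrizable_space
        homeomorphic_space_second_countability)
qed

text \<open>That open sets of the product are product measurable is where second countability acts:
  such a set is a countable union of open rectangles.\<close>

lemma sigma_sets_prod_topology:
  assumes sc: "second_countable \<tau>\<^sub>1" "second_countable \<tau>\<^sub>2"
    and M: "topspace \<tau>\<^sub>1 = space M" "sets M = sigma_sets (space M) {U. openin \<tau>\<^sub>1 U}"
    and N: "topspace \<tau>\<^sub>2 = space N" "sets N = sigma_sets (space N) {U. openin \<tau>\<^sub>2 U}"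
  shows "second_countable (prod_topology \<tau>\<^sub>1 \<tau>\<^sub>2)" (is ?sc)
    and "sets (M \<Otimes>\<^sub>M N) = sigma_sets (space (M \<Otimes>\<^sub>M N)) {U. openin (prod_topology \<tau>\<^sub>1 \<tau>\<^sub>2) U}" (is ?sets)
proof -
  let ?\<tau> = "prod_topology \<tau>\<^sub>1 \<tau>\<^sub>2"
  obtain \<B>\<^sub>1 where B1: "countable \<B>\<^sub>1" "\<And>V. V \<in> \<B>\<^sub>1 \<Longrightarrow> openin \<tau>\<^sub>1 V"
    "\<And>U x. openin \<tau>\<^sub>1 U \<Longrightarrow> x \<in> U \<Longrightarrow> \<exists>V\<in>\<B>\<^sub>1. x \<in> V \<and> V \<subseteq> U"
    using second_countableE[OF sc(1)] by metis
  obtain \<B>\<^sub>2 where B2: "countable \<B>\<^sub>2" "\<And>V. V \<in> \<B>\<^sub>2 \<Longrightarrow> openin \<tau>\<^sub>2 V"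
    "\<And>U x. openin \<tau>\<^sub>2 U \<Longrightarrow> x \<in> U \<Longrightarrow> \<exists>V\<in>\<B>\<^sub>2. x \<in> V \<and> V \<subseteq> U"
    using second_countableE[OF sc(2)] by metis
  define \<B> where "\<B> = (\<lambda>(a, b). a \<times> b) ` (\<B>\<^sub>1 \<times> \<B>\<^sub>2)"
  have cB: "countable \<B>" using B1(1) B2(1) by (auto simp: \<B>_def)
  have oB: "openin ?\<tau> V" if "V \<in> \<B>" for V
    using that B1(2) B2(2) by (auto simp: \<B>_def openin_prod_Times_iff)
  have bB: "\<exists>V\<in>\<B>. z \<in> V \<and> V \<subseteq> W" if W: "openin ?\<tau> W" "z \<in> W" for W z
  proof -
    obtain x y where z: "z = (x, y)" by (cases z)
    obtain U V where UV: "openin \<tau>\<^sub>1 U" "openin \<tau>\<^sub>2 V" "x \<in> U" "y \<in> V" "U \<times> V \<subseteq> W"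
      using W unfolding z by (metis openin_prod_topology_alt)
    obtain U' where U': "U' \<in> \<B>\<^sub>1" "x \<in> U'" "U' \<subseteq> U" using B1(3) UV by blast
    obtain V' where V': "V' \<in> \<B>\<^sub>2" "y \<in> V'" "V' \<subseteq> V" using B2(3) UV by blast
    have "U' \<times> V' \<in> \<B>" using U' V' by (auto simp: \<B>_def)
    moreover have "z \<in> U' \<times> V'" "U' \<times> V' \<subseteq> W" using U'(2,3) V'(2,3) UV(5) z by auto
    ultimately show ?thesis by (intro bexI[of _ "U' \<times> V'"] conjI)
  qed
  show ?sc
    unfolding second_countable_def using cB oB bB by (intro exI[of _ \<B>]) simp
  have sp: "space (M \<Otimes>\<^sub>M N) = topspace ?\<tau>" by (simp add: space_pair_measure M N)
  show ?sets
  proof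
    have "U \<in> sets (M \<Otimes>\<^sub>M N)" if U: "openin ?\<tau> U" for U
    proof -
      have "\<B> \<subseteq> sets (M \<Otimes>\<^sub>M N)"
        using B1(2) B2(2) by (auto simp: \<B>_def M N intro!: pair_measureI sigma_sets.Basic)
      moreover have "U = \<Union>{V\<in>\<B>. V \<subseteq> U}" using bB[OF U] by blast
      moreover have "countable {V\<in>\<B>. V \<subseteq> U}" using cB by (rule countable_subset[rotated]) auto
      ultimately show ?thesis
        using sets.countable_Union[of "{V\<in>\<B>. V \<subseteq> U}" "M \<Otimes>\<^sub>M N"] by auto
    qed
    then show "sigma_sets (space (M \<Otimes>\<^sub>M N)) {U. openin ?\<tau> U} \<subseteq> sets (M \<Otimes>\<^sub>M N)"
      by (intro sets.sigma_sets_subset) auto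
    \<comment> \<open>For the other inclusion, both projections are measurable on the Borel algebra
      \<open>S\<close> of the product topology; hence so is the identity, as a map from
      \<open>S\<close> to the product algebra.\<close>
    define S where "S = sigma (topspace ?\<tau>) {U. openin ?\<tau> U}"
    have Pow: "{U. openin ?\<tau> U} \<subseteq> Pow (topspace ?\<tau>)" using openin_subset by blast
    have [simp]: "space S = topspace ?\<tau>" unfolding S_def by (rule space_measure_of[OF Pow])
    have setsS: "sets S = sigma_sets (topspace ?\<tau>) {U. openin ?\<tau> U}"
      unfolding S_def by (rule sets_measure_of[OF Pow])
    have 1: "fst \<in> S \<rightarrow>\<^sub>M M"
    proof (rule measurable_sigma_sets[OF M(2)])
      fix A assume "A \<in> {U. openin \<tau>\<^sub>1 U}"
      then have "openin ?\<tau> (A \<times> topspace \<tau>\<^sub>2)" by (simp add: openin_prod_Times_iff)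
      moreover have "fst -` A \<inter> space S = A \<times> topspace \<tau>\<^sub>2"
        using openin_subset[of \<tau>\<^sub>1 A] \<open>A \<in> _\<close> by auto
      ultimately show "fst -` A \<inter> space S \<in> sets S" unfolding setsS by auto
    qed (use openin_subset[of \<tau>\<^sub>1] M(1) in auto)
    have 2: "snd \<in> S \<rightarrow>\<^sub>M N"
    proof (rule measurable_sigma_sets[OF N(2)])
      fix A assume "A \<in> {U. openin \<tau>\<^sub>2 U}"
      then have "openin ?\<tau> (topspace \<tau>\<^sub>1 \<times> A)" by (simp add: openin_prod_Times_iff)
      moreover have "snd -` A \<inter> space S = topspace \<tau>\<^sub>1 \<times> A"
        using openin_subset[of \<tau>\<^sub>2 A] \<open>A \<in> _\<close> by auto
      ultimately show "snd -` A \<inter> space S \<in> sets S" unfolding setsS by auto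
    qed (use openin_subset[of \<tau>\<^sub>2] N(1) in auto)
    have "(\<lambda>z. (fst z, snd z)) \<in> S \<rightarrow>\<^sub>M M \<Otimes>\<^sub>M N"
      using 1 2 by (rule measurable_Pair)
    then have "A \<in> sets S" if "A \<in> sets (M \<Otimes>\<^sub>M N)" for A
    proof -
      have "(\<lambda>z. (fst z, snd z)) -` A \<inter> space S = A"
        using sets.sets_into_space[OF that] sp by auto
      with measurable_sets[OF \<open>(\<lambda>z. (fst z, snd z)) \<in> S \<rightarrow>\<^sub>M M \<Otimes>\<^sub>M N\<close> that] show ?thesis by simp
    qed
    then show "sets (M \<Otimes>\<^sub>M N) \<subseteq> sigma_sets (space (M \<Otimes>\<^sub>M N)) {U. openin ?\<tau> U}"
      using setsS sp by auto
  qed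
qed

lemma standard_borel_pair:
  assumes "standard_borel M" "standard_borel N"
  shows "standard_borel (M \<Otimes>\<^sub>M N)"
proof -
  obtain \<tau>\<^sub>1 where 1: "topspace \<tau>\<^sub>1 = space M" "completely_metrizable_space \<tau>\<^sub>1" "second_countable \<tau>\<^sub>1"
      "sets M = sigma_sets (space M) {U. openin \<tau>\<^sub>1 U}"
    using assms(1) unfolding standard_borel_def by blast
  obtain \<tau>\<^sub>2 where 2: "topspace \<tau>\<^sub>2 = space N" "completely_metrizable_space \<tau>\<^sub>2" "second_countable \<tau>\<^sub>2"
      "sets N = sigma_sets (space N) {U. openin \<tau>\<^sub>2 U}"
    using assms(2) unfolding standard_borel_def by blast
  show ?thesis
    unfolding standard_borel_def
    using sigma_sets_prod_topology[OF 1(3) 2(3) 1(1,4) 2(1,4)] 1(1,2) 2(1,2)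
    by (intro exI[of _ "prod_topology \<tau>\<^sub>1 \<tau>\<^sub>2"])
      (auto simp: completely_metrizable_space_prod_topology space_pair_measure)
qed

lemma mpsD:
  assumes "mps M T"
  shows "prob_space M" "standard_borel M" "(\<lambda>(j, x). T j x) \<in> borel \<Otimes>\<^sub>M M \<rightarrow>\<^sub>M M"
    "\<And>x. x \<in> space M \<Longrightarrow> T 0 x = x"
    "\<And>i j x. x \<in> space M \<Longrightarrow> T (i + j) x = T i (T j x)"
    "\<And>j. distr M M (T j) = M"
  using assms unfolding mps_def by blast+

lemma mps_measurable:
  assumes "mps M T"
  shows "T j \<in> M \<rightarrow>\<^sub>M M"
proof -
  have "(\<lambda>x. (\<lambda>(j, x). T j x) (j, x)) \<in> M \<rightarrow>\<^sub>M M"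
    using mpsD(3)[OF assms] by measurable
  then show ?thesis by simp
qed

lemma mps_pair:
  assumes "mps M T"
  shows "mps (M \<Otimes>\<^sub>M M) (\<lambda>j (x, y). (T j x, T j y))"
proof -
  interpret prob_space M using mpsD(1)[OF assms] .
  interpret P: pair_prob_space M M ..
  have [measurable]: "T j \<in> M \<rightarrow>\<^sub>M M" for j by (rule mps_measurable[OF assms])
  note [measurable] = mpsD(3)[OF assms]
  have eq: "T j x = (\<lambda>(j, x). T j x) (j, x)" for j x by simp
  have "(\<lambda>z. ((\<lambda>(j, x). T j x) (fst z, fst (snd z)), (\<lambda>(j, x). T j x) (fst z, snd (snd z))))
      \<in> borel \<Otimes>\<^sub>M (M \<Otimes>\<^sub>M M) \<rightarrow>\<^sub>M M \<Otimes>\<^sub>M M"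
    by measurable
  then have m: "(\<lambda>(j, x, y). (T j x, T j y)) \<in> borel \<Otimes>\<^sub>M (M \<Otimes>\<^sub>M M) \<rightarrow>\<^sub>M M \<Otimes>\<^sub>M M"
    by (simp add: case_prod_beta')
  have "distr (M \<Otimes>\<^sub>M M) (M \<Otimes>\<^sub>M M) (\<lambda>(x, y). (T j x, T j y)) = M \<Otimes>\<^sub>M M" for j
    using pair_measure_distr[of "T j" M M "T j" M M] mpsD(6)[OF assms, of j]
    by (simp add: prob_space_imp_sigma_finite prob_space_axioms)
  then show ?thesis
    unfolding mps_def using m standard_borel_pair[OF mpsD(2)[OF assms] mpsD(2)[OF assms]]
    by (auto simp: space_pair_measure mpsD(4,5)[OF assms] case_prod_beta' P.prob_space_axioms)
qed

lemma mps_space: "mps M T \<Longrightarrow> x \<in> space M \<Longrightarrow> T j x \<in> space M"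
  using mps_measurable[of M T j] by (simp add: measurable_space)

text \<open>Systems carried by a set of reals suffice: the points of a second countable Hausdorff space are
  separated by a countable base, so they inject into the reals.\<close>

lemma pointwise_ergodic_seqD:
  fixes T :: "'g::topological_ab_group_add \<Rightarrow> 'x \<Rightarrow> 'x" and f :: "'x \<Rightarrow> complex"
  assumes F: "pointwise_ergodic_seq \<nu> F" and T: "ergodic_mps M T" and f: "integrable M f"
  shows "AE x in M. generic_point \<nu> F M T f x"
proof -
  have mps: "mps M T" and erg: "ergodic M T" using T by (auto simp: ergodic_mps_def)
  obtain e :: "'x \<Rightarrow> real" where e: "inj_on e (space M)"
    using standard_borel_embedding[OF mpsD(2)[OF mps]] by blast
  define d where "d = inv_into (space M) e"
  define X where "X = e ` space M"
  have de [simp]: "\<And>x. x \<in> space M \<Longrightarrow> d (e x) = x" using e by (simp add: d_def)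
  have dX: "d \<in> X \<rightarrow> space M" using e by (auto simp: X_def)
  define \<Sigma> where "\<Sigma> = vimage_algebra X d M"
  define M' where "M' = distr M \<Sigma> e"
  define T' where "T' j r = e (T j (d r))" for j r
  have [measurable_cong]: "sets M' = sets \<Sigma>" by (simp add: M'_def)
  have sp: "space M' = X" "space \<Sigma> = X" by (simp_all add: M'_def \<Sigma>_def)
  have e_m [measurable]: "e \<in> M \<rightarrow>\<^sub>M \<Sigma>"
    unfolding \<Sigma>_def by (rule measurable_vimage_algebra2) (auto simp: X_def cong: measurable_cong)
  have d_m [measurable]: "d \<in> \<Sigma> \<rightarrow>\<^sub>M M"
    unfolding \<Sigma>_def by (rule measurable_vimage_algebra1[OF dX])
  have T_m [measurable]: "T j \<in> M \<rightarrow>\<^sub>M M" for j by (rule mps_measurable[OF mps])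
  note [measurable] = mpsD(3)[OF mps]
  have Tsp: "\<And>x j. x \<in> space M \<Longrightarrow> T j x \<in> space M" using mps_space[OF mps] .
  have "mps M' T'"
    unfolding mps_def
  proof (intro conjI allI ballI)
    show "prob_space M'" unfolding M'_def using mpsD(1)[OF mps] e_m by (rule prob_space.prob_space_distr)
    show "standard_borel M'"
      unfolding M'_def \<Sigma>_def X_def d_def using mpsD(2)[OF mps] e by (rule standard_borel_inj_image)
    have "(\<lambda>z. e ((\<lambda>(j, x). T j x) (fst z, d (snd z)))) \<in> borel \<Otimes>\<^sub>M M' \<rightarrow>\<^sub>M M'"
      by measurable
    then show "(\<lambda>(j, r). T' j r) \<in> borel \<Otimes>\<^sub>M M' \<rightarrow>\<^sub>M M'"
      by (simp add: T'_def case_prod_beta')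
    show "T' 0 r = r" if "r \<in> space M'" for r
      using that by (auto simp: sp X_def T'_def mpsD(4)[OF mps])
    show "T' (i + j) r = T' i (T' j r)" if "r \<in> space M'" for i j r
      using that by (auto simp: sp X_def T'_def mpsD(5)[OF mps] Tsp)
    show "distr M' M' (T' j) = M'" for j
    proof -
      have [measurable]: "T' j \<in> \<Sigma> \<rightarrow>\<^sub>M \<Sigma>" unfolding T'_def[abs_def] by measurable
      have "distr M' M' (T' j) = distr M' \<Sigma> (T' j)" by (rule distr_cong) (auto simp: M'_def)
      also have "\<dots> = distr M \<Sigma> (T' j \<circ> e)" unfolding M'_def by (rule distr_distr) measurable
      also have "\<dots> = distr M \<Sigma> (e \<circ> T j)" by (rule distr_cong) (auto simp: T'_def)
      also have "\<dots> = distr (distr M M (T j)) \<Sigma> e" by (rule distr_distr[symmetric]) measurable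
      also have "\<dots> = M'" by (simp add: mpsD(6)[OF mps] M'_def)
      finally show ?thesis .
    qed
  qed
  moreover have "ergodic M' T'"
    unfolding ergodic_def
  proof (intro ballI impI)
    fix A assume A: "A \<in> sets M'" and inv: "\<forall>j. T' j -` A \<inter> space M' = A"
    have A': "A \<in> sets \<Sigma>" using A by (simp add: M'_def)
    let ?A = "e -` A \<inter> space M"
    have "?A \<in> sets M" using A' by simp
    moreover have "T j -` ?A \<inter> space M = ?A" for j
    proof -
      have "e (T j x) \<in> A \<longleftrightarrow> e x \<in> A" if "x \<in> space M" for x
      proof -
        have "e x \<in> T' j -` A \<inter> space M' \<longleftrightarrow> e x \<in> A" using inv by simp
        then show ?thesis using that by (simp add: T'_def sp X_def)
      qed
      then show ?thesis using Tsp by auto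
    qed
    ultimately have "measure M ?A = 0 \<or> measure M ?A = 1"
      using erg unfolding ergodic_def by blast
    then show "measure M' A = 0 \<or> measure M' A = 1"
      using A' by (simp add: M'_def measure_distr)
  qed
  ultimately have "ergodic_mps M' T'" by (simp add: ergodic_mps_def)
  moreover have [measurable]: "f \<in> borel_measurable M" using f by simp
  have "integrable M (\<lambda>x. f (d (e x)))"
    using f by (rule Bochner_Integration.integrable_cong[THEN iffD1, rotated 2]) auto
  then have "integrable M' (\<lambda>r. f (d r))"
    unfolding M'_def by (subst integrable_distr_eq) simp_all
  ultimately have "AE r in M'. generic_point \<nu> F M' T' (\<lambda>r. f (d r)) r"
    using F unfolding pointwise_ergodic_seq_def by blast
  then have "AE x in M. generic_point \<nu> F M' T' (\<lambda>r. f (d r)) (e x)"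
    unfolding M'_def by (rule AE_distrD[OF e_m])
  moreover have "(LINT r|M'. f (d r)) = (LINT x|M. f x)"
  proof -
    have "(LINT r|M'. f (d r)) = (LINT x|M. f (d (e x)))"
      unfolding M'_def by (rule integral_distr) measurable
    also have "\<dots> = (LINT x|M. f x)" by (rule Bochner_Integration.integral_cong) auto
    finally show ?thesis .
  qed
  ultimately show ?thesis
    by (auto simp: generic_point_def T'_def Tsp elim!: AE_mp intro!: AE_I2)
qed

section \<open>Averages along the orbits\<close>

lemma (in prob_space) positive_measure_piece:
  assumes C: "\<And>i. C i \<in> events" and A: "A \<in> events" "prob A > 0" "A \<subseteq> (\<Union>i::nat. C i)"
  obtains i where "prob (A \<inter> C i) > 0"
proof (rule ccontr)
  assume "\<not> thesis"
  then have "prob (A \<inter> C i) = 0" for i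
    using that zero_less_measure_iff by blast
  then have "A \<inter> C i \<in> null_sets M" for i
    using C A(1) by (simp add: null_sets_def emeasure_eq_measure sets.Int)
  then have "(\<Union>i. A \<inter> C i) \<in> null_sets M" by (rule null_sets_UN)
  moreover have "(\<Union>i. A \<inter> C i) = A" using A(3) by auto
  ultimately show False using A(2) by (simp add: measure_eq_0_null_sets)
qed

text \<open>Countably many discs of radius \<open>\<delta> / 2\<close> cover the plane, so the
  preimage of one of them meets the current set in positive measure. This is repeated for each of
  the finitely many functions.\<close>

lemma (in prob_space) small_oscillation:
  fixes b :: "'i \<Rightarrow> 'a \<Rightarrow> complex"
  assumes "finite S" "\<And>i. i \<in> S \<Longrightarrow> b i \<in> borel_measurable M" "\<delta> > 0"
    and "A \<in> events" "prob A > 0"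
  obtains A' where "A' \<in> events" "A' \<subseteq> A" "prob A' > 0"
    "\<And>i x y. i \<in> S \<Longrightarrow> x \<in> A' \<Longrightarrow> y \<in> A' \<Longrightarrow> cmod (b i x - b i y) \<le> \<delta>"
proof -
  have "\<exists>A'. A' \<in> events \<and> A' \<subseteq> A \<and> prob A' > 0 \<and>
      (\<forall>i\<in>S. \<forall>x\<in>A'. \<forall>y\<in>A'. cmod (b i x - b i y) \<le> \<delta>)"
    using assms(1,2)
  proof (induction S rule: finite_induct)
    case empty
    then show ?case using assms(4,5) by auto
  next
    case (insert i S)
    then obtain A' where A': "A' \<in> events" "A' \<subseteq> A" "prob A' > 0"
      "\<And>i x y. i \<in> S \<Longrightarrow> x \<in> A' \<Longrightarrow> y \<in> A' \<Longrightarrow> cmod (b i x - b i y) \<le> \<delta>"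
      by (metis insertCI)
    have [measurable]: "b i \<in> borel_measurable M" "A' \<in> events"
      using insert.prems A'(1) by auto
    obtain D :: "complex set" where D: "countable D" "\<And>X. open X \<Longrightarrow> X \<noteq> {} \<Longrightarrow> \<exists>d\<in>D. d \<in> X"
      using countable_dense_setE[where 'a = complex] by blast
    have "D \<noteq> {}" using D(2)[of UNIV] by auto
    define C where "C n = {x \<in> space M. cmod (b i x - from_nat_into D n) < \<delta> / 2}" for n :: nat
    have "A' \<subseteq> (\<Union>n. C n)"
    proof
      fix x assume x: "x \<in> A'"
      obtain d where "d \<in> D" "d \<in> ball (b i x) (\<delta> / 2)"
        using D(2)[of "ball (b i x) (\<delta> / 2)"] \<open>\<delta> > 0\<close> by auto
      then have "x \<in> C (to_nat_on D d)"
        using D(1) x sets.sets_into_space[OF A'(1)] by (auto simp: C_def dist_norm)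
      then show "x \<in> (\<Union>n. C n)" by blast
    qed
    moreover have C [measurable]: "C n \<in> events" for n unfolding C_def by measurable
    ultimately obtain n where n: "prob (A' \<inter> C n) > 0"
      using positive_measure_piece[of C A'] A' by blast
    have "cmod (b i x - b i y) \<le> \<delta>" if "x \<in> C n" "y \<in> C n" for x y
    proof -
      have "cmod (b i x - b i y) \<le> cmod (b i x - from_nat_into D n) + cmod (b i y - from_nat_into D n)"
        by (metis norm_triangle_ineq4 diff_add_cancel diff_diff_eq2 add_diff_cancel_right)
      then show ?thesis using that by (auto simp: C_def)
    qed
    then show ?case
      using n A' by (intro exI[of _ "A' \<inter> C n"]) auto
  qed
  then show ?thesis using that by blast
qed

lemma distr_pair_snd:
  assumes "prob_space M" "prob_space N"
  shows "distr (M \<Otimes>\<^sub>M N) N snd = N"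
proof (rule measure_eqI)
  interpret M: prob_space M by fact
  interpret N: prob_space N by fact
  fix A assume A: "A \<in> sets (distr (M \<Otimes>\<^sub>M N) N snd)"
  then have "snd -` A \<inter> space (M \<Otimes>\<^sub>M N) = space M \<times> A"
    using sets.sets_into_space[of A N] by (auto simp: space_pair_measure)
  with A show "emeasure (distr (M \<Otimes>\<^sub>M N) N snd) A = emeasure N A"
    by (simp add: emeasure_distr N.emeasure_pair_measure_Times M.emeasure_space_1)
qed simp

text \<open>Neither ergodicity nor the pointwise theorem is assumed here, so that the locale can be
  interpreted in the square, whose ergodicity is the question.\<close>

locale folner_mps =
  fixes \<nu> :: "'g::{topological_ab_group_add, t2_space} measure"
    and F :: "nat \<Rightarrow> 'g set"
    and M :: "'x measure"
    and T :: "'g \<Rightarrow> 'x \<Rightarrow> 'x"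
  assumes haar: "haar_measure \<nu>"
    and folner: "folner_seq \<nu> F"
    and mps: "mps M T"
begin

sublocale prob_space M by (rule mpsD(1)[OF mps])

sublocale MM: pair_prob_space M M ..

lemma sets_haar [measurable_cong, simp]: "sets \<nu> = sets borel"
  using haar by (simp add: haar_measure_def)

lemma space_haar [simp]: "space \<nu> = UNIV"
  using sets_eq_imp_space_eq[OF sets_haar] by simp

lemma folner_pos: "F n \<in> sets borel" "emeasure \<nu> (F n) \<noteq> 0" "emeasure \<nu> (F n) \<noteq> \<infinity>"
  and measure_folner_pos: "measure \<nu> (F n) > 0"
proof -
  show *: "F n \<in> sets borel" "emeasure \<nu> (F n) \<noteq> 0" "emeasure \<nu> (F n) \<noteq> \<infinity>"
    using folner unfolding folner_seq_def by (auto simp: less_le)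
  then show "measure \<nu> (F n) > 0"
    by (simp add: measure_def enn2real_positive_iff less_top zero_less_iff_neq_zero)
qed

text \<open>Foelner averages become expectations under these probability measures. Haar measure need
  not be sigma-finite, so Fubini is applied to \<open>U n\<close> and the system instead of
  \<nu>.\<close>

definition U :: "nat \<Rightarrow> 'g measure" where "U n = uniform_measure \<nu> (F n)"

lemma sets_U [measurable_cong, simp]: "sets (U n) = sets borel"
  by (simp add: U_def)

lemma space_U [simp]: "space (U n) = UNIV"
  by (simp add: U_def)

lemma prob_space_U: "prob_space (U n)"
  unfolding U_def by (rule prob_space_uniform_measure[OF folner_pos(2,3)])

lemma pair_prob_space_U: "pair_prob_space (U n) N" if "prob_space N"
  using that prob_space_U by (simp add: pair_prob_space_def pair_sigma_finite_def prob_space_imp_sigma_finite)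

lemma U_density: "U n = density \<nu> (\<lambda>j. ennreal (indicator (F n) j / measure \<nu> (F n)))"
proof -
  have one: "1 / ennreal (measure \<nu> (F n)) = ennreal (1 / measure \<nu> (F n))"
    using divide_ennreal[of 1 "measure \<nu> (F n)"] measure_folner_pos[of n] by (simp only: ennreal_1)
  have "indicator (F n) j / emeasure \<nu> (F n) = ennreal (indicator (F n) j / measure \<nu> (F n))" for j
    using measure_folner_pos[of n] folner_pos(3)[of n] one
    by (auto simp: emeasure_eq_ennreal_measure divide_ennreal indicator_def)
  then show ?thesis by (simp add: U_def uniform_measure_def)
qed

lemma folner_avg_eq:
  fixes h :: "'g \<Rightarrow> 'b::{banach, second_countable_topology}"
  assumes [measurable]: "h \<in> borel_measurable borel"
  shows "folner_avg \<nu> (F n) h = (LINT j|U n. h j)"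
proof -
  note [measurable] = folner_pos(1)
  have "(LINT j|U n. h j) = (LINT j|\<nu>. (indicator (F n) j / measure \<nu> (F n)) *\<^sub>R h j)"
    unfolding U_density by (rule integral_density) auto
  also have "\<dots> = (LINT j|\<nu>. (1 / measure \<nu> (F n)) *\<^sub>R (indicator (F n) j *\<^sub>R h j))"
    by (rule Bochner_Integration.integral_cong) auto
  also have "\<dots> = folner_avg \<nu> (F n) h"
    unfolding folner_avg_def set_lebesgue_integral_def
    by (subst integral_scaleR_right) (auto simp: divide_inverse)
  finally show ?thesis by simp
qed

lemma set_integrable_eq:
  fixes h :: "'g \<Rightarrow> 'b::{banach, second_countable_topology}"
  assumes [measurable]: "h \<in> borel_measurable borel"
  shows "set_integrable \<nu> (F n) h \<longleftrightarrow> integrable (U n) h"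
proof -
  note [measurable] = folner_pos(1)
  have scale: "integrable \<nu> (\<lambda>j. c *\<^sub>R k j) \<longleftrightarrow> integrable \<nu> k" if "c \<noteq> 0" for c and k :: "'g \<Rightarrow> 'b"
    using that integrable_scaleR_right[of "inverse c" \<nu> "\<lambda>j. c *\<^sub>R k j"] by auto
  have "integrable (U n) h \<longleftrightarrow> integrable \<nu> (\<lambda>j. (indicator (F n) j / measure \<nu> (F n)) *\<^sub>R h j)"
    unfolding U_density by (rule integrable_density) auto
  also have "\<dots> \<longleftrightarrow> integrable \<nu> (\<lambda>j. (1 / measure \<nu> (F n)) *\<^sub>R (indicator (F n) j *\<^sub>R h j))"
    by (intro Bochner_Integration.integrable_cong) auto
  also have "\<dots> \<longleftrightarrow> set_integrable \<nu> (F n) h"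
    unfolding set_integrable_def using measure_folner_pos[of n]
    by (intro scale) simp
  finally show ?thesis by simp
qed

lemma T_measurable [measurable]: "T j \<in> M \<rightarrow>\<^sub>M M"
  by (rule mps_measurable[OF mps])

lemma T_joint_measurable: "(\<lambda>z. T (fst z) (snd z)) \<in> borel \<Otimes>\<^sub>M M \<rightarrow>\<^sub>M M"
  using mpsD(3)[OF mps] by (simp add: case_prod_beta')

lemma T_measurable_comp [measurable]:
  assumes [measurable]: "g \<in> N \<rightarrow>\<^sub>M borel" "h \<in> N \<rightarrow>\<^sub>M M"
  shows "(\<lambda>z. T (g z) (h z)) \<in> N \<rightarrow>\<^sub>M M"
  using measurable_compose[OF _ T_joint_measurable, of "\<lambda>z. (g z, h z)" N] by simp

lemma T_space: "x \<in> space M \<Longrightarrow> T j x \<in> space M"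
  by (rule mps_space[OF mps])

lemma T_add: "x \<in> space M \<Longrightarrow> T (i + j) x = T i (T j x)"
  by (rule mpsD(5)[OF mps])

lemma T_zero: "x \<in> space M \<Longrightarrow> T 0 x = x"
  by (rule mpsD(4)[OF mps])

lemma orbit_measurable: "x \<in> space M \<Longrightarrow> (\<lambda>j. T j x) \<in> borel \<rightarrow>\<^sub>M M"
  by measurable

lemma AE_T:
  assumes "AE x in M. P x"
  shows "AE x in M. P (T j x)"
proof (rule AE_distrD[OF T_measurable])
  show "AE x in distr M M (T j). P x"
    unfolding mpsD(6)[OF mps] by (rule assms)
qed

lemma integral_T:
  fixes f :: "'x \<Rightarrow> 'b::{banach, second_countable_topology}"
  assumes "f \<in> borel_measurable M"
  shows "(LINT x|M. f (T j x)) = (LINT x|M. f x)"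
  using integral_distr[of "T j" M M f] assms mpsD(6)[OF mps, of j] by simp

lemma integrable_T:
  fixes f :: "'x \<Rightarrow> 'b::{banach, second_countable_topology}"
  assumes "integrable M f"
  shows "integrable M (\<lambda>x. f (T j x))"
  using integrable_distr_eq[of "T j" M M f] assms mpsD(6)[OF mps, of j] by simp

lemma L2_norm_T:
  assumes "f \<in> borel_measurable M"
  shows "L2_norm M (\<lambda>x. f (T j x)) = L2_norm M f"
  using integral_T[of "\<lambda>x. (cmod (f x))\<^sup>2" j] assms by (simp add: L2_norm_def)

lemma L2_inner_T:
  assumes "f \<in> borel_measurable M" "g \<in> borel_measurable M"
  shows "L2_inner M (\<lambda>x. f (T j x)) (\<lambda>x. g (T j x)) = L2_inner M f g"
  using integral_T[of "\<lambda>x. f x * cnj (g x)" j] assms by (simp add: L2_inner_def)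

text \<open>The exceptional null set of \<open>P j\<close> depends on \<open>j\<close>, and there
  may be uncountably many \<open>j\<close>. Fubini on the product of \<open>U n\<close> and
  \<open>M\<close> exchanges the two quantifiers, at the price of holding only for almost every
  \<open>j\<close> in each Foelner set.\<close>

lemma AE_orbit:
  assumes P: "{z \<in> space (borel \<Otimes>\<^sub>M M). P (fst z) (snd z)} \<in> sets (borel \<Otimes>\<^sub>M M)"
    and AE: "\<And>j. AE x in M. P j x"
  shows "AE x in M. \<forall>n. AE j in U n. P j x"
proof -
  have "AE x in M. AE j in U n. P j x" for n
  proof -
    interpret pair_prob_space "U n" M by (rule pair_prob_space_U[OF prob_space_axioms])
    have "sets (U n \<Otimes>\<^sub>M M) = sets (borel \<Otimes>\<^sub>M M)" by (rule sets_pair_measure_cong) simp_all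
    with P have *: "{z \<in> space (U n \<Otimes>\<^sub>M M). P (fst z) (snd z)} \<in> sets (U n \<Otimes>\<^sub>M M)"
      using sets_eq_imp_space_eq[OF \<open>sets (U n \<Otimes>\<^sub>M M) = _\<close>] by simp
    show ?thesis
      using AE by (simp flip: AE_commute[OF *])
  qed
  then show ?thesis by (simp add: AE_all_countable)
qed

lemma integrable_orbit:
  fixes f :: "'x \<Rightarrow> 'b::{banach, second_countable_topology}"
  assumes f: "integrable M f"
  shows "integrable (U n \<Otimes>\<^sub>M M) (\<lambda>z. f (T (fst z) (snd z)))"
proof -
  interpret Un: prob_space "U n" by (rule prob_space_U)
  interpret pair_prob_space "U n" M by (rule pair_prob_space_U[OF prob_space_axioms])
  have [measurable]: "f \<in> borel_measurable M" using f by simp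
  show ?thesis
    by (rule Fubini_integrable) (auto simp: integrable_T[OF f] integral_T[of "\<lambda>x. norm (f x)"])
qed

lemma AE_integrable_orbit:
  fixes f :: "'x \<Rightarrow> 'b::{banach, second_countable_topology}"
  assumes f: "integrable M f"
  shows "AE x in M. \<forall>n. integrable (U n) (\<lambda>j. f (T j x))"
proof -
  have "AE x in M. integrable (U n) (\<lambda>j. f (T j x))" for n
  proof -
    interpret pair_prob_space "U n" M by (rule pair_prob_space_U[OF prob_space_axioms])
    show ?thesis
      using AE_integrable_snd[of "\<lambda>j x. f (T j x)"] integrable_orbit[OF f, of n] by (simp add: case_prod_beta')
  qed
  then show ?thesis by (simp add: AE_all_countable)
qed

definition mean :: "nat \<Rightarrow> ('x \<Rightarrow> complex) \<Rightarrow> 'x \<Rightarrow> complex" where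
  "mean n f x = (LINT j|U n. f (T j x))"

lemma mean_measurable [measurable]:
  assumes [measurable]: "f \<in> borel_measurable M"
  shows "mean n f \<in> borel_measurable M"
proof -
  interpret Un: prob_space "U n" by (rule prob_space_U)
  show ?thesis unfolding mean_def[abs_def] by measurable
qed

text \<open>Along an orbit the square of an average is at most the average of the squares.
  Integrating over \<open>M\<close>, exchanging the integrals and using invariance of the measure
  bounds the norm.\<close>

lemma mean_L2:
  assumes f: "f \<in> L2 M"
  shows "mean n f \<in> L2 M" "L2_norm M (mean n f) \<le> L2_norm M f"
proof -
  interpret Un: prob_space "U n" by (rule prob_space_U)
  interpret pair_prob_space "U n" M by (rule pair_prob_space_U[OF prob_space_axioms])
  have [measurable]: "f \<in> borel_measurable M" using f by (simp add: L2_def)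
  let ?q = "\<lambda>x. (cmod (f x))\<^sup>2"
  have q: "integrable M ?q" using f by (rule L2_square_integrable)
  have orb: "integrable (U n \<Otimes>\<^sub>M M) (case_prod (\<lambda>j x. ?q (T j x)))"
    using integrable_orbit[OF q, of n] by (simp add: case_prod_beta')
  have le: "AE x in M. (cmod (mean n f x))\<^sup>2 \<le> (LINT j|U n. ?q (T j x))"
    using AE_integrable_orbit[OF q] AE_space
  proof eventually_elim
    case (elim x)
    then have fx: "(\<lambda>j. f (T j x)) \<in> L2 (U n)"
      using orbit_measurable[of x] by (auto simp: L2_def)
    have "cmod (mean n f x) \<le> (LINT j|U n. cmod (f (T j x)))"
      unfolding mean_def by (rule integral_norm_bound)
    also have "\<dots> \<le> L2_norm (U n) (\<lambda>j. f (T j x))"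
      using Un.L2_integral_norm_le[OF fx] by (simp add: Un.prob_space[simplified])
    finally have "(cmod (mean n f x))\<^sup>2 \<le> (L2_norm (U n) (\<lambda>j. f (T j x)))\<^sup>2"
      by (intro power_mono) auto
    then show ?case by (simp add: L2_norm_square)
  qed
  have int: "integrable M (\<lambda>x. LINT j|U n. ?q (T j x))"
    using integrable_snd[OF orb] .
  have i1: "integrable M (\<lambda>x. (cmod (mean n f x))\<^sup>2)"
    using le by (intro Bochner_Integration.integrable_bound[OF int]) auto
  then show "mean n f \<in> L2 M" by (simp add: L2_def)
  have "(L2_norm M (mean n f))\<^sup>2 \<le> (LINT x|M. LINT j|U n. ?q (T j x))"
    unfolding L2_norm_square using i1 int le by (rule integral_mono_AE)
  also have "\<dots> = (LINT j|U n. LINT x|M. ?q (T j x))"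
    by (rule Fubini_integral[OF orb])
  also have "\<dots> = (L2_norm M f)\<^sup>2"
    by (simp add: integral_T[of ?q] L2_norm_square Un.prob_space[simplified])
  finally show "L2_norm M (mean n f) \<le> L2_norm M f"
    by (rule power2_le_imp_le) (rule L2_norm_nonneg)
qed

end

locale ergodic_folner_mps = folner_mps +
  assumes pointwise: "pointwise_ergodic_seq \<nu> F"
    and ergodic: "ergodic M T"
begin

lemma ergodic_mps: "ergodic_mps M T"
  using mps ergodic by (simp add: ergodic_mps_def)

lemma AE_generic: "integrable M (f :: _ \<Rightarrow> complex) \<Longrightarrow> AE x in M. generic_point \<nu> F M T f x"
  by (rule pointwise_ergodic_seqD[OF pointwise ergodic_mps])

lemma AE_generic_real:
  fixes f :: "_ \<Rightarrow> real"
  assumes f: "integrable M f"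
  shows "AE x in M. generic_point \<nu> F M T f x"
proof -
  have "AE x in M. generic_point \<nu> F M T (\<lambda>x. complex_of_real (f x)) x"
    using f by (intro AE_generic) simp
  with AE_space show ?thesis
  proof eventually_elim
    case (elim x)
    have [measurable]: "f \<in> borel_measurable M" using f by simp
    have [measurable]: "(\<lambda>j. f (T j x)) \<in> borel_measurable borel"
      using orbit_measurable[OF elim(1)] by measurable
    show ?case
      using elim(2) by (auto simp: generic_point_def folner_avg_eq set_integrable_eq tendsto_of_real_iff
          dest!: spec[where P = "\<lambda>n. integrable (U n) _"] integrable_Re)
  qed
qed

text \<open>The difference of \<open>f\<close> along two orbits splits into the error f - g on each
  orbit and the oscillation of \<open>g\<close> between them. At points generic for |f - g|^2 the
  average error on an orbit is the squared L2 distance of \<open>f\<close> and \<open>g\<close>,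
  whatever the point.\<close>

lemma not_mean_sensitiveI:
  assumes f: "f \<in> L2 M"
    and approx: "\<And>e. e > 0 \<Longrightarrow> \<exists>g\<in>L2 M. \<exists>A\<in>sets M. L2_norm M (\<lambda>x. f x - g x) < e \<and> measure M A > 0 \<and>
      (\<forall>x\<in>A. \<forall>y\<in>A. \<forall>n. AE j in U n. cmod (g (T j x) - g (T j y)) \<le> e)"
  shows "\<not> mean_sensitive \<nu> F M T f"
proof
  assume "mean_sensitive \<nu> F M T f"
  then obtain \<epsilon> where \<epsilon>: "\<epsilon> > 0" and sens: "\<And>A. A \<in> sets M \<Longrightarrow> measure M A > 0 \<Longrightarrow>
    \<exists>x\<in>A. \<exists>y\<in>A. mean_dist \<nu> F T f x y > ereal \<epsilon>"
    unfolding mean_sensitive_def by blast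
  \<comment> \<open>Three errors of size \<open>e\<close> enter through (a + b + c)^2 \<le> 3 (a^2 +
    b^2 + c^2), which bounds the distance by 3 \<open>e\<close>.\<close>
  define e where "e = \<epsilon> / 3"
  have e: "e > 0" using \<epsilon> by (simp add: e_def)
  obtain g A where g: "g \<in> L2 M" and A: "A \<in> sets M" "measure M A > 0"
    and fg: "L2_norm M (\<lambda>x. f x - g x) < e"
    and osc: "\<And>x y n. x \<in> A \<Longrightarrow> y \<in> A \<Longrightarrow> AE j in U n. cmod (g (T j x) - g (T j y)) \<le> e"
    using approx[OF e] by blast
  define q where "q x = (cmod (f x - g x))\<^sup>2" for x
  have [measurable]: "f \<in> borel_measurable M" "g \<in> borel_measurable M"
    using f g by (auto simp: L2_def)
  have q_int: "integrable M q"
    unfolding q_def by (rule L2_square_integrable[OF L2_diff[OF f g]])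
  have [measurable]: "q \<in> borel_measurable M" using q_int by simp
  obtain N where N: "N \<in> null_sets M" "{x \<in> space M. \<not> generic_point \<nu> F M T q x} \<subseteq> N"
    using AE_generic_real[OF q_int] by (auto elim: AE_E simp: null_sets_def)
  \<comment> \<open>Sensitivity delivers points generic for |f|^2, whereas here they must be generic
    for |f - g|^2; so it is applied to \<open>A\<close> without the exceptional null set.\<close>
  have "measure M (A - N) > 0"
    using measure_Diff_null_set[OF A(1) N(1)] A(2) by simp
  then obtain x y where xy: "x \<in> A - N" "y \<in> A - N" and gt: "mean_dist \<nu> F T f x y > ereal \<epsilon>"
    using sens[of "A - N"] A(1) N(1) by (metis null_setsD2 sets.Diff)
  have sp: "x \<in> space M" "y \<in> space M" using xy sets.sets_into_space[OF A(1)] by auto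
  note [measurable] = orbit_measurable[OF sp(1)] orbit_measurable[OF sp(2)]
  have gen: "generic_point \<nu> F M T q x" "generic_point \<nu> F M T q y"
    using xy sp N(2) by auto
  have qx: "\<And>n. integrable (U n) (\<lambda>j. q (T j x))" "\<And>n. integrable (U n) (\<lambda>j. q (T j y))"
    and lim: "(\<lambda>n. LINT j|U n. q (T j x)) \<longlonglongrightarrow> (LINT x|M. q x)"
    "(\<lambda>n. LINT j|U n. q (T j y)) \<longlonglongrightarrow> (LINT x|M. q x)"
    using gen by (simp_all add: generic_point_def set_integrable_eq folner_avg_eq)
  let ?b = "\<lambda>n. 3 * ((LINT j|U n. q (T j x)) + (LINT j|U n. q (T j y)) + e\<^sup>2)"
  have le: "folner_avg \<nu> (F n) (\<lambda>j. (cmod (f (T j x) - f (T j y)))\<^sup>2) \<le> ?b n" for n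
  proof -
    interpret Un: prob_space "U n" by (rule prob_space_U)
    have "folner_avg \<nu> (F n) (\<lambda>j. (cmod (f (T j x) - f (T j y)))\<^sup>2) =
        (LINT j|U n. (cmod (f (T j x) - f (T j y)))\<^sup>2)"
      by (rule folner_avg_eq) measurable
    also have "\<dots> \<le> (LINT j|U n. 3 * (q (T j x) + q (T j y) + e\<^sup>2))"
    proof (rule integral_mono_AE')
      show "integrable (U n) (\<lambda>j. 3 * (q (T j x) + q (T j y) + e\<^sup>2))"
        using qx by auto
      have "AE j in U n. cmod (g (T j x) - g (T j y)) \<le> e" using osc xy by simp
      then show "AE j in U n. (cmod (f (T j x) - f (T j y)))\<^sup>2 \<le> 3 * (q (T j x) + q (T j y) + e\<^sup>2)"
      proof eventually_elim
        case (elim j)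
        let ?a = "f (T j x) - g (T j x)" and ?c = "f (T j y) - g (T j y)" and ?d = "g (T j x) - g (T j y)"
        have "cmod (f (T j x) - f (T j y)) = cmod (?a + ?d - ?c)" by simp
        also have "\<dots> \<le> cmod ?a + cmod ?c + e"
          using norm_triangle_ineq4[of "?a + ?d" ?c] norm_triangle_ineq[of ?a ?d] elim by linarith
        finally have "(cmod (f (T j x) - f (T j y)))\<^sup>2 \<le> (cmod ?a + cmod ?c + e)\<^sup>2"
          by (intro power_mono) auto
        also have "\<dots> \<le> 3 * ((cmod ?a)\<^sup>2 + (cmod ?c)\<^sup>2 + e\<^sup>2)"
        proof -
          have "0 \<le> (a - b)\<^sup>2 + (b - c)\<^sup>2 + (a - c)\<^sup>2" for a b c :: real by simp
          from this[of "cmod ?a" "cmod ?c" e] show ?thesis by (simp add: power2_eq_square algebra_simps)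
        qed
        finally show ?case by (simp add: q_def)
      qed
    qed (simp add: q_def)
    also have "\<dots> = ?b n"
      using qx by (simp add: Un.prob_space[simplified])
    finally show ?thesis .
  qed
  have "(\<lambda>n. sqrt (?b n)) \<longlonglongrightarrow> sqrt (3 * ((LINT x|M. q x) + (LINT x|M. q x) + e\<^sup>2))"
    by (intro tendsto_intros lim)
  then have "limsup (\<lambda>n. ereal (sqrt (?b n))) = ereal (sqrt (3 * ((LINT x|M. q x) + (LINT x|M. q x) + e\<^sup>2)))"
    by (intro lim_imp_Limsup) auto
  moreover have "mean_dist \<nu> F T f x y \<le> limsup (\<lambda>n. ereal (sqrt (?b n)))"
    unfolding mean_dist_def using le by (intro Limsup_mono always_eventually allI) simp
  moreover have "(LINT x|M. q x) \<le> e\<^sup>2"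
    using power_mono[OF less_imp_le[OF fg] L2_norm_nonneg, of 2] by (simp add: L2_norm_square q_def)
  then have "sqrt (3 * ((LINT x|M. q x) + (LINT x|M. q x) + e\<^sup>2)) \<le> sqrt ((3 * e)\<^sup>2)"
    by (intro real_sqrt_le_mono) (simp add: power2_eq_square)
  ultimately have "mean_dist \<nu> F T f x y \<le> ereal \<epsilon>"
    using e by (simp add: e_def) (metis ereal_less_eq(3) order_trans)
  with gt show False by simp
qed

end

section \<open>Discrete spectrum excludes sensitivity\<close>

context ergodic_folner_mps
begin

text \<open>Eigenvalues have modulus 1, so the distance of b(x) and b(y) is preserved along the
  orbits. It is enough that the finitely many eigenfunctions oscillate little on \<open>A\<close>
  itself.\<close>

lemma eigenfunction_combination_approx:
  assumes S: "finite S" "\<And>b. b \<in> S \<Longrightarrow> eigenfunction M T b" and e: "e > 0"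
  shows "\<exists>A\<in>sets M. measure M A > 0 \<and> (\<forall>x\<in>A. \<forall>y\<in>A. \<forall>n. AE j in U n.
    cmod ((\<Sum>b\<in>S. c b * b (T j x)) - (\<Sum>b\<in>S. c b * b (T j y))) \<le> e)"
proof -
  have "\<exists>w. continuous_on UNIV w \<and> (\<forall>j. cmod (w j) = 1) \<and> (\<forall>j. AE x in M. b (T j x) = w j * b x)"
    if "b \<in> S" for b
    using S(2)[OF that] unfolding eigenfunction_def by blast
  then obtain w where w: "\<And>b. b \<in> S \<Longrightarrow> continuous_on UNIV (w b)"
    "\<And>b j. b \<in> S \<Longrightarrow> cmod (w b j) = 1" "\<And>b j. b \<in> S \<Longrightarrow> AE x in M. b (T j x) = w b j * b x"
    by metis
  have b_m: "b \<in> borel_measurable M" if "b \<in> S" for b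
    using S(2)[OF that] by (auto simp: eigenfunction_def L2_def)
  have "AE x in M. \<forall>n. AE j in U n. b (T j x) = w b j * b x" if b: "b \<in> S" for b
  proof (rule AE_orbit)
    have [measurable]: "w b \<in> borel_measurable borel" "b \<in> borel_measurable M"
      using borel_measurable_continuous_onI[OF w(1)[OF b]] b_m[OF b] by simp_all
    have [measurable]: "(\<lambda>z. T (fst z) (snd z)) \<in> borel \<Otimes>\<^sub>M M \<rightarrow>\<^sub>M M"
      by (rule T_joint_measurable)
    show "{z \<in> space (borel \<Otimes>\<^sub>M M). b (T (fst z) (snd z)) = w b (fst z) * b (snd z)} \<in> sets (borel \<Otimes>\<^sub>M M)"
      by measurable
  qed (rule w(3)[OF b])
  then have "AE x in M. \<forall>b\<in>S. \<forall>n. AE j in U n. b (T j x) = w b j * b x"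
    using S(1) by (simp add: AE_finite_all)
  then obtain N where N: "N \<in> null_sets M"
    "{x \<in> space M. \<not> (\<forall>b\<in>S. \<forall>n. AE j in U n. b (T j x) = w b j * b x)} \<subseteq> N"
    by (auto elim: AE_E simp: null_sets_def)
  \<comment> \<open>The added 1 keeps the denominator positive when all coefficients vanish.\<close>
  define \<delta> where "\<delta> = e / ((\<Sum>b\<in>S. cmod (c b)) + 1)"
  have pos: "(\<Sum>b\<in>S. cmod (c b)) + 1 > 0" by (simp add: add_nonneg_pos sum_nonneg)
  have \<delta>: "\<delta> > 0" "(\<Sum>b\<in>S. cmod (c b)) * \<delta> \<le> e"
    using e pos by (auto simp: \<delta>_def field_simps)
  have "prob (space M - N) > 0"
    using measure_Diff_null_set[OF sets.top N(1)] by (simp add: prob_space)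
  then obtain A where A: "A \<in> events" "A \<subseteq> space M - N" "prob A > 0"
    "\<And>b x y. b \<in> S \<Longrightarrow> x \<in> A \<Longrightarrow> y \<in> A \<Longrightarrow> cmod (b x - b y) \<le> \<delta>"
    using small_oscillation[of S "\<lambda>b. b" \<delta> "space M - N"] S(1) b_m \<delta>(1) N(1) by blast
  have "AE j in U n. cmod ((\<Sum>b\<in>S. c b * b (T j x)) - (\<Sum>b\<in>S. c b * b (T j y))) \<le> e"
    if xy: "x \<in> A" "y \<in> A" for x y n
  proof -
    have "AE j in U n. \<forall>b\<in>S. b (T j x) = w b j * b x" "AE j in U n. \<forall>b\<in>S. b (T j y) = w b j * b y"
      using A(2) N(2) xy S(1) by (auto simp: AE_finite_all)
    then show ?thesis
    proof eventually_elim
      case (elim j)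
      have "(\<Sum>b\<in>S. c b * b (T j x)) - (\<Sum>b\<in>S. c b * b (T j y)) = (\<Sum>b\<in>S. c b * w b j * (b x - b y))"
        using elim by (simp add: sum_subtractf[symmetric] algebra_simps)
      also have "cmod \<dots> \<le> (\<Sum>b\<in>S. cmod (c b) * \<delta>)"
        using A(4)[OF _ xy] w(2) by (intro sum_norm_le) (auto simp: norm_mult intro!: mult_left_mono)
      also have "\<dots> \<le> e" using \<delta>(2) by (simp add: sum_distrib_right)
      finally show ?case .
    qed
  qed
  then show ?thesis using A(1,3) by blast
qed

theorem discrete_spectrum_imp_not_mean_sensitive:
  assumes ds: "discrete_spectrum M T" and f: "f \<in> L2 M"
  shows "\<not> mean_sensitive \<nu> F M T f"
proof (rule not_mean_sensitiveI[OF f])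
  fix e :: real assume e: "e > 0"
  obtain B where B: "orthonormal_basis M B" "\<And>b. b \<in> B \<Longrightarrow> eigenfunction M T b"
    using ds unfolding discrete_spectrum_def by blast
  obtain S c where S: "finite S" "S \<subseteq> B" "L2_norm M (\<lambda>x. f x - (\<Sum>b\<in>S. c b * b x)) < e"
    using B(1) f e unfolding orthonormal_basis_def by blast
  have "(\<lambda>x. \<Sum>b\<in>S. c b * b x) \<in> L2 M"
    using S(2) B(1) by (intro L2_sum L2_scale) (auto simp: orthonormal_basis_def)
  moreover have "\<And>b. b \<in> S \<Longrightarrow> eigenfunction M T b" using S(2) B(2) by blast
  note eigenfunction_combination_approx[OF S(1) this e, of c]
  ultimately show "\<exists>g\<in>L2 M. \<exists>A\<in>sets M. L2_norm M (\<lambda>x. f x - g x) < e \<and> measure M A > 0 \<and>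
      (\<forall>x\<in>A. \<forall>y\<in>A. \<forall>n. AE j in U n. cmod (g (T j x) - g (T j y)) \<le> e)"
    using S(3) by (intro bexI[of _ "\<lambda>x. \<Sum>b\<in>S. c b * b x"]) auto
qed

end

section \<open>Weak mixing and sensitivity\<close>

context folner_mps
begin

lemma distr_fst: "distr (M \<Otimes>\<^sub>M M) M fst = M"
  by (rule distr_pair_fst)

lemma distr_snd: "distr (M \<Otimes>\<^sub>M M) M snd = M"
  by (rule distr_pair_snd[OF prob_space_axioms prob_space_axioms])

lemma AE_fst:
  assumes "AE x in M. P x"
  shows "AE z in M \<Otimes>\<^sub>M M. P (fst z)"
proof (rule AE_distrD[OF measurable_fst])
  show "AE x in distr (M \<Otimes>\<^sub>M M) M fst. P x" unfolding distr_fst by fact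
qed

lemma AE_snd:
  assumes "AE x in M. P x"
  shows "AE z in M \<Otimes>\<^sub>M M. P (snd z)"
proof (rule AE_distrD[OF measurable_snd])
  show "AE x in distr (M \<Otimes>\<^sub>M M) M snd. P x" unfolding distr_snd by fact
qed

lemma L2_fst: "f \<in> L2 M \<Longrightarrow> (\<lambda>z. f (fst z)) \<in> L2 (M \<Otimes>\<^sub>M M)"
  using integrable_distr[of fst "M \<Otimes>\<^sub>M M" M "\<lambda>x. (cmod (f x))\<^sup>2"]
  by (auto simp: L2_def distr_fst)

lemma L2_snd: "f \<in> L2 M \<Longrightarrow> (\<lambda>z. f (snd z)) \<in> L2 (M \<Otimes>\<^sub>M M)"
  using integrable_distr[of snd "M \<Otimes>\<^sub>M M" M "\<lambda>x. (cmod (f x))\<^sup>2"]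
  by (auto simp: L2_def distr_snd)

lemma prod_folner_mps: "folner_mps \<nu> F (M \<Otimes>\<^sub>M M) (\<lambda>j (x, y). (T j x, T j y))"
  by unfold_locales (rule haar folner mps_pair[OF mps])+

end

context ergodic_folner_mps
begin

text \<open>If \<open>A\<close> has positive measure then so has its square in the product, which
  therefore contains one of the pairs at which everything required holds almost everywhere.\<close>

lemma mean_sensitiveI:
  assumes f: "f \<in> L2 M" and e: "e > 0"
    and far: "AE z in M \<Otimes>\<^sub>M M. mean_dist \<nu> F T f (fst z) (snd z) > ereal e"
  shows "mean_sensitive \<nu> F M T f"
proof -
  let ?g = "generic_point \<nu> F M T (\<lambda>x. (cmod (f x))\<^sup>2)"
  have gen: "AE x in M. ?g x"
    by (rule AE_generic_real[OF L2_square_integrable[OF f]])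
  have "\<exists>x\<in>A. \<exists>y\<in>A. ?g x \<and> ?g y \<and> mean_dist \<nu> F T f x y > ereal e"
    if A: "A \<in> sets M" "measure M A > 0" for A
  proof (rule ccontr)
    assume neg: "\<not> ?thesis"
    have "emeasure (M \<Otimes>\<^sub>M M) (A \<times> A) \<noteq> 0"
      using A by (simp add: emeasure_pair_measure_Times emeasure_eq_measure)
    then have "\<not> (AE z in M \<Otimes>\<^sub>M M. z \<notin> A \<times> A)"
      using A(1) AE_iff_null_sets[of "A \<times> A" "M \<Otimes>\<^sub>M M"] by (auto simp: null_sets_def)
    moreover have "AE z in M \<Otimes>\<^sub>M M. z \<notin> A \<times> A"
      using AE_fst[OF gen] AE_snd[OF gen] far by eventually_elim (use neg in force)
    ultimately show False by simp
  qed
  with e show ?thesis unfolding mean_sensitive_def by blast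
qed

text \<open>On an ergodic square the pointwise ergodic theorem makes the distance of almost every pair
  equal to the square root of twice the variance.\<close>

theorem weakly_mixing_imp_mean_sensitive:
  assumes wm: "weakly_mixing M T" and f: "f \<in> L2 M" and nc: "\<not> (\<exists>c. AE x in M. f x = c)"
  shows "mean_sensitive \<nu> F M T f"
proof -
  interpret P: ergodic_folner_mps \<nu> F "M \<Otimes>\<^sub>M M" "\<lambda>j (x, y). (T j x, T j y)"
    using prod_folner_mps pointwise wm
    by (simp add: ergodic_folner_mps_def ergodic_folner_mps_axioms_def weakly_mixing_def)
  have [measurable]: "f \<in> borel_measurable M" using f by (simp add: L2_def)
  define q where "q z = (cmod (f (fst z) - f (snd z)))\<^sup>2" for z
  have q: "integrable (M \<Otimes>\<^sub>M M) q"
    unfolding q_def by (rule L2_square_integrable[OF L2_diff[OF L2_fst[OF f] L2_snd[OF f]]])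
  define v where "v = (LINT z|(M \<Otimes>\<^sub>M M). q z)"
  \<comment> \<open>If \<open>v\<close> vanished, then \<open>f x = f y\<close> for almost every
    pair, and fixing one suitable \<open>x\<close> would make \<open>f\<close> constant.\<close>
  have "v \<noteq> 0"
  proof
    assume "v = 0"
    then have "AE z in M \<Otimes>\<^sub>M M. q z = 0"
      using integral_nonneg_eq_0_iff_AE[OF q] by (simp add: v_def) (simp add: q_def)
    then have "AE x in M. AE y in M. q (x, y) = 0" by (rule MM.AE_pair)
    then have *: "AE x in M. AE y in M. f x = f y" by (simp add: q_def)
    have "\<exists>x. AE y in M. f x = f y"
    proof (rule ccontr)
      assume "\<not> ?thesis"
      then have "AE x in M. False" using * by simp
      then show False by simp
    qed
    then obtain x where "AE y in M. f x = f y" by (rule exE)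
    then have "AE y in M. f y = f x" by eventually_elim simp
    with nc show False by blast
  qed
  moreover have "v \<ge> 0" unfolding v_def by (simp add: q_def)
  ultimately have v: "v > 0" by simp
  \<comment> \<open>Halving leaves room for the strict inequality in the definition of
    sensitivity.\<close>
  have "AE z in M \<Otimes>\<^sub>M M. mean_dist \<nu> F T f (fst z) (snd z) > ereal (sqrt v / 2)"
    using P.AE_generic_real[OF q]
  proof eventually_elim
    case (elim z)
    have "(\<lambda>n. folner_avg \<nu> (F n) (\<lambda>j. (cmod (f (T j (fst z)) - f (T j (snd z))))\<^sup>2)) \<longlonglongrightarrow> v"
      using elim by (simp add: generic_point_def v_def) (simp add: q_def case_prod_beta')
    then have "(\<lambda>n. ereal (sqrt (folner_avg \<nu> (F n) (\<lambda>j. (cmod (f (T j (fst z)) - f (T j (snd z))))\<^sup>2))))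
        \<longlonglongrightarrow> ereal (sqrt v)"
      by (intro tendsto_intros)
    then have "mean_dist \<nu> F T f (fst z) (snd z) = ereal (sqrt v)"
      unfolding mean_dist_def by (intro lim_imp_Limsup) auto
    with v show ?case by simp
  qed
  then show ?thesis by (rule mean_sensitiveI[OF f, rotated]) (use v in simp)
qed

end

text \<open>This replaces the separability of the measure algebra.\<close>

lemma (in prob_space) fibre_cover:
  assumes E: "E \<in> sets (M \<Otimes>\<^sub>M M)" and \<delta>: "\<delta> > 0"
  shows "\<exists>C::nat \<Rightarrow> 'a set. (\<forall>i. C i \<in> events) \<and> space M \<subseteq> (\<Union>i. C i) \<and>
    (\<forall>i. \<forall>x\<in>C i. \<forall>y\<in>C i. prob (sym_diff (Pair x -` E) (Pair y -` E)) \<le> \<delta>)"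
proof -
  let ?P = "\<lambda>E. \<forall>\<delta>>0. \<exists>C::nat \<Rightarrow> 'a set. (\<forall>i. C i \<in> events) \<and> space M \<subseteq> (\<Union>i. C i) \<and>
    (\<forall>i. \<forall>x\<in>C i. \<forall>y\<in>C i. prob (sym_diff (Pair x -` E) (Pair y -` E)) \<le> \<delta>)"
  let ?G = "{a \<times> b | a b. a \<in> sets M \<and> b \<in> sets M}"
  interpret MM: pair_prob_space M M ..
  have cut: "Pair x -` D \<in> events" if "D \<in> sets (M \<Otimes>\<^sub>M M)" for x D
    using that by (rule sets_Pair1)
  have sG: "sigma_sets (space M \<times> space M) ?G = sets (M \<Otimes>\<^sub>M M)"
    by (simp add: sets_pair_measure)
  have *: "E \<in> sigma_sets (space M \<times> space M) ?G" using E sG by simp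
  have **: "?G \<subseteq> Pow (space M \<times> space M)" using sets.sets_into_space by blast
  have "?P E"
    using Int_stable_pair_measure_generator ** *
  proof (induction rule: sigma_sets_induct_disjoint)
    case (basic A)
    then obtain a b where A: "A = a \<times> b" "a \<in> sets M" "b \<in> sets M" by blast
    \<comment> \<open>A rectangle has only the fibres \<open>b\<close> and the empty set, according
      to whether the point lies in \<open>a\<close>.\<close>
    show ?case
      by (intro allI impI exI[of _ "\<lambda>i. if i = 0 then a else space M - a"])
        (use A in \<open>auto simp: vimage_def split: if_splits\<close>)
  next
    case empty
    show ?case by (intro allI impI exI[of _ "\<lambda>i. space M"]) auto
  next
    case (compl A)
    note A = compl.hyps and IH = compl.IH
    show ?case
    proof (intro allI impI)
      fix \<delta> :: real assume "\<delta> > 0"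
      then obtain C where C: "\<And>i::nat. C i \<in> events" "space M \<subseteq> (\<Union>i. C i)"
        "\<And>i x y. x \<in> C i \<Longrightarrow> y \<in> C i \<Longrightarrow> prob (sym_diff (Pair x -` A) (Pair y -` A)) \<le> \<delta>"
        using IH by metis
      have "sym_diff (Pair x -` (space M \<times> space M - A)) (Pair y -` (space M \<times> space M - A))
          = sym_diff (Pair x -` A) (Pair y -` A)" if "x \<in> space M" "y \<in> space M" for x y
        using that A sets.sets_into_space[of A "M \<Otimes>\<^sub>M M"] unfolding sG
        by (auto simp: space_pair_measure)
      moreover have "\<And>i x. x \<in> C i \<Longrightarrow> x \<in> space M" using C(1) sets.sets_into_space by blast
      ultimately show "\<exists>C::nat \<Rightarrow> 'a set. (\<forall>i. C i \<in> events) \<and> space M \<subseteq> (\<Union>i. C i) \<and>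
        (\<forall>i. \<forall>x\<in>C i. \<forall>y\<in>C i. prob (sym_diff (Pair x -` (space M \<times> space M - A))
           (Pair y -` (space M \<times> space M - A))) \<le> \<delta>)"
        using C by (intro exI[of _ C]) simp
    qed
  next
    case (union A)
    note disj = union.hyps(1) and ran = union.hyps(2) and IH = union.IH
    have A: "A i \<in> sets (M \<Otimes>\<^sub>M M)" for i using ran sG by auto
    show ?case
    proof (intro allI impI)
      fix \<delta> :: real assume \<delta>: "\<delta> > 0"
      \<comment> \<open>The tail \<open>R n\<close> of the disjoint union has fibres of small
        measure once \<open>n\<close> is large, but how large depends on the point; hence the sets
        \<open>D n\<close>. The budget is \<open>\<delta> / 2\<close> for the pieces before
        \<open>n\<close> and \<open>\<delta> / 4\<close> for each of the two tails.\<close>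
      define R where "R n = (\<Union>i. A (i + n))" for n
      have R: "R n \<in> sets (M \<Otimes>\<^sub>M M)" for n unfolding R_def using A by auto
      define D where "D n = {x \<in> space M. prob (Pair x -` R n) \<le> \<delta> / 4}" for n
      have D: "D n \<in> events" for n
      proof -
        have "(\<lambda>x. prob (Pair x -` R n)) \<in> borel_measurable M"
          unfolding measure_def using measurable_emeasure_Pair[OF R[of n]] by measurable
        then show ?thesis unfolding D_def by measurable
      qed
      have Dcov: "\<exists>n. x \<in> D n" if x: "x \<in> space M" for x
      proof -
        have "(\<lambda>n. prob (Pair x -` R n)) \<longlonglongrightarrow> prob (\<Inter>n. Pair x -` R n)"
        proof (rule finite_Lim_measure_decseq)
          show "range (\<lambda>n. Pair x -` R n) \<subseteq> events" using cut[OF R] by auto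
          have "R m \<subseteq> R n" if "n \<le> m" for m n
          proof
            fix z assume "z \<in> R m"
            then obtain i where "z \<in> A (i + m)" by (auto simp: R_def)
            then have "z \<in> A ((i + (m - n)) + n)" using that by simp
            then show "z \<in> R n" unfolding R_def by blast
          qed
          then show "decseq (\<lambda>n. Pair x -` R n)" by (auto simp: decseq_def)
        qed
        moreover have "(\<Inter>n. Pair x -` R n) = {}"
        proof -
          have False if inR: "\<And>n. (x, y) \<in> R n" for y
          proof -
            obtain i where i: "(x, y) \<in> A i" using inR[of 0] by (auto simp: R_def)
            obtain k where "(x, y) \<in> A (k + Suc i)" using inR[of "Suc i"] by (auto simp: R_def)
            moreover have "A i \<inter> A (k + Suc i) = {}"
              using disj by (rule disjoint_family_onD) auto
            ultimately show False using i by blast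
          qed
          then show ?thesis by blast
        qed
        ultimately have "(\<lambda>n. prob (Pair x -` R n)) \<longlonglongrightarrow> 0" by simp
        then have "\<forall>\<^sub>F n in sequentially. prob (Pair x -` R n) < \<delta> / 4"
          using \<delta> by (intro order_tendstoD) auto
        then obtain n where "prob (Pair x -` R n) < \<delta> / 4" by (auto simp: eventually_sequentially)
        then show ?thesis using x by (intro exI[of _ n]) (simp add: D_def)
      qed
      have step: "\<exists>C::nat \<Rightarrow> 'a set. (\<forall>i. C i \<in> events) \<and> space M \<subseteq> (\<Union>i. C i) \<and>
        (\<forall>i. \<forall>x\<in>C i. \<forall>y\<in>C i. (\<Sum>k<n. prob (sym_diff (Pair x -` A k) (Pair y -` A k))) \<le> \<delta> / 2)" for n
      proof -
        define \<eta> where "\<eta> = \<delta> / (2 * (real n + 1))"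
        have \<eta>: "\<eta> > 0" using \<delta> by (simp add: \<eta>_def)
        have "\<forall>k. \<exists>C::nat \<Rightarrow> 'a set. (\<forall>i. C i \<in> events) \<and> space M \<subseteq> (\<Union>i. C i) \<and>
          (\<forall>i. \<forall>x\<in>C i. \<forall>y\<in>C i. prob (sym_diff (Pair x -` A k) (Pair y -` A k)) \<le> \<eta>)"
          using IH \<eta> by blast
        then obtain C where C: "\<And>k i::nat. C k i \<in> events" "\<And>k::nat. space M \<subseteq> (\<Union>i. C k i)"
          "\<And>k i x y. x \<in> C k i \<Longrightarrow> y \<in> C k i \<Longrightarrow> prob (sym_diff (Pair x -` A k) (Pair y -` A k)) \<le> \<eta>"
          by metis
        \<comment> \<open>The index \<open>i\<close> codes a list of naturals whose k-th entry
          selects a cell of the cover belonging to \<open>A k\<close>. This is the common refinement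
          of \<open>n\<close> covers, still indexed by one natural number.\<close>
        define C' where "C' i = {x \<in> space M. \<forall>k<n. x \<in> C k (from_nat_into (lists UNIV) i ! k)}" for i
        have "C' i \<in> events" for i
          unfolding C'_def using C(1) by measurable
        moreover have "space M \<subseteq> (\<Union>i. C' i)"
        proof
          fix x assume x: "x \<in> space M"
          then have "\<forall>k. \<exists>i. x \<in> C k i" using C(2) by blast
          then obtain s where s: "\<And>k. x \<in> C k (s k)" by metis
          have "map s [0..<n] \<in> lists UNIV" by simp
          then have "from_nat_into (lists UNIV) (to_nat_on (lists UNIV) (map s [0..<n])) = map s [0..<n]"
            by (intro from_nat_into_to_nat_on) auto
          then have "x \<in> C' (to_nat_on (lists UNIV) (map s [0..<n]))"
            using x s by (simp add: C'_def)
          then show "x \<in> (\<Union>i. C' i)" by blast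
        qed
        moreover have "(\<Sum>k<n. prob (sym_diff (Pair x -` A k) (Pair y -` A k))) \<le> \<delta> / 2"
          if "x \<in> C' i" "y \<in> C' i" for i x y
        proof -
          have "(\<Sum>k<n. prob (sym_diff (Pair x -` A k) (Pair y -` A k))) \<le> (\<Sum>k<n. \<eta>)"
            using that C(3) by (intro sum_mono) (auto simp: C'_def)
          also have "\<dots> = real n * \<eta>" by simp
          also have "\<dots> \<le> \<delta> / 2" using \<delta> by (simp add: \<eta>_def field_simps)
          finally show ?thesis .
        qed
        ultimately show ?thesis by blast
      qed
      obtain C :: "nat \<Rightarrow> nat \<Rightarrow> 'a set" where C': "\<forall>n. (\<forall>i. C n i \<in> events) \<and> space M \<subseteq> (\<Union>i. C n i) \<and>
        (\<forall>i. \<forall>x\<in>C n i. \<forall>y\<in>C n i. (\<Sum>k<n. prob (sym_diff (Pair x -` A k) (Pair y -` A k))) \<le> \<delta> / 2)"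
        using choice[OF allI[OF step]] by (rule exE)
      have C: "\<And>n i::nat. C n i \<in> events" "\<And>n::nat. space M \<subseteq> (\<Union>i. C n i)"
        "\<And>n i x y. x \<in> C n i \<Longrightarrow> y \<in> C n i \<Longrightarrow>
          (\<Sum>k<n. prob (sym_diff (Pair x -` A k) (Pair y -` A k))) \<le> \<delta> / 2"
        using C' by simp_all
      \<comment> \<open>An index codes a pair: the stage \<open>n\<close> from which the tail is
        small, and a cell of the cover for that stage.\<close>
      define C' where "C' i = (case prod_decode i of (n, m) \<Rightarrow> C n m \<inter> D n)" for i
      have "C' i \<in> events" for i
        using C(1) D by (auto simp: C'_def split: prod.splits)
      moreover have "space M \<subseteq> (\<Union>i. C' i)"
      proof
        fix x assume x: "x \<in> space M"
        obtain n where n: "x \<in> D n" using Dcov[OF x] by blast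
        obtain m where m: "x \<in> C n m" using C(2)[of n] x by blast
        have "x \<in> C' (prod_encode (n, m))" using n m by (simp add: C'_def)
        then show "x \<in> (\<Union>i. C' i)" by blast
      qed
      moreover have "prob (sym_diff (Pair x -` (\<Union>i. A i)) (Pair y -` (\<Union>i. A i))) \<le> \<delta>"
        if xy: "x \<in> C' i" "y \<in> C' i" for i x y
      proof -
        obtain n m where nm: "prod_decode i = (n, m)" by (cases "prod_decode i")
        have x: "x \<in> C n m" "x \<in> D n" "y \<in> C n m" "y \<in> D n" using xy nm by (auto simp: C'_def)
        let ?s = "\<lambda>k. sym_diff (Pair x -` A k) (Pair y -` A k)"
        have s: "?s k \<in> events" for k using cut[OF A] by auto
        have split: "z \<in> R n" if "z \<in> A k" "n \<le> k" for z k
          using that unfolding R_def by (intro UN_I[of "k - n"]) simp_all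
        have "sym_diff (Pair x -` (\<Union>i. A i)) (Pair y -` (\<Union>i. A i))
            \<subseteq> (\<Union>k<n. ?s k) \<union> (Pair x -` R n \<union> Pair y -` R n)"
        proof
          fix z assume "z \<in> sym_diff (Pair x -` (\<Union>i. A i)) (Pair y -` (\<Union>i. A i))"
          then have "\<exists>k. z \<in> ?s k"
          proof
            assume z: "z \<in> Pair x -` (\<Union>i. A i) - Pair y -` (\<Union>i. A i)"
            then obtain k where "(x, z) \<in> A k" by blast
            with z show ?thesis by (intro exI[of _ k]) simp
          next
            assume z: "z \<in> Pair y -` (\<Union>i. A i) - Pair x -` (\<Union>i. A i)"
            then obtain k where "(y, z) \<in> A k" by blast
            with z show ?thesis by (intro exI[of _ k]) simp
          qed
          then obtain k where k: "z \<in> ?s k" by (rule exE)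
          then have "(x, z) \<in> A k \<or> (y, z) \<in> A k" by blast
          with k show "z \<in> (\<Union>k<n. ?s k) \<union> (Pair x -` R n \<union> Pair y -` R n)"
            using split[of _ k] by (cases "k < n") auto
        qed
        then have "prob (sym_diff (Pair x -` (\<Union>i. A i)) (Pair y -` (\<Union>i. A i)))
            \<le> prob ((\<Union>k<n. ?s k) \<union> (Pair x -` R n \<union> Pair y -` R n))"
          using s cut[OF R] by (intro finite_measure_mono) auto
        also have "\<dots> \<le> prob (\<Union>k<n. ?s k) + (prob (Pair x -` R n) + prob (Pair y -` R n))"
          using s cut[OF R] by (intro order_trans[OF measure_Un_le] add_mono measure_Un_le order_refl) auto
        also have "prob (\<Union>k<n. ?s k) \<le> (\<Sum>k<n. prob (?s k))"
          using s by (intro finite_measure_subadditive_finite) auto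
        also have "\<dots> \<le> \<delta> / 2" using C(3) x by blast
        finally show ?thesis using x by (simp add: D_def)
      qed
      ultimately show "\<exists>C::nat \<Rightarrow> 'a set. (\<forall>i. C i \<in> events) \<and> space M \<subseteq> (\<Union>i. C i) \<and>
        (\<forall>i. \<forall>x\<in>C i. \<forall>y\<in>C i. prob (sym_diff (Pair x -` (\<Union>i. A i)) (Pair y -` (\<Union>i. A i))) \<le> \<delta>)"
        by blast
    qed
  qed
  then show ?thesis using \<delta> by blast
qed

lemma (in finite_measure) measure_Int_sym_diff_le:
  assumes "P \<in> sets M" "P' \<in> sets M" "Q \<in> sets M"
  shows "\<bar>measure M (P \<inter> Q) - measure M (P' \<inter> Q)\<bar> \<le> measure M (sym_diff P P')"
proof -
  have "measure M (A \<inter> Q) \<le> measure M (B \<inter> Q) + measure M (sym_diff P P')"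
    if "A \<in> sets M" "B \<in> sets M" "A - B \<subseteq> sym_diff P P'" for A B
  proof -
    have "measure M (A \<inter> Q) \<le> measure M ((B \<inter> Q) \<union> sym_diff P P')"
      using assms that by (intro finite_measure_mono) auto
    also have "\<dots> \<le> measure M (B \<inter> Q) + measure M (sym_diff P P')"
      using assms that by (intro measure_Un_le) auto
    finally show ?thesis .
  qed
  from this[of P P'] this[of P' P] assms show ?thesis by (auto simp: abs_le_iff Un_commute)
qed

context ergodic_folner_mps
begin

lemma fibre_measure_borel:
  assumes E: "E \<in> sets (M \<Otimes>\<^sub>M M)" and B: "B \<in> events"
  shows "(\<lambda>x. prob (Pair x -` E \<inter> B)) \<in> borel_measurable M"
proof -
  have "E \<inter> (space M \<times> B) \<in> sets (M \<Otimes>\<^sub>M M)" using E B by auto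
  from measurable_emeasure_Pair[OF this]
  have "(\<lambda>x. enn2real (emeasure M (Pair x -` (E \<inter> (space M \<times> B))))) \<in> borel_measurable M"
    by measurable
  moreover have "Pair x -` (E \<inter> (space M \<times> B)) = Pair x -` E \<inter> B" if "x \<in> space M" for x
    using that by auto
  ultimately show ?thesis
    unfolding measure_def by (simp cong: measurable_cong)
qed

text \<open>Invariance of \<open>E\<close> moves the translation from the fibre to \<open>B\<close>, so the orbits of \<open>x\<close> and \<open>y\<close>
  stay as close as the fibres over \<open>x\<close> and \<open>y\<close> are.\<close>

lemma fibre_measure_not_mean_sensitive:
  assumes E: "E \<in> sets (M \<Otimes>\<^sub>M M)" and B: "B \<in> events"
    and inv: "\<And>j x y. x \<in> space M \<Longrightarrow> y \<in> space M \<Longrightarrow> (T j x, T j y) \<in> E \<longleftrightarrow> (x, y) \<in> E"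
  defines "f \<equiv> \<lambda>x. complex_of_real (prob (Pair x -` E \<inter> B))"
  shows "f \<in> L2 M" "\<not> mean_sensitive \<nu> F M T f"
proof -
  have cut: "Pair x -` E \<in> events" for x using E by (rule sets_Pair1)
  show f: "f \<in> L2 M"
    unfolding f_def using fibre_measure_borel[OF E B] by (intro L2_bounded[of _ 1]) auto
  have move: "prob (Pair (T j x) -` E \<inter> B) = prob (Pair x -` E \<inter> (T j -` B \<inter> space M))"
    if x: "x \<in> space M" for j x
  proof -
    have "prob (Pair (T j x) -` E \<inter> B) = measure (distr M M (T j)) (Pair (T j x) -` E \<inter> B)"
      by (simp add: mpsD(6)[OF mps])
    also have "\<dots> = prob (T j -` (Pair (T j x) -` E \<inter> B) \<inter> space M)"
      using cut B by (intro measure_distr) auto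
    also have "T j -` (Pair (T j x) -` E \<inter> B) \<inter> space M = Pair x -` E \<inter> (T j -` B \<inter> space M)"
      using inv[OF x] by auto
    finally show ?thesis .
  qed
  show "\<not> mean_sensitive \<nu> F M T f"
  proof (rule not_mean_sensitiveI[OF f])
    fix e :: real assume e: "e > 0"
    obtain C :: "nat \<Rightarrow> 'b set" where C: "\<And>i. C i \<in> events" "space M \<subseteq> (\<Union>i. C i)"
      "\<And>i x y. x \<in> C i \<Longrightarrow> y \<in> C i \<Longrightarrow> prob (sym_diff (Pair x -` E) (Pair y -` E)) \<le> e"
      using fibre_cover[OF E e] by metis
    obtain i where i: "prob (space M \<inter> C i) > 0"
      using positive_measure_piece[of C "space M"] C(1,2) prob_space by auto
    have "cmod (f (T j x) - f (T j y)) \<le> e" if "x \<in> C i" "y \<in> C i" for x y j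
    proof -
      have xy: "x \<in> space M" "y \<in> space M" using that C(1) sets.sets_into_space by blast+
      have "\<bar>prob (Pair (T j x) -` E \<inter> B) - prob (Pair (T j y) -` E \<inter> B)\<bar> \<le> e"
        unfolding move[OF xy(1)] move[OF xy(2)]
        using measure_Int_sym_diff_le[OF cut cut, of "T j -` B \<inter> space M" x y] B C(3)[OF that] by simp
      then show ?thesis by (simp add: f_def flip: of_real_diff)
    qed
    then show "\<exists>g\<in>L2 M. \<exists>A\<in>sets M. L2_norm M (\<lambda>x. f x - g x) < e \<and> measure M A > 0 \<and>
      (\<forall>x\<in>A. \<forall>y\<in>A. \<forall>n. AE j in U n. cmod (g (T j x) - g (T j y)) \<le> e)"
      using f C(1) i e by (intro bexI[of _ f] bexI[of _ "space M \<inter> C i"]) (auto simp: L2_norm_def)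
  qed
qed

text \<open>The measure of the fibre within \<open>B\<close> is a function that is not sensitive,
  hence almost everywhere constant. Integrating this constant over \<open>A\<close> and over the
  whole space gives the two sides.\<close>

lemma invariant_set_rectangle:
  assumes E: "E \<in> sets (M \<Otimes>\<^sub>M M)" and A: "A \<in> events" and B: "B \<in> events"
    and inv: "\<And>j x y. x \<in> space M \<Longrightarrow> y \<in> space M \<Longrightarrow> (T j x, T j y) \<in> E \<longleftrightarrow> (x, y) \<in> E"
    and sens: "\<And>f. f \<in> L2 M \<Longrightarrow> \<not> (\<exists>c. AE x in M. f x = c) \<Longrightarrow> mean_sensitive \<nu> F M T f"
  shows "measure (M \<Otimes>\<^sub>M M) (E \<inter> A \<times> B) = prob A * measure (M \<Otimes>\<^sub>M M) (E \<inter> space M \<times> B)"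
proof -
  obtain c where "AE x in M. complex_of_real (prob (Pair x -` E \<inter> B)) = c"
    using sens[OF fibre_measure_not_mean_sensitive(1)[OF E B inv]]
      fibre_measure_not_mean_sensitive(2)[OF E B inv] by blast
  then have c: "AE x in M. prob (Pair x -` E \<inter> B) = Re c"
    by eventually_elim auto
  \<comment> \<open>Only the positive part of \<open>Re c\<close> survives in an extended
    nonnegative integral; writing it as a maximum avoids settling the sign.\<close>
  have "measure (M \<Otimes>\<^sub>M M) (E \<inter> A \<times> B) = prob A * max 0 (Re c)" if A: "A \<in> events" for A
  proof -
    have "emeasure (M \<Otimes>\<^sub>M M) (E \<inter> A \<times> B) = (\<integral>\<^sup>+x. emeasure M (Pair x -` (E \<inter> A \<times> B)) \<partial>M)"
      using E A B by (intro emeasure_pair_measure_alt) auto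
    also have "\<dots> = (\<integral>\<^sup>+x. ennreal (Re c) * indicator A x \<partial>M)"
    proof (rule nn_integral_cong_AE)
      show "AE x in M. emeasure M (Pair x -` (E \<inter> A \<times> B)) = ennreal (Re c) * indicator A x"
        using c
      proof eventually_elim
        case (elim x)
        have "Pair x -` (E \<inter> A \<times> B) = (if x \<in> A then Pair x -` E \<inter> B else {})" by auto
        then show ?case using elim by (simp add: emeasure_eq_measure)
      qed
    qed
    also have "\<dots> = ennreal (Re c) * ennreal (prob A)"
      using A by (simp add: nn_integral_cmult_indicator emeasure_eq_measure)
    also have "\<dots> = ennreal (prob A * max 0 (Re c))"
      by (simp add: ennreal_mult' mult.commute max_def ennreal_neg)
    finally show ?thesis
      by (simp add: measure_def)
  qed
  from this[OF A] this[OF sets.top] show ?thesis by (simp add: prob_space)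
qed

text \<open>The rectangle formula, applied to \<open>E\<close> and to its mirror image
  \<open>E'\<close>, shows that \<open>E\<close> is independent of every rectangle. By a Dynkin
  argument it is independent of every measurable set, in particular of itself, so its measure equals
  its own square.\<close>

theorem mean_sensitive_imp_weakly_mixing:
  assumes sens: "\<And>f. f \<in> L2 M \<Longrightarrow> \<not> (\<exists>c. AE x in M. f x = c) \<Longrightarrow> mean_sensitive \<nu> F M T f"
  shows "weakly_mixing M T"
  unfolding weakly_mixing_def ergodic_def
proof (intro ballI impI)
  let ?P = "measure (M \<Otimes>\<^sub>M M)"
  fix E assume E: "E \<in> sets (M \<Otimes>\<^sub>M M)"
    and inv': "\<forall>j. (\<lambda>(x, y). (T j x, T j y)) -` E \<inter> space (M \<Otimes>\<^sub>M M) = E"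
  have inv: "(T j x, T j y) \<in> E \<longleftrightarrow> (x, y) \<in> E" if "x \<in> space M" "y \<in> space M" for j x y
  proof -
    have "(x, y) \<in> (\<lambda>(x, y). (T j x, T j y)) -` E \<inter> space (M \<Otimes>\<^sub>M M) \<longleftrightarrow> (x, y) \<in> E"
      using inv' by simp
    then show ?thesis using that by (simp add: space_pair_measure)
  qed
  define E' where "E' = (\<lambda>(x, y). (y, x)) -` E \<inter> space (M \<Otimes>\<^sub>M M)"
  have E': "E' \<in> sets (M \<Otimes>\<^sub>M M)"
    unfolding E'_def using E by (intro measurable_sets[OF measurable_pair_swap'])
  have swap: "?P D = ?P ((\<lambda>(x, y). (y, x)) -` D \<inter> space (M \<Otimes>\<^sub>M M))"
    if "D \<in> sets (M \<Otimes>\<^sub>M M)" for D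
  proof -
    have "?P D = measure (distr (M \<Otimes>\<^sub>M M) (M \<Otimes>\<^sub>M M) (\<lambda>(x, y). (y, x))) D"
      using MM.distr_pair_swap by simp
    then show ?thesis using that by (simp add: measure_distr[OF measurable_pair_swap'])
  qed
  have rect: "?P (E \<inter> A \<times> B) = ?P E * ?P (A \<times> B)" if A: "A \<in> events" and B: "B \<in> events" for A B
  proof -
    have "?P (E \<inter> A \<times> B) = prob A * ?P (E \<inter> space M \<times> B)"
      by (rule invariant_set_rectangle[OF E A B inv sens])
    also have "?P (E \<inter> space M \<times> B) = ?P (E' \<inter> B \<times> space M)"
      using swap[of "E \<inter> space M \<times> B"] E B sets.sets_into_space[OF B]
      by (auto simp: E'_def space_pair_measure intro!: arg_cong[of _ _ ?P])
    also have "\<dots> = prob B * ?P (E' \<inter> space M \<times> space M)"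
    proof (rule invariant_set_rectangle[OF E' B sets.top _ sens])
      show "(T j x, T j y) \<in> E' \<longleftrightarrow> (x, y) \<in> E'" if "x \<in> space M" "y \<in> space M" for j x y
        using inv[OF that(2,1)] that T_space by (auto simp: E'_def space_pair_measure)
    qed
    also have "?P (E' \<inter> space M \<times> space M) = ?P E"
      using swap[OF E] by (auto simp: E'_def space_pair_measure intro!: arg_cong[of _ _ ?P])
    also have "prob A * (prob B * ?P E) = ?P E * ?P (A \<times> B)"
      using A B by (simp add: measure_def emeasure_pair_measure_Times enn2real_mult)
    finally show ?thesis .
  qed
  let ?G = "{a \<times> b | a b. a \<in> sets M \<and> b \<in> sets M}"
  have sG: "sigma_sets (space M \<times> space M) ?G = sets (M \<Otimes>\<^sub>M M)"
    by (simp add: sets_pair_measure)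
  have **: "?G \<subseteq> Pow (space M \<times> space M)" using sets.sets_into_space by blast
  have "?P (E \<inter> D) = ?P E * ?P D" if "D \<in> sigma_sets (space M \<times> space M) ?G" for D
    using Int_stable_pair_measure_generator ** that
  proof (induction rule: sigma_sets_induct_disjoint)
    case (basic D)
    then show ?case using rect by auto
  next
    case empty
    then show ?case by simp
  next
    case (compl D)
    have D: "D \<in> sets (M \<Otimes>\<^sub>M M)" using compl.hyps sG by simp
    have "E \<inter> (space M \<times> space M - D) = E - E \<inter> D"
      using sets.sets_into_space[OF E] by (auto simp: space_pair_measure)
    then have a: "?P (E \<inter> (space M \<times> space M - D)) = ?P E - ?P (E \<inter> D)"
      using E D by (simp add: MM.finite_measure_Diff)
    have b: "?P (space M \<times> space M - D) = 1 - ?P D"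
      using MM.prob_compl[OF D] by (simp add: space_pair_measure)
    show ?case unfolding a b compl.IH by (simp add: right_diff_distrib)
  next
    case (union D)
    have D: "D i \<in> sets (M \<Otimes>\<^sub>M M)" for i using union.hyps(2) sG by auto
    have ran: "range (\<lambda>i. E \<inter> D i) \<subseteq> sets (M \<Otimes>\<^sub>M M)" "range D \<subseteq> sets (M \<Otimes>\<^sub>M M)" using E D by auto
    have disj: "disjoint_family (\<lambda>i. E \<inter> D i)"
      using union.hyps(1) unfolding disjoint_family_on_def by blast
    have "(\<lambda>i. ?P E * ?P (D i)) sums ?P (\<Union>i. E \<inter> D i)"
      using MM.finite_measure_UNION[OF ran(1) disj] unfolding union.IH .
    moreover have "(\<lambda>i. ?P E * ?P (D i)) sums (?P E * ?P (\<Union>i. D i))"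
      by (rule sums_mult[OF MM.finite_measure_UNION[OF ran(2) union.hyps(1)]])
    ultimately have "?P (\<Union>i. E \<inter> D i) = ?P E * ?P (\<Union>i. D i)"
      by (rule sums_unique2)
    then show ?case unfolding Int_UN_distrib .
  qed
  from this[of E] E sG have "?P E = ?P E * ?P E" by simp
  then show "?P E = 0 \<or> ?P E = 1" by simp
qed

end

section \<open>Bounded integral kernels\<close>

context prob_space
begin

interpretation MM: pair_prob_space M M ..

text \<open>The bound is required at every point and not just essentially. Integrals over single
  sections then always exist, and identities such as associativity of \<open>kcomp\<close> hold
  pointwise.\<close>

definition kernels :: "('a \<times> 'a \<Rightarrow> complex) set" where
  "kernels = {K \<in> borel_measurable (M \<Otimes>\<^sub>M M). \<exists>B. \<forall>z\<in>space (M \<Otimes>\<^sub>M M). cmod (K z) \<le> B}"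

definition kcomp :: "('a \<times> 'a \<Rightarrow> complex) \<Rightarrow> ('a \<times> 'a \<Rightarrow> complex) \<Rightarrow> 'a \<times> 'a \<Rightarrow> complex" where
  "kcomp K L = (\<lambda>z. LINT w|M. K (fst z, w) * L (w, snd z))"

definition kadj :: "('a \<times> 'a \<Rightarrow> complex) \<Rightarrow> 'a \<times> 'a \<Rightarrow> complex" where
  "kadj K = (\<lambda>z. cnj (K (snd z, fst z)))"

definition kapp :: "('a \<times> 'a \<Rightarrow> complex) \<Rightarrow> ('a \<Rightarrow> complex) \<Rightarrow> 'a \<Rightarrow> complex" where
  "kapp K h = (\<lambda>x. LINT y|M. K (x, y) * h y)"

definition tensor :: "('a \<Rightarrow> complex) \<Rightarrow> ('a \<Rightarrow> complex) \<Rightarrow> 'a \<times> 'a \<Rightarrow> complex" where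
  "tensor f g = (\<lambda>z. f (fst z) * cnj (g (snd z)))"

abbreviation kip :: "('a \<times> 'a \<Rightarrow> complex) \<Rightarrow> ('a \<times> 'a \<Rightarrow> complex) \<Rightarrow> complex" where
  "kip \<equiv> L2_inner (M \<Otimes>\<^sub>M M)"

abbreviation knorm :: "('a \<times> 'a \<Rightarrow> complex) \<Rightarrow> real" where
  "knorm \<equiv> L2_norm (M \<Otimes>\<^sub>M M)"

abbreviation keq :: "('a \<times> 'a \<Rightarrow> complex) \<Rightarrow> ('a \<times> 'a \<Rightarrow> complex) \<Rightarrow> bool" (infix "\<doteq>" 50) where
  "K \<doteq> L \<equiv> (AE z in M \<Otimes>\<^sub>M M. K z = L z)"

lemma kernelsI:
  "K \<in> borel_measurable (M \<Otimes>\<^sub>M M) \<Longrightarrow> (\<And>x y. x \<in> space M \<Longrightarrow> y \<in> space M \<Longrightarrow> cmod (K (x, y)) \<le> B) \<Longrightarrow>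
    K \<in> kernels"
  by (auto simp: kernels_def space_pair_measure)

lemma kernels_measurable [measurable_dest]: "K \<in> kernels \<Longrightarrow> K \<in> borel_measurable (M \<Otimes>\<^sub>M M)"
  by (simp add: kernels_def)

lemma kernels_bound:
  assumes "K \<in> kernels"
  obtains B where "B \<ge> 0" "\<And>x y. x \<in> space M \<Longrightarrow> y \<in> space M \<Longrightarrow> cmod (K (x, y)) \<le> B"
proof -
  obtain B where B: "\<forall>z\<in>space (M \<Otimes>\<^sub>M M). cmod (K z) \<le> B"
    using assms by (auto simp: kernels_def)
  show thesis
    by (rule that[of "max B 0"]) (use B in \<open>auto simp: space_pair_measure le_max_iff_disj\<close>)
qed

lemma kernels_L2: "K \<in> kernels \<Longrightarrow> K \<in> L2 (M \<Otimes>\<^sub>M M)"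
  by (auto simp: kernels_def intro: MM.L2_bounded)

lemma kernels_add:
  assumes "K \<in> kernels" "L \<in> kernels"
  shows "(\<lambda>z. K z + L z) \<in> kernels"
proof -
  obtain B B' where "\<And>x y. x \<in> space M \<Longrightarrow> y \<in> space M \<Longrightarrow> cmod (K (x, y)) \<le> B"
    "\<And>x y. x \<in> space M \<Longrightarrow> y \<in> space M \<Longrightarrow> cmod (L (x, y)) \<le> B'"
    using assms[THEN kernels_bound] by metis
  then show ?thesis
    using assms by (intro kernelsI[of _ "B + B'"] order_trans[OF norm_triangle_ineq add_mono]) auto
qed

lemma kernels_scale:
  assumes "K \<in> kernels"
  shows "(\<lambda>z. c * K z) \<in> kernels"
proof -
  obtain B where "\<And>x y. x \<in> space M \<Longrightarrow> y \<in> space M \<Longrightarrow> cmod (K (x, y)) \<le> B"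
    using assms[THEN kernels_bound] by metis
  then show ?thesis
    using assms by (intro kernelsI[of _ "cmod c * B"]) (auto simp: norm_mult mult_left_mono)
qed

lemma kernels_diff: "K \<in> kernels \<Longrightarrow> L \<in> kernels \<Longrightarrow> (\<lambda>z. K z - L z) \<in> kernels"
  using kernels_add[of K "\<lambda>z. (-1) * L z"] kernels_scale[of L "-1"] by simp

lemma kadj_kernels:
  assumes "K \<in> kernels"
  shows "kadj K \<in> kernels"
proof -
  obtain B where "\<And>x y. x \<in> space M \<Longrightarrow> y \<in> space M \<Longrightarrow> cmod (K (x, y)) \<le> B"
    using assms[THEN kernels_bound] by metis
  then show ?thesis
    using kernels_measurable[OF assms] unfolding kadj_def by (intro kernelsI[of _ B]) (measurable, auto)
qed

lemma integral_norm_bounded_le: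
  fixes f :: "'a \<Rightarrow> complex"
  assumes "\<And>x. x \<in> space M \<Longrightarrow> cmod (f x) \<le> B" "f \<in> borel_measurable M"
  shows "cmod (LINT x|M. f x) \<le> B"
proof -
  have int: "integrable M f" using assms by (intro integrable_const_bound[of _ B]) auto
  have "cmod (LINT x|M. f x) \<le> (LINT x|M. cmod (f x))" by (rule integral_norm_bound)
  also have "\<dots> \<le> (LINT x|M. B)" using int assms(1) by (intro integral_mono) auto
  finally show ?thesis by (simp add: prob_space)
qed

lemma kernels_section:
  assumes "K \<in> kernels" "x \<in> space M"
  shows "(\<lambda>y. K (x, y)) \<in> borel_measurable M" "(\<lambda>y. K (y, x)) \<in> borel_measurable M"
proof -
  note [measurable] = kernels_measurable[OF assms(1)] and assms(2) [simp]
  show "(\<lambda>y. K (x, y)) \<in> borel_measurable M" "(\<lambda>y. K (y, x)) \<in> borel_measurable M"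
    by measurable
qed

lemma kcomp_bound:
  assumes K: "K \<in> kernels" "\<And>x y. x \<in> space M \<Longrightarrow> y \<in> space M \<Longrightarrow> cmod (K (x, y)) \<le> B"
    and L: "L \<in> kernels" "\<And>x y. x \<in> space M \<Longrightarrow> y \<in> space M \<Longrightarrow> cmod (L (x, y)) \<le> B'"
    and "x \<in> space M" "y \<in> space M"
  shows "cmod (kcomp K L (x, y)) \<le> B * B'"
proof -
  have "0 \<le> B" using K(2)[of x x] assms(5) norm_ge_zero order_trans by blast
  then show ?thesis
    unfolding kcomp_def using assms kernels_section[OF K(1), of x] kernels_section[OF L(1), of y]
    by (intro integral_norm_bounded_le) (auto simp: norm_mult intro!: mult_mono)
qed

lemma kcomp_kernels:
  assumes K: "K \<in> kernels" and L: "L \<in> kernels"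
  shows "kcomp K L \<in> kernels"
proof -
  obtain B B' where B: "\<And>x y. x \<in> space M \<Longrightarrow> y \<in> space M \<Longrightarrow> cmod (K (x, y)) \<le> B"
    "\<And>x y. x \<in> space M \<Longrightarrow> y \<in> space M \<Longrightarrow> cmod (L (x, y)) \<le> B'"
    using K[THEN kernels_bound] L[THEN kernels_bound] by metis
  have "kcomp K L \<in> borel_measurable (M \<Otimes>\<^sub>M M)"
    unfolding kcomp_def using kernels_measurable[OF K] kernels_measurable[OF L] by measurable
  then show ?thesis using kcomp_bound[OF K B(1) L B(2)] by (rule kernelsI)
qed

lemma bounded_integrable_pair:
  fixes f :: "'a \<Rightarrow> 'a \<Rightarrow> complex"
  assumes "(\<lambda>z. f (fst z) (snd z)) \<in> borel_measurable (M \<Otimes>\<^sub>M M)"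
    "\<And>x y. x \<in> space M \<Longrightarrow> y \<in> space M \<Longrightarrow> cmod (f x y) \<le> B"
  shows "integrable (M \<Otimes>\<^sub>M M) (\<lambda>z. f (fst z) (snd z))"
  using assms by (intro MM.integrable_const_bound[of _ B]) (auto simp: space_pair_measure)

lemma bounded_integral_pair:
  fixes f :: "'a \<Rightarrow> 'a \<Rightarrow> complex"
  assumes "(\<lambda>z. f (fst z) (snd z)) \<in> borel_measurable (M \<Otimes>\<^sub>M M)"
    "\<And>x y. x \<in> space M \<Longrightarrow> y \<in> space M \<Longrightarrow> cmod (f x y) \<le> B"
  shows "(LINT z|(M \<Otimes>\<^sub>M M). f (fst z) (snd z)) = (LINT x|M. LINT y|M. f x y)"
  using MM.integral_fst'[OF bounded_integrable_pair[OF assms]] by simp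

lemma bounded_integral_swap:
  fixes f :: "'a \<Rightarrow> 'a \<Rightarrow> complex"
  assumes "(\<lambda>z. f (fst z) (snd z)) \<in> borel_measurable (M \<Otimes>\<^sub>M M)"
    "\<And>x y. x \<in> space M \<Longrightarrow> y \<in> space M \<Longrightarrow> cmod (f x y) \<le> B"
  shows "(LINT x|M. LINT y|M. f x y) = (LINT y|M. LINT x|M. f x y)"
  using MM.Fubini_integral[of f] bounded_integrable_pair[OF assms] by (simp add: case_prod_beta')

lemma kcomp_assoc:
  assumes K: "K \<in> kernels" and L: "L \<in> kernels" and J: "J \<in> kernels" and z: "z \<in> space (M \<Otimes>\<^sub>M M)"
  shows "kcomp (kcomp K L) J z = kcomp K (kcomp L J) z"
proof -
  obtain x y where xy: "z = (x, y)" "x \<in> space M" "y \<in> space M"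
    using z by (auto simp: space_pair_measure)
  obtain B1 where B1: "B1 \<ge> 0" "\<And>x y. x \<in> space M \<Longrightarrow> y \<in> space M \<Longrightarrow> cmod (K (x, y)) \<le> B1"
    using kernels_bound[OF K] by blast
  obtain B2 where B2: "B2 \<ge> 0" "\<And>x y. x \<in> space M \<Longrightarrow> y \<in> space M \<Longrightarrow> cmod (L (x, y)) \<le> B2"
    using kernels_bound[OF L] by blast
  obtain B3 where B3: "B3 \<ge> 0" "\<And>x y. x \<in> space M \<Longrightarrow> y \<in> space M \<Longrightarrow> cmod (J (x, y)) \<le> B3"
    using kernels_bound[OF J] by blast
  note [measurable] = kernels_measurable[OF K] kernels_measurable[OF L] kernels_measurable[OF J]
  note [simp] = xy(2,3)
  have "kcomp (kcomp K L) J z = (LINT w|M. LINT v|M. K (x, v) * L (v, w) * J (w, y))"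
    by (simp add: kcomp_def xy)
  also have "\<dots> = (LINT v|M. LINT w|M. K (x, v) * L (v, w) * J (w, y))"
    by (rule bounded_integral_swap[of _ "B1 * B2 * B3"])
       (measurable, auto simp: norm_mult xy B1 B2 B3 intro!: mult_mono)
  also have "\<dots> = kcomp K (kcomp L J) z"
    by (simp add: kcomp_def xy mult.assoc)
  finally show ?thesis .
qed

lemma kapp_measurable:
  assumes "K \<in> kernels" "h \<in> L2 M"
  shows "kapp K h \<in> borel_measurable M"
proof -
  note [measurable] = kernels_measurable[OF assms(1)] L2_measurable[OF assms(2)]
  show ?thesis unfolding kapp_def by measurable
qed

lemma kapp_L2:
  assumes K: "K \<in> kernels" and h: "h \<in> L2 M"
  shows "kapp K h \<in> L2 M"
proof -
  obtain B where B: "B \<ge> 0" "\<And>x y. x \<in> space M \<Longrightarrow> y \<in> space M \<Longrightarrow> cmod (K (x, y)) \<le> B"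
    using kernels_bound[OF K] by blast
  show ?thesis
  proof (rule L2_bounded[OF kapp_measurable[OF K h]])
    fix x assume x: "x \<in> space M"
    have "cmod (kapp K h x) \<le> (LINT y|M. cmod (K (x, y) * h y))"
      unfolding kapp_def by (rule integral_norm_bound)
    also have "\<dots> \<le> (LINT y|M. B * cmod (h y))"
      using B x L2_integrable[OF h] by (intro integral_mono') (auto simp: norm_mult mult_right_mono)
    finally show "cmod (kapp K h x) \<le> (LINT y|M. B * cmod (h y))" .
  qed
qed

lemma tensor_L2:
  assumes f: "f \<in> L2 M" and g: "g \<in> L2 M"
  shows "tensor f g \<in> L2 (M \<Otimes>\<^sub>M M)" "knorm (tensor f g) = L2_norm M f * L2_norm M g"
proof -
  note [measurable] = L2_measurable[OF f] L2_measurable[OF g]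
  have m: "tensor f g \<in> borel_measurable (M \<Otimes>\<^sub>M M)" unfolding tensor_def by measurable
  have eq: "(cmod (tensor f g z))\<^sup>2 = (cmod (f (fst z)))\<^sup>2 * (cmod (g (snd z)))\<^sup>2" for z
    by (simp add: tensor_def norm_mult power_mult_distrib)
  have int: "integrable (M \<Otimes>\<^sub>M M) (\<lambda>z. (cmod (f (fst z)))\<^sup>2 * (cmod (g (snd z)))\<^sup>2)"
    using L2_square_integrable[OF f] L2_square_integrable[OF g]
    by (intro MM.Fubini_integrable) auto
  then show "tensor f g \<in> L2 (M \<Otimes>\<^sub>M M)" using m by (simp add: L2_def eq)
  have "(LINT z|(M \<Otimes>\<^sub>M M). (cmod (tensor f g z))\<^sup>2) = (LINT x|M. (cmod (f x))\<^sup>2) * (LINT y|M. (cmod (g y))\<^sup>2)"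
    using MM.integral_fst'[OF int] by (simp add: eq)
  then show "knorm (tensor f g) = L2_norm M f * L2_norm M g"
    by (simp add: L2_norm_def real_sqrt_mult)
qed

text \<open>\<open>tensor g h\<close> is the kernel of a rank one operator, and the matrix
  coefficient of \<open>K\<close> is its Hilbert-Schmidt inner product with it. This is the bridge
  from eigenfunctions of the system to averages on the square.\<close>

lemma kapp_inner:
  assumes K: "K \<in> kernels" and h: "h \<in> L2 M" and g: "g \<in> L2 M"
  shows "L2_inner M (kapp K h) g = kip K (tensor g h)"
proof -
  have "kip K (tensor g h) = (LINT x|M. LINT y|M. K (x, y) * cnj (tensor g h (x, y)))"
    unfolding L2_inner_def
    using MM.integral_fst'[OF L2_mult_cnj_integrable[OF kernels_L2[OF K] tensor_L2(1)[OF g h]]] by simp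
  also have "\<dots> = (LINT x|M. kapp K h x * cnj (g x))"
    unfolding kapp_def tensor_def
    by (intro Bochner_Integration.integral_cong refl) (simp add: mult.assoc[symmetric] mult.commute[of "cnj _"] flip: integral_mult_left_zero)
  finally show ?thesis by (simp add: L2_inner_def)
qed

lemma kapp_kcomp:
  assumes K: "K \<in> kernels" and L: "L \<in> kernels" and h: "h \<in> L2 M" and x: "x \<in> space M"
  shows "kapp (kcomp K L) h x = kapp K (kapp L h) x"
proof -
  obtain B1 where B1: "B1 \<ge> 0" "\<And>x y. x \<in> space M \<Longrightarrow> y \<in> space M \<Longrightarrow> cmod (K (x, y)) \<le> B1"
    using kernels_bound[OF K] by blast
  obtain B2 where B2: "B2 \<ge> 0" "\<And>x y. x \<in> space M \<Longrightarrow> y \<in> space M \<Longrightarrow> cmod (L (x, y)) \<le> B2"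
    using kernels_bound[OF L] by blast
  note [measurable] = kernels_measurable[OF K] kernels_measurable[OF L] L2_measurable[OF h]
  note [simp] = x
  have h1: "integrable (M \<Otimes>\<^sub>M M) (\<lambda>z. h (fst z))"
    using L2_integrable[OF h] by (intro MM.Fubini_integrable) auto
  have int: "integrable (M \<Otimes>\<^sub>M M) (case_prod (\<lambda>y w. K (x, w) * L (w, y) * h y))"
  proof (rule Bochner_Integration.integrable_bound)
    show "integrable (M \<Otimes>\<^sub>M M) (\<lambda>z. of_real (B1 * B2) * h (fst z))" using h1 by auto
    show "AE z in M \<Otimes>\<^sub>M M. norm (case z of (y, w) \<Rightarrow> K (x, w) * L (w, y) * h y) \<le> norm (of_real (B1 * B2) * h (fst z))"
      using B1 B2 x by (intro AE_I2) (auto simp: space_pair_measure norm_mult intro!: mult_right_mono mult_mono)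
  qed measurable
  have "kapp (kcomp K L) h x = (LINT y|M. LINT w|M. K (x, w) * L (w, y) * h y)"
    by (simp add: kapp_def kcomp_def)
  also have "\<dots> = (LINT w|M. LINT y|M. K (x, w) * L (w, y) * h y)"
    by (rule MM.Fubini_integral[OF int, symmetric])
  also have "\<dots> = kapp K (kapp L h) x"
    by (simp add: kapp_def mult.assoc)
  finally show ?thesis .
qed

lemma kip_iterated:
  assumes K: "K \<in> kernels" and L: "L \<in> kernels"
  shows "kip K L = (LINT x|M. LINT y|M. K (x, y) * cnj (L (x, y)))"
  unfolding L2_inner_def
  using MM.integral_fst'[OF L2_mult_cnj_integrable[OF kernels_L2[OF K] kernels_L2[OF L]]] by simp

text \<open>Both are the cyclicity of the trace, since \<open>kip K L\<close> is the trace of K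
  times the adjoint of L. They come from reordering one triple integral of a bounded
  function.\<close>

lemma
  assumes K: "K \<in> kernels" and L: "L \<in> kernels" and J: "J \<in> kernels"
  shows kip_kcomp_left: "kip (kcomp K L) J = kip L (kcomp (kadj K) J)"
    and kip_kcomp_right: "kip (kcomp K L) J = kip K (kcomp J (kadj L))"
proof -
  obtain B1 where B1: "B1 \<ge> 0" "\<And>x y. x \<in> space M \<Longrightarrow> y \<in> space M \<Longrightarrow> cmod (K (x, y)) \<le> B1"
    using kernels_bound[OF K] by blast
  obtain B2 where B2: "B2 \<ge> 0" "\<And>x y. x \<in> space M \<Longrightarrow> y \<in> space M \<Longrightarrow> cmod (L (x, y)) \<le> B2"
    using kernels_bound[OF L] by blast
  obtain B3 where B3: "B3 \<ge> 0" "\<And>x y. x \<in> space M \<Longrightarrow> y \<in> space M \<Longrightarrow> cmod (J (x, y)) \<le> B3"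
    using kernels_bound[OF J] by blast
  note [measurable] = kernels_measurable[OF K] kernels_measurable[OF L] kernels_measurable[OF J]
  let ?f = "\<lambda>x y w. K (x, w) * L (w, y) * cnj (J (x, y))"
  have b: "cmod (?f x y w) \<le> B1 * B2 * B3" if "x \<in> space M" "y \<in> space M" "w \<in> space M" for x y w
    using that B1 B2 B3 by (auto simp: norm_mult intro!: mult_mono)
  have lhs: "kip (kcomp K L) J = (LINT x|M. LINT y|M. LINT w|M. ?f x y w)"
    by (subst kip_iterated[OF kcomp_kernels[OF K L] J]) (simp add: kcomp_def)
  also have "\<dots> = (LINT x|M. LINT w|M. LINT y|M. ?f x y w)"
  proof (rule Bochner_Integration.integral_cong[OF refl])
    fix x assume x: "x \<in> space M"
    have "(\<lambda>z. L (snd z, fst z)) \<in> borel_measurable (M \<Otimes>\<^sub>M M)" by measurable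
    then have "(\<lambda>z. ?f x (fst z) (snd z)) \<in> borel_measurable (M \<Otimes>\<^sub>M M)"
      by (rule borel_measurable_times[OF borel_measurable_times borel_measurable_cnj,
        OF measurable_compose[OF measurable_snd kernels_section(1)[OF K x]] _
           measurable_compose[OF measurable_fst kernels_section(1)[OF J x]]])
    then show "(LINT y|M. LINT w|M. ?f x y w) = (LINT w|M. LINT y|M. ?f x y w)"
      by (rule bounded_integral_swap) (rule b[OF x])
  qed
  finally have xwy: "kip (kcomp K L) J = (LINT x|M. LINT w|M. LINT y|M. ?f x y w)" .
  then show "kip (kcomp K L) J = kip K (kcomp J (kadj L))"
    by (subst kip_iterated[OF K kcomp_kernels[OF J kadj_kernels[OF L]]])
       (simp add: kcomp_def kadj_def mult_ac flip: Bochner_Integration.integral_cnj integral_mult_right_zero)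
  have "(LINT x|M. LINT w|M. LINT y|M. ?f x y w) = (LINT w|M. LINT x|M. LINT y|M. ?f x y w)"
  proof (rule bounded_integral_swap[of _ "B1 * B2 * B3"])
    show "(\<lambda>z. LINT y|M. ?f (fst z) y (snd z)) \<in> borel_measurable (M \<Otimes>\<^sub>M M)" by measurable
    show "cmod (LINT y|M. ?f x y w) \<le> B1 * B2 * B3" if xw: "x \<in> space M" "w \<in> space M" for x w
      using kernels_section[OF J xw(1)] kernels_section[OF L xw(2)] b xw
      by (intro integral_norm_bounded_le) auto
  qed
  also have "\<dots> = (LINT w|M. LINT y|M. LINT x|M. ?f x y w)"
  proof (rule Bochner_Integration.integral_cong[OF refl])
    fix w assume w: "w \<in> space M"
    have "(\<lambda>z. J (fst z, snd z)) \<in> borel_measurable (M \<Otimes>\<^sub>M M)" by measurable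
    then have "(\<lambda>z. ?f (fst z) (snd z) w) \<in> borel_measurable (M \<Otimes>\<^sub>M M)"
      by (rule borel_measurable_times[OF borel_measurable_times borel_measurable_cnj,
        OF measurable_compose[OF measurable_fst kernels_section(2)[OF K w]]
           measurable_compose[OF measurable_snd kernels_section(1)[OF L w]]])
    then show "(LINT x|M. LINT y|M. ?f x y w) = (LINT y|M. LINT x|M. ?f x y w)"
      by (rule bounded_integral_swap) (rule b[OF _ _ w])
  qed
  finally show "kip (kcomp K L) J = kip L (kcomp (kadj K) J)"
    unfolding xwy by (subst kip_iterated[OF L kcomp_kernels[OF kadj_kernels[OF K] J]])
       (simp add: kcomp_def kadj_def mult_ac flip: Bochner_Integration.integral_cnj integral_mult_right_zero)
qed

lemma kadj_kcomp: "kadj (kcomp K L) = kcomp (kadj L) (kadj K)"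
  unfolding kadj_def kcomp_def by (simp flip: Bochner_Integration.integral_cnj add: mult.commute)

lemma kip_kadj:
  assumes K: "K \<in> kernels" and L: "L \<in> kernels"
  shows "kip (kadj K) (kadj L) = kip L K"
proof -
  have "kip (kadj K) (kadj L) = (LINT x|M. LINT y|M. L (y, x) * cnj (K (y, x)))"
    by (simp add: kip_iterated[OF kadj_kernels[OF K] kadj_kernels[OF L]]) (simp add: kadj_def mult.commute)
  also have "\<dots> = (LINT y|M. LINT x|M. L (y, x) * cnj (K (y, x)))"
    using MM.Fubini_integral[of "\<lambda>y x. L (y, x) * cnj (K (y, x))"]
      L2_mult_cnj_integrable[OF kernels_L2[OF L] kernels_L2[OF K]] by (simp add: case_prod_beta')
  also have "\<dots> = kip L K" by (rule kip_iterated[OF L K, symmetric])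
  finally show ?thesis .
qed

lemma knorm_kadj: "K \<in> kernels \<Longrightarrow> knorm (kadj K) = knorm K"
  using kip_kadj[of K K] by (simp add: L2_inner_self L2_norm_nonneg del: of_real_power)

lemma kcomp_Cauchy_Schwarz:
  assumes K: "K \<in> kernels" and L: "L \<in> kernels" and xy: "x \<in> space M" "y \<in> space M"
  shows "(cmod (kcomp K L (x, y)))\<^sup>2 \<le> (LINT w|M. (cmod (K (x, w)))\<^sup>2) * (LINT w|M. (cmod (L (w, y)))\<^sup>2)"
proof -
  obtain B1 where B1: "B1 \<ge> 0" "\<And>x y. x \<in> space M \<Longrightarrow> y \<in> space M \<Longrightarrow> cmod (K (x, y)) \<le> B1"
    using kernels_bound[OF K] by blast
  obtain B2 where B2: "B2 \<ge> 0" "\<And>x y. x \<in> space M \<Longrightarrow> y \<in> space M \<Longrightarrow> cmod (L (x, y)) \<le> B2"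
    using kernels_bound[OF L] by blast
  have k: "(\<lambda>w. K (x, w)) \<in> L2 M" "(\<lambda>w. cnj (L (w, y))) \<in> L2 M"
    by (rule L2_bounded[OF kernels_section(1)[OF K xy(1)] B1(2)[OF xy(1)]], assumption)
       (rule L2_cnj, rule L2_bounded[OF kernels_section(2)[OF L xy(2)] B2(2)[OF _ xy(2)]])
  have "cmod (kcomp K L (x, y)) = cmod (L2_inner M (\<lambda>w. K (x, w)) (\<lambda>w. cnj (L (w, y))))"
    by (simp add: kcomp_def L2_inner_def)
  also have "\<dots> \<le> L2_norm M (\<lambda>w. K (x, w)) * L2_norm M (\<lambda>w. cnj (L (w, y)))"
    by (rule L2_Cauchy_Schwarz[OF k])
  finally have "(cmod (kcomp K L (x, y)))\<^sup>2 \<le> (L2_norm M (\<lambda>w. K (x, w)) * L2_norm M (\<lambda>w. cnj (L (w, y))))\<^sup>2"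
    by (intro power_mono) auto
  then show ?thesis by (simp add: power_mult_distrib L2_norm_square)
qed

lemma knorm_square_iterated:
  assumes K: "K \<in> kernels"
  shows "(knorm K)\<^sup>2 = (LINT x|M. LINT y|M. (cmod (K (x, y)))\<^sup>2)"
    and "(knorm K)\<^sup>2 = (LINT y|M. LINT x|M. (cmod (K (x, y)))\<^sup>2)"
    and "integrable M (\<lambda>x. LINT y|M. (cmod (K (x, y)))\<^sup>2)"
    and "integrable M (\<lambda>y. LINT x|M. (cmod (K (x, y)))\<^sup>2)"
proof -
  note int = L2_square_integrable[OF kernels_L2[OF K]]
  show 1: "(knorm K)\<^sup>2 = (LINT x|M. LINT y|M. (cmod (K (x, y)))\<^sup>2)"
    unfolding L2_norm_square using MM.integral_fst'[OF int] by simp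
  show "(knorm K)\<^sup>2 = (LINT y|M. LINT x|M. (cmod (K (x, y)))\<^sup>2)"
    unfolding 1 using MM.Fubini_integral[of "\<lambda>x y. (cmod (K (x, y)))\<^sup>2"] int
    by (simp add: case_prod_beta')
  show "integrable M (\<lambda>x. LINT y|M. (cmod (K (x, y)))\<^sup>2)"
    using MM.integrable_fst'[OF int] .
  show "integrable M (\<lambda>y. LINT x|M. (cmod (K (x, y)))\<^sup>2)"
    using MM.integrable_snd[of "\<lambda>x y. (cmod (K (x, y)))\<^sup>2"] int by (simp add: case_prod_beta')
qed

text \<open>The pointwise Cauchy-Schwarz bound separates the two variables, and its integral is the
  product of the squared norms.\<close>

lemma knorm_kcomp:
  assumes K: "K \<in> kernels" and L: "L \<in> kernels"
  shows "knorm (kcomp K L) \<le> knorm K * knorm L"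
proof (rule power2_le_imp_le)
  let ?k = "\<lambda>x. LINT w|M. (cmod (K (x, w)))\<^sup>2" and ?l = "\<lambda>y. LINT w|M. (cmod (L (w, y)))\<^sup>2"
  note kl = knorm_square_iterated[OF K] knorm_square_iterated[OF L]
  have int: "integrable (M \<Otimes>\<^sub>M M) (\<lambda>z. ?k (fst z) * ?l (snd z))"
    using kl(3) kl(8) by (intro MM.Fubini_integrable) (auto simp: norm_mult)
  have "(knorm (kcomp K L))\<^sup>2 \<le> (LINT z|(M \<Otimes>\<^sub>M M). ?k (fst z) * ?l (snd z))"
    unfolding L2_norm_square using kcomp_Cauchy_Schwarz[OF K L]
    by (intro integral_mono' int) (auto simp: space_pair_measure intro!: mult_nonneg_nonneg Bochner_Integration.integral_nonneg)
  also have "\<dots> = (LINT x|M. ?k x) * (LINT y|M. ?l y)"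
    using MM.integral_fst'[OF int] by simp
  also have "\<dots> = (knorm K * knorm L)\<^sup>2"
    by (simp only: kl(1) kl(6) power_mult_distrib)
  finally show "(knorm (kcomp K L))\<^sup>2 \<le> (knorm K * knorm L)\<^sup>2" .
qed (simp add: L2_norm_nonneg)

text \<open>The middle factor enters through its Hilbert-Schmidt norm alone. Control of norms
  thereby becomes a pointwise bound, which keeps normalised powers, and hence their limit, among the
  bounded kernels.\<close>

lemma kcomp_sandwich_bound:
  assumes K: "K \<in> kernels" "\<And>x y. x \<in> space M \<Longrightarrow> y \<in> space M \<Longrightarrow> cmod (K (x, y)) \<le> B"
    and L: "L \<in> kernels" "\<And>x y. x \<in> space M \<Longrightarrow> y \<in> space M \<Longrightarrow> cmod (L (x, y)) \<le> B'"
    and J: "J \<in> kernels" and xy: "x \<in> space M" "y \<in> space M"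
  shows "cmod (kcomp K (kcomp J L) (x, y)) \<le> B * B' * knorm J"
proof -
  have B: "0 \<le> B" "0 \<le> B'"
    using K(2)[OF xy(1,1)] L(2)[OF xy(1,1)] norm_ge_zero order_trans by blast+
  note [measurable] = kernels_measurable[OF K(1)] kernels_measurable[OF L(1)] kernels_measurable[OF J]
  note [simp] = xy
  obtain C where C: "C \<ge> 0" "\<And>x y. x \<in> space M \<Longrightarrow> y \<in> space M \<Longrightarrow> cmod (J (x, y)) \<le> C"
    using kernels_bound[OF J] by blast
  let ?f = "\<lambda>v w. K (x, v) * J (v, w) * L (w, y)"
  have "kcomp K (kcomp J L) (x, y) = (LINT v|M. LINT w|M. ?f v w)"
    by (simp add: kcomp_def mult.assoc)
  also have "\<dots> = (LINT z|(M \<Otimes>\<^sub>M M). ?f (fst z) (snd z))"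
    by (rule bounded_integral_pair[symmetric, of _ "B * C * B'"])
       (measurable, auto simp: norm_mult xy K L C B intro!: mult_mono)
  also have "cmod \<dots> \<le> (LINT z|(M \<Otimes>\<^sub>M M). cmod (?f (fst z) (snd z)))"
    by (rule integral_norm_bound)
  also have "\<dots> \<le> (LINT z|(M \<Otimes>\<^sub>M M). B * B' * cmod (J z))"
  proof (rule integral_mono')
    show "integrable (M \<Otimes>\<^sub>M M) (\<lambda>z. B * B' * cmod (J z))"
      using MM.L2_integrable[OF kernels_L2[OF J]] by simp
    show "cmod (?f (fst z) (snd z)) \<le> B * B' * cmod (J z)" if "z \<in> space (M \<Otimes>\<^sub>M M)" for z
    proof -
      have "cmod (?f (fst z) (snd z)) \<le> B * cmod (J z) * B'"
        using that xy B by (auto simp: norm_mult space_pair_measure intro!: mult_mono K(2) L(2))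
      then show ?thesis by (simp add: mult_ac)
    qed
  qed (simp add: B)
  also have "\<dots> \<le> B * B' * knorm J"
    using MM.L2_integral_norm_le[OF kernels_L2[OF J]] B by (simp add: MM.prob_space mult_left_mono)
  finally show ?thesis .
qed

lemma keq_iff_knorm: "K \<in> kernels \<Longrightarrow> L \<in> kernels \<Longrightarrow> K \<doteq> L \<longleftrightarrow> knorm (\<lambda>z. K z - L z) = 0"
  using L2_norm_eq_0_iff[OF L2_diff[OF kernels_L2[of K] kernels_L2[of L]]] by simp

lemma kcomp_diff_left:
  assumes "K \<in> kernels" "K' \<in> kernels" "L \<in> kernels" "z \<in> space (M \<Otimes>\<^sub>M M)"
  shows "kcomp (\<lambda>z. K z - K' z) L z = kcomp K L z - kcomp K' L z"
proof -
  have int: "integrable M (\<lambda>w. J (fst z, w) * L (w, snd z))" if J: "J \<in> kernels" for J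
  proof -
    obtain B1 where B1: "B1 \<ge> 0" "\<And>x y. x \<in> space M \<Longrightarrow> y \<in> space M \<Longrightarrow> cmod (J (x, y)) \<le> B1"
      using kernels_bound[OF J] by blast
    obtain B2 where B2: "B2 \<ge> 0" "\<And>x y. x \<in> space M \<Longrightarrow> y \<in> space M \<Longrightarrow> cmod (L (x, y)) \<le> B2"
      using kernels_bound[OF assms(3)] by blast
    show ?thesis
      using assms(4) kernels_section[OF J, of "fst z"] kernels_section[OF assms(3), of "snd z"] B1 B2
      by (intro integrable_const_bound[of _ "B1 * B2"])
        (auto simp: space_pair_measure norm_mult intro!: AE_I2 mult_mono)
  qed
  show ?thesis
    using int[OF assms(1)] int[OF assms(2)] by (simp add: kcomp_def left_diff_distrib)
qed

lemma kcomp_diff_right: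
  assumes "K \<in> kernels" "L \<in> kernels" "L' \<in> kernels" "z \<in> space (M \<Otimes>\<^sub>M M)"
  shows "kcomp K (\<lambda>z. L z - L' z) z = kcomp K L z - kcomp K L' z"
proof -
  have "kadj (kcomp K (\<lambda>z. L z - L' z)) (snd z, fst z) =
      kadj (kcomp K L) (snd z, fst z) - kadj (kcomp K L') (snd z, fst z)"
    unfolding kadj_kcomp using kcomp_diff_left[OF kadj_kernels[OF assms(2)] kadj_kernels[OF assms(3)]
      kadj_kernels[OF assms(1)], of "(snd z, fst z)"] assms(4)
    by (simp add: kadj_def[of "\<lambda>z. L z - L' z"] kadj_def[of L] kadj_def[of L'] space_pair_measure mem_Times_iff)
  then show ?thesis by (simp add: kadj_def flip: complex_cnj_diff)
qed

lemma kcomp_scale_left: "kcomp (\<lambda>z. c * K z) L z = c * kcomp K L z"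
  by (simp add: kcomp_def mult.assoc)

lemma kcomp_scale_right: "kcomp K (\<lambda>z. c * L z) z = c * kcomp K L z"
  by (simp add: kcomp_def mult.left_commute)

lemma knorm_kcomp_diff:
  assumes K: "K \<in> kernels" "K' \<in> kernels" and L: "L \<in> kernels" "L' \<in> kernels"
  shows "knorm (\<lambda>z. kcomp K L z - kcomp K' L' z) \<le>
    knorm (\<lambda>z. K z - K' z) * knorm L + knorm K' * knorm (\<lambda>z. L z - L' z)"
proof -
  have "knorm (\<lambda>z. kcomp K L z - kcomp K' L' z) \<le>
      knorm (\<lambda>z. kcomp K L z - kcomp K' L z) + knorm (\<lambda>z. kcomp K' L z - kcomp K' L' z)"
    using assms by (intro L2_norm_triangle_diff kernels_L2 kcomp_kernels)
  also have "knorm (\<lambda>z. kcomp K L z - kcomp K' L z) = knorm (kcomp (\<lambda>z. K z - K' z) L)"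
    unfolding L2_norm_def
    by (intro arg_cong[of _ _ sqrt] Bochner_Integration.integral_cong refl) (simp add: kcomp_diff_left assms)
  also have "knorm (\<lambda>z. kcomp K' L z - kcomp K' L' z) = knorm (kcomp K' (\<lambda>z. L z - L' z))"
    unfolding L2_norm_def
    by (intro arg_cong[of _ _ sqrt] Bochner_Integration.integral_cong refl) (simp add: kcomp_diff_right assms)
  finally show ?thesis
    using knorm_kcomp[OF kernels_diff[OF K] L(1)] knorm_kcomp[OF K(2) kernels_diff[OF L]] by linarith
qed

text \<open>To be equal a.e. is to be at distance 0 in the Hilbert-Schmidt norm, and composition is
  continuous in that norm.\<close>

lemma kcomp_cong:
  assumes "K \<in> kernels" "K' \<in> kernels" "L \<in> kernels" "L' \<in> kernels" "K \<doteq> K'" "L \<doteq> L'"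
  shows "kcomp K L \<doteq> kcomp K' L'"
  using knorm_kcomp_diff[OF assms(1-4)] assms L2_norm_nonneg[of "M \<Otimes>\<^sub>M M"]
  by (simp add: keq_iff_knorm kcomp_kernels antisym)

lemma kadj_cong:
  assumes "K \<in> kernels" "L \<in> kernels" "K \<doteq> L"
  shows "kadj K \<doteq> kadj L"
proof -
  have "knorm (kadj (\<lambda>z. K z - L z)) = 0"
    using knorm_kadj[OF kernels_diff[OF assms(1,2)]] assms by (simp add: keq_iff_knorm)
  then show ?thesis
    using assms by (simp add: keq_iff_knorm kadj_kernels) (simp add: kadj_def)
qed

end

text \<open>The sequence \<open>r\<close> will be \<open>r m = \<parallel>R\<^sup>m\<^sup>+\<^sup>1\<parallel>\<^sup>2\<close> for a self-adjoint Hilbert-Schmidt operator \<open>R\<close>: the ratios of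
  consecutive terms increase to the square of the spectral radius, and the normalised sequence
  decreases to the multiplicity of the top eigenvalue of \<open>R\<^sup>2\<close>.\<close>

lemma logconvex_submultiplicative_normalize:
  fixes r :: "nat \<Rightarrow> real"
  assumes nn: "\<And>m. r m \<ge> 0" and r1: "r 1 > 0"
    and conv: "\<And>m. (r (m + 1))\<^sup>2 \<le> r m * r (m + 2)"
    and sub: "\<And>m n. r (m + n + 1) \<le> r m * r n"
  obtains l where "l \<ge> r 1 / r 0" "l > 0" "decseq (\<lambda>m. r m / l ^ (m + 1))" "\<And>m. r m / l ^ (m + 1) \<ge> 1"
proof -
  have r0: "r 0 > 0"
    using sub[of 0 0] r1 nn[of 0] by (cases "r 0 = 0") (auto simp: less_le)
  have pos: "r m > 0 \<and> r (m + 1) > 0" for m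
  proof (induction m)
    case (Suc m)
    then have "0 < r m * r (m + 2)" using conv[of m] zero_less_power[of "r (m + 1)" 2] by linarith
    then show ?case using Suc by (simp add: zero_less_mult_iff)
  qed (use r0 r1 in auto)
  define \<rho> where "\<rho> m = r (m + 1) / r m" for m
  have \<rho>_pos: "\<rho> m > 0" for m using pos by (simp add: \<rho>_def)
  have "\<rho> m \<le> \<rho> (Suc m)" for m
    using conv[of m] pos[of m] pos[of "m + 1"] by (simp add: \<rho>_def field_simps power2_eq_square)
  then have \<rho>_inc: "incseq \<rho>" by (rule incseq_SucI)
  have "\<rho> m \<le> r 0" for m
    using sub[of m 0] pos[of m] by (simp add: \<rho>_def field_simps)
  then obtain l where l: "\<rho> \<longlonglongrightarrow> l" "\<And>m. \<rho> m \<le> l"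
    using incseq_convergent[OF \<rho>_inc] by metis
  have lpos: "l > 0" using l(2)[of 0] \<rho>_pos[of 0] by linarith
  have "r (Suc m) / l ^ (Suc m + 1) \<le> r m / l ^ (m + 1)" for m
    using l(2)[of m] pos[of m] lpos by (simp add: \<rho>_def field_simps)
  then have dec: "decseq (\<lambda>m. r m / l ^ (m + 1))" by (rule decseq_SucI)
  \<comment> \<open>For powers of an operator the exponent on the left is (k + 1) (m + 1); as
    \<open>r m\<close> belongs to the exponent m + 1, every index is one less than its
    exponent.\<close>
  have upper: "r (k * (m + 1) + m) \<le> r m ^ (k + 1)" for k m
  proof (induction k)
    case (Suc k)
    have "r (Suc k * (m + 1) + m) \<le> r (k * (m + 1) + m) * r m"
      using sub[of "k * (m + 1) + m" m] by (simp add: algebra_simps)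
    also have "\<dots> \<le> r m ^ (k + 1) * r m" using Suc nn by (intro mult_right_mono)
    finally show ?case by (simp add: mult.commute)
  qed simp
  have lower: "r n * \<rho> n ^ i \<le> r (n + i)" for n i
  proof (induction i)
    case (Suc i)
    have "r n * \<rho> n ^ Suc i \<le> r (n + i) * \<rho> n"
      using Suc \<rho>_pos[of n] by (simp add: mult.commute mult.left_commute)
    also have "\<dots> \<le> r (n + i) * \<rho> (n + i)"
      using incseqD[OF \<rho>_inc, of n "n + i"] nn by (intro mult_left_mono) auto
    also have "\<dots> = r (n + Suc i)" using pos[of "n + i"] by (simp add: \<rho>_def)
    finally show ?case .
  qed simp
  \<comment> \<open>The ratios never decrease, so from \<open>n\<close> on the sequence grows at
    least like the powers of \<open>\<rho> n\<close>. By \<open>upper\<close> it grows at most like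
    the powers of \<open>r m\<close>, one for every m + 1 steps. If \<open>r m\<close> were smaller
    than \<open>\<rho> n ^ (m + 1)\<close>, the two bounds would conflict far out.\<close>
  have "\<rho> n ^ (m + 1) \<le> r m" for n m
  proof (rule ccontr)
    assume "\<not> ?thesis"
    then have lt: "r m < \<rho> n ^ (m + 1)" by simp
    define s where "s = m + 1"
    define \<theta> where "\<theta> = r m / \<rho> n ^ s"
    define C where "C = r n / \<rho> n ^ (n + 1)"
    have \<theta>: "0 \<le> \<theta>" "\<theta> < 1" using lt \<rho>_pos[of n] nn by (auto simp: \<theta>_def s_def)
    have C: "C > 0" using pos \<rho>_pos by (simp add: C_def)
    obtain k where k: "\<theta> ^ k < C" using real_arch_pow_inv[OF C \<theta>(2)] by blast
    \<comment> \<open>The maximum with \<open>n\<close> makes the truncated difference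
      \<open>K * s + m - n\<close> a true one.\<close>
    define K where "K = max k n"
    have Kn: "n \<le> K * s + m" by (simp add: K_def s_def max_def le_trans[OF _ le_add1])
    have "\<theta> ^ (K + 1) \<le> \<theta> ^ k" using \<theta> by (intro power_decreasing) (auto simp: K_def)
    then have "\<theta> ^ (K + 1) < C" using k by simp
    moreover have "C \<le> \<theta> ^ (K + 1)"
    proof -
      have "r n * \<rho> n ^ (K * s + m - n) \<le> r m ^ (K + 1)"
        using lower[of n "K * s + m - n"] upper[of K m] Kn by (simp add: s_def)
      moreover have "K * s + m - n + (n + 1) = s * (K + 1)"
        using Kn by (simp add: s_def algebra_simps)
      then have "(\<rho> n ^ s) ^ (K + 1) = \<rho> n ^ (K * s + m - n) * \<rho> n ^ (n + 1)"
        by (simp only: power_mult[symmetric] power_add[symmetric])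
      then have "C * (\<rho> n ^ s) ^ (K + 1) = r n * \<rho> n ^ (K * s + m - n)"
        using \<rho>_pos[of n] unfolding C_def by (simp only:) simp
      ultimately have "C * (\<rho> n ^ s) ^ (K + 1) \<le> r m ^ (K + 1)"
        by simp
      then show ?thesis
        using \<rho>_pos[of n] by (simp add: \<theta>_def power_divide field_simps)
    qed
    ultimately show False by simp
  qed
  then have "l ^ (m + 1) \<le> r m" for m
    using l(1) by (intro LIMSEQ_le_const2[OF tendsto_power]) auto
  then have "r m / l ^ (m + 1) \<ge> 1" for m using lpos by simp
  moreover have "l \<ge> r 1 / r 0" using l(2)[of 0] by (simp add: \<rho>_def)
  ultimately show thesis using that lpos dec by blast
qed

section \<open>Invariant self-adjoint kernels and their limits\<close>

context folner_mps
begin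

definition kshift :: "'g \<Rightarrow> ('x \<times> 'x \<Rightarrow> complex) \<Rightarrow> 'x \<times> 'x \<Rightarrow> complex" where
  "kshift j K = (\<lambda>z. K (T j (fst z), T j (snd z)))"

definition inv_kernels :: "('x \<times> 'x \<Rightarrow> complex) set" where
  "inv_kernels = {K \<in> kernels. kadj K \<doteq> K \<and> (\<forall>j. kshift j K \<doteq> K)}"

lemma inv_kernelsD:
  assumes "K \<in> inv_kernels"
  shows "K \<in> kernels" "kadj K \<doteq> K" "kshift j K \<doteq> K"
  using assms by (auto simp: inv_kernels_def)

lemma kshift_measurable [measurable]:
  assumes [measurable]: "K \<in> borel_measurable (M \<Otimes>\<^sub>M M)"
  shows "kshift j K \<in> borel_measurable (M \<Otimes>\<^sub>M M)"
  unfolding kshift_def by measurable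

lemma kshift_kernels:
  assumes "K \<in> kernels"
  shows "kshift j K \<in> kernels"
proof -
  obtain B where "B \<ge> 0" "\<And>x y. x \<in> space M \<Longrightarrow> y \<in> space M \<Longrightarrow> cmod (K (x, y)) \<le> B"
    using kernels_bound[OF assms] by blast
  then show ?thesis
    using kernels_measurable[OF assms] T_space by (intro kernelsI[of _ B]) (auto simp: kshift_def)
qed

lemma kshift_prod: "kshift j K = (\<lambda>z. K ((\<lambda>(x, y). (T j x, T j y)) z))"
  by (simp add: kshift_def case_prod_beta')

lemma knorm_kshift:
  assumes "K \<in> borel_measurable (M \<Otimes>\<^sub>M M)"
  shows "knorm (kshift j K) = knorm K"
proof -
  interpret P: folner_mps \<nu> F "M \<Otimes>\<^sub>M M" "\<lambda>j (x, y). (T j x, T j y)" by (rule prod_folner_mps)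
  show ?thesis using P.L2_norm_T[OF assms, of j] by (simp add: kshift_prod)
qed

lemma kip_kshift:
  assumes "K \<in> borel_measurable (M \<Otimes>\<^sub>M M)" "L \<in> borel_measurable (M \<Otimes>\<^sub>M M)"
  shows "kip (kshift j K) (kshift j L) = kip K L"
proof -
  interpret P: folner_mps \<nu> F "M \<Otimes>\<^sub>M M" "\<lambda>j (x, y). (T j x, T j y)" by (rule prod_folner_mps)
  show ?thesis using P.L2_inner_T[OF assms, of j] by (simp add: kshift_prod)
qed

text \<open>The shift of the integration variable is absorbed by invariance of the measure.\<close>

lemma kshift_kcomp:
  assumes K: "K \<in> kernels" and L: "L \<in> kernels" and z: "z \<in> space (M \<Otimes>\<^sub>M M)"
  shows "kshift j (kcomp K L) z = kcomp (kshift j K) (kshift j L) z"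
proof -
  have "(\<lambda>w. K (T j (fst z), w) * L (w, T j (snd z))) \<in> borel_measurable M"
    using z kernels_section[OF K] kernels_section[OF L] by (auto simp: space_pair_measure T_space)
  from integral_T[OF this, of j] show ?thesis by (simp add: kshift_def kcomp_def)
qed

text \<open>The adjoint of K L is L K, so commutation is exactly what keeps the product
  self-adjoint.\<close>

lemma inv_kernels_kcomp_commuting:
  assumes K: "K \<in> inv_kernels" and L: "L \<in> inv_kernels" and com: "kcomp K L \<doteq> kcomp L K"
  shows "kcomp K L \<in> inv_kernels"
proof -
  note k = inv_kernelsD[OF K] and l = inv_kernelsD[OF L]
  have "kadj (kcomp K L) \<doteq> kcomp L K"
    unfolding kadj_kcomp using k l by (intro kcomp_cong kadj_kernels)
  then have "kadj (kcomp K L) \<doteq> kcomp K L" using com by eventually_elim simp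
  moreover have "kshift j (kcomp K L) \<doteq> kcomp K L" for j
  proof -
    have "kcomp (kshift j K) (kshift j L) \<doteq> kcomp K L"
      using k l by (intro kcomp_cong kshift_kernels)
    with AE_space show ?thesis by eventually_elim (simp add: kshift_kcomp k l)
  qed
  ultimately show ?thesis by (simp add: inv_kernels_def kcomp_kernels k l)
qed

lemma inv_kernels_add:
  assumes K: "K \<in> inv_kernels" and L: "L \<in> inv_kernels"
  shows "(\<lambda>z. K z + L z) \<in> inv_kernels"
proof -
  have "kadj (\<lambda>z. K z + L z) \<doteq> (\<lambda>z. K z + L z)"
    using inv_kernelsD(2)[OF K] inv_kernelsD(2)[OF L] by eventually_elim (simp add: kadj_def)
  moreover have "kshift j (\<lambda>z. K z + L z) \<doteq> (\<lambda>z. K z + L z)" for j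
    using inv_kernelsD(3)[OF K, of j] inv_kernelsD(3)[OF L, of j] by eventually_elim (simp add: kshift_def)
  ultimately show ?thesis
    using inv_kernelsD(1)[OF K] inv_kernelsD(1)[OF L] by (simp add: inv_kernels_def kernels_add)
qed

lemma inv_kernels_scale_real:
  assumes K: "K \<in> inv_kernels"
  shows "(\<lambda>z. of_real c * K z) \<in> inv_kernels"
proof -
  have "kadj (\<lambda>z. of_real c * K z) \<doteq> (\<lambda>z. of_real c * K z)"
    using inv_kernelsD(2)[OF K] by eventually_elim (simp add: kadj_def)
  moreover have "kshift j (\<lambda>z. of_real c * K z) \<doteq> (\<lambda>z. of_real c * K z)" for j
    using inv_kernelsD(3)[OF K, of j] by eventually_elim (simp add: kshift_def)
  ultimately show ?thesis
    using inv_kernelsD(1)[OF K] by (simp add: inv_kernels_def kernels_scale)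
qed

lemma inv_kernels_diff: "K \<in> inv_kernels \<Longrightarrow> L \<in> inv_kernels \<Longrightarrow> (\<lambda>z. K z - L z) \<in> inv_kernels"
  using inv_kernels_add[of K "\<lambda>z. of_real (-1) * L z"] inv_kernels_scale_real[of L "-1"] by simp

definition kconv :: "(nat \<Rightarrow> 'x \<times> 'x \<Rightarrow> complex) \<Rightarrow> ('x \<times> 'x \<Rightarrow> complex) \<Rightarrow> bool" where
  "kconv u P \<longleftrightarrow> (\<forall>n. u n \<in> kernels) \<and> P \<in> kernels \<and> (\<lambda>n. knorm (\<lambda>z. u n z - P z)) \<longlonglongrightarrow> 0"

text \<open>Identities for limit kernels are all obtained from this: both sides are exhibited as
  limits of sequences that agree almost everywhere term by term.\<close>

lemma kconv_unique:
  assumes "kconv u P" "kconv v Q" "\<And>n. u n \<doteq> v n"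
  shows "P \<doteq> Q"
proof -
  have k: "\<And>n. u n \<in> kernels" "\<And>n. v n \<in> kernels" "P \<in> kernels" "Q \<in> kernels"
    using assms by (auto simp: kconv_def)
  have "knorm (\<lambda>z. P z - Q z) \<le> knorm (\<lambda>z. u n z - P z) + knorm (\<lambda>z. v n z - Q z)" for n
  proof -
    have "knorm (\<lambda>z. P z - Q z) \<le> knorm (\<lambda>z. P z - u n z) + knorm (\<lambda>z. u n z - Q z)"
      using k by (intro L2_norm_triangle_diff kernels_L2)
    also have "knorm (\<lambda>z. P z - u n z) = knorm (\<lambda>z. u n z - P z)" by (rule L2_norm_minus_commute)
    also have "knorm (\<lambda>z. u n z - Q z) = knorm (\<lambda>z. v n z - Q z)"
    proof (rule L2_norm_cong_AE)
      show "AE z in M \<Otimes>\<^sub>M M. u n z - Q z = v n z - Q z" using assms(3)[of n] by eventually_elim simp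
    qed (use k in \<open>auto intro!: kernels_measurable kernels_diff\<close>)
    finally show ?thesis .
  qed
  moreover have "(\<lambda>n. knorm (\<lambda>z. u n z - P z) + knorm (\<lambda>z. v n z - Q z)) \<longlonglongrightarrow> 0 + 0"
    using assms by (intro tendsto_add) (auto simp: kconv_def)
  ultimately have "knorm (\<lambda>z. P z - Q z) \<le> 0 + 0"
    by (intro LIMSEQ_le_const) auto
  then show ?thesis using k L2_norm_nonneg[of "M \<Otimes>\<^sub>M M"] by (simp add: keq_iff_knorm antisym)
qed

lemma kconv_const: "K \<in> kernels \<Longrightarrow> kconv (\<lambda>_. K) K"
  by (simp add: kconv_def L2_norm_def)

lemma kconv_kcomp:
  assumes "kconv u P" "kconv v Q"
  shows "kconv (\<lambda>n. kcomp (u n) (v n)) (kcomp P Q)"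
proof -
  have k: "\<And>n. u n \<in> kernels" "\<And>n. v n \<in> kernels" "P \<in> kernels" "Q \<in> kernels"
    and lim: "(\<lambda>n. knorm (\<lambda>z. u n z - P z)) \<longlonglongrightarrow> 0" "(\<lambda>n. knorm (\<lambda>z. v n z - Q z)) \<longlonglongrightarrow> 0"
    using assms by (auto simp: kconv_def)
  have "(\<lambda>n. knorm (v n)) \<longlonglongrightarrow> knorm Q"
    by (rule L2_norm_tendsto[OF kernels_L2[OF k(2)] kernels_L2[OF k(4)] lim(2)])
  then have "(\<lambda>n. knorm (\<lambda>z. u n z - P z) * knorm (v n) + knorm P * knorm (\<lambda>z. v n z - Q z))
      \<longlonglongrightarrow> 0 * knorm Q + knorm P * 0"
    by (intro tendsto_add tendsto_mult lim tendsto_const)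
  then have lim0: "(\<lambda>n. knorm (\<lambda>z. u n z - P z) * knorm (v n) + knorm P * knorm (\<lambda>z. v n z - Q z))
      \<longlonglongrightarrow> 0" by simp
  have "norm (knorm (\<lambda>z. kcomp (u n) (v n) z - kcomp P Q z)) \<le>
      knorm (\<lambda>z. u n z - P z) * knorm (v n) + knorm P * knorm (\<lambda>z. v n z - Q z)" for n
    using knorm_kcomp_diff[OF k(1,3) k(2,4), of n n] by (simp add: L2_norm_nonneg)
  then have "(\<lambda>n. knorm (\<lambda>z. kcomp (u n) (v n) z - kcomp P Q z)) \<longlonglongrightarrow> 0"
    by (intro Lim_null_comparison[OF _ lim0] always_eventually allI)
  then show ?thesis using k by (simp add: kconv_def kcomp_kernels)
qed

lemma kconv_scale:
  assumes "kconv u P"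
  shows "kconv (\<lambda>n z. c * u n z) (\<lambda>z. c * P z)"
proof -
  have "knorm (\<lambda>z. c * u n z - c * P z) = cmod c * knorm (\<lambda>z. u n z - P z)" for n
    using L2_norm_scale[of "M \<Otimes>\<^sub>M M" c "\<lambda>z. u n z - P z"] by (simp add: right_diff_distrib)
  then show ?thesis
    using assms tendsto_mult_right_zero[of "\<lambda>n. knorm (\<lambda>z. u n z - P z)" sequentially "cmod c"]
    by (auto simp: kconv_def kernels_scale)
qed

lemma kconv_kadj:
  assumes "kconv u P"
  shows "kconv (\<lambda>n. kadj (u n)) (kadj P)"
proof -
  have "knorm (\<lambda>z. kadj (u n) z - kadj P z) = knorm (\<lambda>z. u n z - P z)" for n
    using knorm_kadj[of "\<lambda>z. u n z - P z"] assms kernels_diff by (simp add: kadj_def kconv_def)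
  then show ?thesis using assms by (simp add: kconv_def kadj_kernels)
qed

lemma kconv_kshift:
  assumes "kconv u P"
  shows "kconv (\<lambda>n. kshift j (u n)) (kshift j P)"
proof -
  have "knorm (\<lambda>z. kshift j (u n) z - kshift j P z) = knorm (\<lambda>z. u n z - P z)" for n
    using knorm_kshift[of "\<lambda>z. u n z - P z" j] assms kernels_diff
    by (simp add: kshift_def kconv_def kernels_measurable)
  then show ?thesis using assms by (simp add: kconv_def kshift_kernels)
qed

lemma kconv_subseq: "kconv u P \<Longrightarrow> strict_mono f \<Longrightarrow> kconv (\<lambda>n. u (f n)) P"
  using LIMSEQ_subseq_LIMSEQ[of "\<lambda>n. knorm (\<lambda>z. u n z - P z)" 0 f] by (simp add: kconv_def o_def)

lemma inv_kernels_closed: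
  assumes "kconv u P" "\<And>n. u n \<in> inv_kernels"
  shows "P \<in> inv_kernels"
proof -
  have "kadj P \<doteq> P"
    by (rule kconv_unique[OF kconv_kadj[OF assms(1)] assms(1) inv_kernelsD(2)[OF assms(2)]])
  moreover have "kshift j P \<doteq> P" for j
    by (rule kconv_unique[OF kconv_kshift[OF assms(1)] assms(1) inv_kernelsD(3)[OF assms(2)]])
  ultimately show ?thesis using assms(1) by (simp add: inv_kernels_def kconv_def)
qed

text \<open>\<open>kpow R n\<close> is the power with exponent n + 1. Counting starts at
  \<open>R\<close> because the identity operator is in general not given by a bounded
  kernel.\<close>

definition kpow :: "('x \<times> 'x \<Rightarrow> complex) \<Rightarrow> nat \<Rightarrow> 'x \<times> 'x \<Rightarrow> complex" where
  "kpow R n = (kcomp R ^^ n) R"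

lemma kpow_0: "kpow R 0 = R" and kpow_Suc: "kpow R (Suc n) = kcomp R (kpow R n)"
  by (simp_all add: kpow_def)

lemma kpow_kernels: "R \<in> kernels \<Longrightarrow> kpow R n \<in> kernels"
  by (induction n) (simp_all add: kpow_0 kpow_Suc kcomp_kernels)

lemma kcomp_kpow:
  assumes R: "R \<in> kernels" and z: "z \<in> space (M \<Otimes>\<^sub>M M)"
  shows "kcomp (kpow R m) (kpow R n) z = kpow R (m + n + 1) z"
  using z
proof (induction m arbitrary: z)
  case 0
  then show ?case by (simp add: kpow_0 kpow_Suc)
next
  case (Suc m)
  have "kcomp (kpow R (Suc m)) (kpow R n) z = kcomp R (kcomp (kpow R m) (kpow R n)) z"
    unfolding kpow_Suc by (rule kcomp_assoc[OF R kpow_kernels[OF R] kpow_kernels[OF R] Suc.prems])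
  also have "\<dots> = kcomp R (kpow R (m + n + 1)) z"
    unfolding kcomp_def[of R]
    by (rule Bochner_Integration.integral_cong[OF refl])
       (use Suc.prems in \<open>simp add: Suc.IH space_pair_measure mem_Times_iff\<close>)
  finally show ?case by (simp add: kpow_Suc)
qed

lemma keqI: "(\<And>z. z \<in> space (M \<Otimes>\<^sub>M M) \<Longrightarrow> K z = L z) \<Longrightarrow> K \<doteq> L"
  by (rule AE_I2)

lemma kpow_kset:
  assumes "R \<in> inv_kernels"
  shows "kpow R n \<in> inv_kernels"
proof (induction n)
  case (Suc n)
  have R: "R \<in> kernels" using assms by (rule inv_kernelsD)
  have "kcomp R (kpow R n) \<doteq> kcomp (kpow R n) R"
  proof (rule keqI)
    fix z assume "z \<in> space (M \<Otimes>\<^sub>M M)"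
    from kcomp_kpow[OF R this, of 0 n] kcomp_kpow[OF R this, of n 0]
    show "kcomp R (kpow R n) z = kcomp (kpow R n) R z" by (simp add: kpow_0)
  qed
  then show ?case
    unfolding kpow_Suc by (rule inv_kernels_kcomp_commuting[OF assms Suc])
qed (simp add: assms kpow_0)

lemma kip_cong:
  "\<lbrakk>K \<doteq> K'; L \<doteq> L'; K \<in> kernels; K' \<in> kernels; L \<in> kernels; L' \<in> kernels\<rbrakk> \<Longrightarrow> kip K L = kip K' L'"
  by (intro L2_inner_cong_AE kernels_measurable)

lemma kip_kcomp_selfadjoint:
  assumes R: "R \<in> inv_kernels" and K: "K \<in> kernels" and L: "L \<in> kernels"
  shows "kip (kcomp R K) L = kip K (kcomp R L)"
proof -
  note r = inv_kernelsD[OF R]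
  have "kip (kcomp R K) L = kip K (kcomp (kadj R) L)"
    by (rule kip_kcomp_left[OF r(1) K L])
  also have "\<dots> = kip K (kcomp R L)"
    using r K L by (intro kip_cong kcomp_cong kcomp_kernels kadj_kernels) auto
  finally show ?thesis .
qed

text \<open>Self-adjointness moves factors from one side to the other, so only the sum of the two
  indices matters, and an even difference can be balanced.\<close>

lemma kip_kpow:
  assumes R: "R \<in> inv_kernels"
  shows "kip (kpow R (m + 2 * i)) (kpow R m) = of_real ((knorm (kpow R (m + i)))\<^sup>2)"
proof -
  note k = kpow_kernels[OF inv_kernelsD(1)[OF R]]
  have shift: "kip (kpow R (m + i)) (kpow R n) = kip (kpow R m) (kpow R (n + i))" for m n i
  proof (induction i arbitrary: n)
    case (Suc i)
    have "kip (kpow R (m + Suc i)) (kpow R n) = kip (kpow R (m + i)) (kpow R (Suc n))"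
      by (simp add: kpow_Suc kip_kcomp_selfadjoint[OF R k k])
    also have "\<dots> = kip (kpow R m) (kpow R (n + Suc i))"
      using Suc[of "Suc n"] by simp
    finally show ?case .
  qed simp
  from shift[of "m + i" i m] show ?thesis by (simp add: L2_inner_self mult_2 add.assoc)
qed

lemma kcomp_assoc_eq: "K \<in> kernels \<Longrightarrow> L \<in> kernels \<Longrightarrow> J \<in> kernels \<Longrightarrow>
    kcomp (kcomp K L) J \<doteq> kcomp K (kcomp L J)"
  by (rule keqI) (rule kcomp_assoc)

lemma keq_trans:
  assumes "K \<doteq> L" "L \<doteq> J"
  shows "K \<doteq> J"
  using assms by eventually_elim simp

lemma keq_sym:
  assumes "K \<doteq> L"
  shows "L \<doteq> K"
  using assms by eventually_elim simp

lemma kcomp_scale_kernels: "kcomp (\<lambda>z. c * K z) L = (\<lambda>z. c * kcomp K L z)"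
    "kcomp K (\<lambda>z. c * L z) = (\<lambda>z. c * kcomp K L z)"
  by (rule ext, rule kcomp_scale_left) (rule ext, rule kcomp_scale_right)

text \<open>The limit projects onto the eigenspaces of \<open>R\<close> for plus and minus the
  square root of \<open>l\<close>. The explicit lower bound for \<open>l\<close> makes the later
  subtraction argument quantitative. The last conclusion lets \<open>P\<close> inherit whatever
  \<open>R\<close> absorbs from the left, in particular that it lies below a given
  projection.\<close>

lemma spectral_projection:
  assumes R: "R \<in> inv_kernels" and nz: "knorm (kcomp R R) > 0"
  obtains l :: real and P where "l \<ge> (knorm (kcomp R R))\<^sup>2 / (knorm R)\<^sup>2" "l > 0" "P \<in> inv_kernels"
    "kcomp P P \<doteq> P" "knorm P \<ge> 1" "kcomp P (kcomp R R) \<doteq> (\<lambda>z. of_real l * P z)"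
    "kcomp P R \<doteq> kcomp R P" "\<And>Z. Z \<in> kernels \<Longrightarrow> kcomp Z R \<doteq> R \<Longrightarrow> kcomp Z P \<doteq> P"
proof -
  have Rk: "R \<in> kernels" using R by (rule inv_kernelsD)
  note pk = kpow_kernels[OF Rk]
  define r where "r m = (knorm (kpow R m))\<^sup>2" for m
  have pow: "kpow R 1 = kcomp R R" using kpow_Suc[of R 0] by (simp add: kpow_0)
  have ip: "kip (kpow R (m + 2 * i)) (kpow R m) = of_real (r (m + i))" for m i
    unfolding r_def by (rule kip_kpow[OF R])
  have rnn: "r m \<ge> 0" for m by (simp add: r_def)
  have r1: "r 1 > 0" using nz pow by (simp add: r_def)
  have conv: "(r (m + 1))\<^sup>2 \<le> r m * r (m + 2)" for m
  proof -
    have "r (m + 1) = cmod (kip (kpow R (m + 2)) (kpow R m))"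
      using ip[of m 1] rnn by simp
    also have "\<dots> \<le> knorm (kpow R (m + 2)) * knorm (kpow R m)"
      by (intro L2_Cauchy_Schwarz kernels_L2 pk)
    finally have "(r (m + 1))\<^sup>2 \<le> (knorm (kpow R (m + 2)) * knorm (kpow R m))\<^sup>2"
      using rnn by (intro power_mono) auto
    then show ?thesis by (simp add: r_def power_mult_distrib mult.commute)
  qed
  have sub: "r (m + n + 1) \<le> r m * r n" for m n
  proof -
    have "knorm (kpow R (m + n + 1)) = knorm (kcomp (kpow R m) (kpow R n))"
      by (intro L2_norm_cong_AE keqI kernels_measurable kcomp_kernels pk) (simp add: kcomp_kpow[OF Rk])
    also have "\<dots> \<le> knorm (kpow R m) * knorm (kpow R n)" by (intro knorm_kcomp pk)
    finally have "r (m + n + 1) \<le> (knorm (kpow R m) * knorm (kpow R n))\<^sup>2"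
      unfolding r_def by (intro power_mono L2_norm_nonneg)
    then show ?thesis by (simp add: r_def power_mult_distrib)
  qed
  obtain l where l: "l \<ge> r 1 / r 0" "l > 0" and dec: "decseq (\<lambda>m. r m / l ^ (m + 1))"
    and ge1: "\<And>m. r m / l ^ (m + 1) \<ge> 1"
    using logconvex_submultiplicative_normalize[of r, OF rnn r1 conv sub] by metis
  define q where "q m = r m / l ^ (m + 1)" for m
  have q_dec: "decseq q" and q1: "\<And>m. q m \<ge> 1" using dec ge1 by (simp_all add: q_def[abs_def])
  obtain q' where q': "q \<longlonglongrightarrow> q'" using decseq_convergent[OF q_dec, of 1] q1 by metis
  \<comment> \<open>This is the power with even exponent 2 a + 4, divided by the same power of the
    square root of \<open>l\<close>. Starting at 4 leaves a genuine even power in the middle after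
    one factor \<open>R\<close> is split off on each side, which the pointwise bound
    requires.\<close>
  define u where "u a = (\<lambda>z. complex_of_real (1 / l ^ (a + 2)) * kpow R (2 * a + 3) z)" for a
  have u_kset: "u a \<in> inv_kernels" for a unfolding u_def by (intro inv_kernels_scale_real kpow_kset R)
  have uk: "u a \<in> kernels" for a using u_kset by (rule inv_kernelsD)
  \<comment> \<open>The inner product depends on a + b only. As \<open>q\<close> converges, all
    inner products of late terms are nearly equal, which makes the sequence Cauchy.\<close>
  have u_ip': "kip (u a) (u b) = of_real (q (a + b + 3))" if "b \<le> a" for a b
  proof -
    have e: "2 * a + 3 = (2 * b + 3) + 2 * (a - b)" and e': "(2 * b + 3) + (a - b) = a + b + 3" using that by auto
    have "kip (u a) (u b) = of_real (1 / l ^ (a + 2)) * (of_real (1 / l ^ (b + 2)) * kip (kpow R (2 * a + 3)) (kpow R (2 * b + 3)))"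
      unfolding u_def by (simp only: L2_inner_scale_left L2_inner_scale_right complex_cnj_complex_of_real)
    also have "kip (kpow R (2 * a + 3)) (kpow R (2 * b + 3)) = of_real (r (a + b + 3))"
      unfolding e ip e' ..
    also have "complex_of_real (1 / l ^ (a + 2)) * (of_real (1 / l ^ (b + 2)) * of_real (r (a + b + 3))) =
        of_real (1 / l ^ (a + 2) * (1 / l ^ (b + 2) * r (a + b + 3)))"
      by (simp only: of_real_mult)
    also have "1 / l ^ (a + 2) * (1 / l ^ (b + 2) * r (a + b + 3)) = q (a + b + 3)"
    proof -
      have "a + 2 + (b + 2) = a + b + 3 + 1" by simp
      then have "l ^ (a + 2) * l ^ (b + 2) = l ^ (a + b + 3 + 1)" by (simp only: power_add[symmetric])
      then show ?thesis by (simp add: q_def)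
    qed
    finally show ?thesis .
  qed
  have u_ip: "kip (u a) (u b) = of_real (q (a + b + 3))" for a b
  proof (cases "b \<le> a")
    case False
    then show ?thesis using u_ip'[of a b] L2_inner_commute[of _ "u a" "u b"] by (simp add: add.commute)
  qed (rule u_ip')
  have u_norm: "(knorm (u a))\<^sup>2 = q (a + a + 3)" for a
    using u_ip[of a a] unfolding L2_inner_self of_real_eq_iff .
  have cauchy: "\<exists>N. \<forall>m\<ge>N. \<forall>n\<ge>N. knorm (\<lambda>z. u m z - u n z) < e" if "e > 0" for e
  proof -
    \<comment> \<open>The expansion of the squared distance uses three values of \<open>q\<close>
      with weights 1, -2 and 1. The limits cancel, and four errors below a quarter of e^2
      remain.\<close>
    obtain N where N: "\<And>m. m \<ge> N \<Longrightarrow> \<bar>q m - q'\<bar> < e\<^sup>2 / 4"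
      using LIMSEQ_D[OF q', of "e\<^sup>2 / 4"] \<open>e > 0\<close> by auto
    have "knorm (\<lambda>z. u m z - u n z) < e" if "m \<ge> N" "n \<ge> N" for m n
    proof -
      have "(knorm (\<lambda>z. u m z - u n z))\<^sup>2 = q (m + m + 3) - 2 * q (m + n + 3) + q (n + n + 3)"
        using L2_norm_diff_square[OF kernels_L2[OF uk] kernels_L2[OF uk], of m n] by (simp add: u_norm u_ip)
      also have "\<dots> < e\<^sup>2"
      proof -
        have "\<bar>q (m + m + 3) - q'\<bar> < e\<^sup>2 / 4" "\<bar>q (m + n + 3) - q'\<bar> < e\<^sup>2 / 4" "\<bar>q (n + n + 3) - q'\<bar> < e\<^sup>2 / 4"
          using that by (intro N; linarith)+
        then show ?thesis by linarith
      qed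
      finally have lt: "(knorm (\<lambda>z. u m z - u n z))\<^sup>2 < e\<^sup>2" .
      show ?thesis by (rule power2_less_imp_less[OF lt]) (use \<open>e > 0\<close> in simp)
    qed
    then show ?thesis by blast
  qed
  obtain B where B: "B \<ge> 0" "\<And>x y. x \<in> space M \<Longrightarrow> y \<in> space M \<Longrightarrow> cmod (R (x, y)) \<le> B"
    using kernels_bound[OF Rk] by blast
  \<comment> \<open>The sandwich bound gives B^2 times the norm of the power with exponent 2 a + 2,
    and that norm is at most sqrt (q 0) times l^(a + 1) because \<open>q\<close> decreases. Dividing
    by l^(a + 2) leaves a bound independent of \<open>a\<close>.\<close>
  define C where "C = B * B * sqrt (q 0) / l"
  have bound: "cmod (u a (x, y)) \<le> C" if xy: "x \<in> space M" "y \<in> space M" for a x y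
  proof -
    have z: "(x, y) \<in> space (M \<Otimes>\<^sub>M M)" using xy by (simp add: space_pair_measure)
    have "kpow R (2 * a + 3) (x, y) = kcomp R (kpow R (2 * a + 2)) (x, y)"
      by (simp add: kpow_Suc numeral_3_eq_3)
    also have "\<dots> = kcomp R (kcomp (kpow R (2 * a + 1)) R) (x, y)"
      unfolding kcomp_def[of R]
      by (rule Bochner_Integration.integral_cong[OF refl])
        (use kcomp_kpow[OF Rk, of _ "2 * a + 1" 0] xy in \<open>simp add: kpow_0 space_pair_measure\<close>)
    finally have "cmod (kpow R (2 * a + 3) (x, y)) \<le> B * B * knorm (kpow R (2 * a + 1))"
      using kcomp_sandwich_bound[OF Rk B(2) Rk B(2) pk xy] by simp
    also have "knorm (kpow R (2 * a + 1)) \<le> sqrt (q 0) * l ^ (a + 1)"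
    proof (rule power2_le_imp_le)
      have "(knorm (kpow R (2 * a + 1)))\<^sup>2 = q (2 * a + 1) * l ^ (2 * a + 1 + 1)"
        using l(2) by (simp add: q_def r_def)
      also have "\<dots> \<le> q 0 * l ^ (2 * a + 1 + 1)"
        using decseqD[OF q_dec, of 0 "2 * a + 1"] l(2) by (intro mult_right_mono) auto
      also have "l ^ (2 * a + 1 + 1) = (l ^ (a + 1))\<^sup>2"
      proof -
        have "2 * a + 1 + 1 = (a + 1) * 2" by simp
        then show ?thesis by (simp only: power_mult)
      qed
      finally show "(knorm (kpow R (2 * a + 1)))\<^sup>2 \<le> (sqrt (q 0) * l ^ (a + 1))\<^sup>2"
        using q1[of 0] by (simp add: power_mult_distrib)
    qed (use l(2) q1[of 0] in simp)
    finally have "cmod (kpow R (2 * a + 3) (x, y)) \<le> B * B * (sqrt (q 0) * l ^ (a + 1))"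
      using B(1) by (simp add: mult_left_mono)
    then have "1 / l ^ (a + 2) * cmod (kpow R (2 * a + 3) (x, y)) \<le> 1 / l ^ (a + 2) * (B * B * (sqrt (q 0) * l ^ (a + 1)))"
      using l(2) by (intro mult_left_mono) auto
    also have "\<dots> = C" using l(2) by (simp add: C_def field_simps)
    finally show ?thesis using l(2) by (simp add: u_def norm_mult norm_divide norm_power)
  qed
  obtain P where P: "P \<in> L2 (M \<Otimes>\<^sub>M M)" "(\<lambda>n. knorm (\<lambda>z. u n z - P z)) \<longlonglongrightarrow> 0"
    "\<And>z C. (\<And>n. cmod (u n z) \<le> C) \<Longrightarrow> cmod (P z) \<le> C"
  proof (rule MM.L2_complete[of u, OF kernels_L2[OF uk] cauchy])
    fix v
    assume a: "v \<in> L2 (M \<Otimes>\<^sub>M M)" "(\<lambda>n. knorm (\<lambda>z. u n z - v z)) \<longlonglongrightarrow> 0"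
      and b: "\<And>z C. (\<And>n. cmod (u n z) \<le> C) \<Longrightarrow> cmod (v z) \<le> C"
    show thesis by (rule that[OF a b])
  qed
  have Pk: "P \<in> kernels"
    using P(1) by (intro kernelsI[of _ C] P(3) bound) (auto simp: L2_def)
  have cv: "kconv u P" using uk Pk P(2) by (simp add: kconv_def)
  have Ps: "P \<in> inv_kernels" by (rule inv_kernels_closed[OF cv u_kset])
  \<comment> \<open>The normalisation is multiplicative: the square of \<open>u n\<close> is
    \<open>u (2 * n + 2)\<close>, a later member of the same sequence.\<close>
  have "kcomp P P \<doteq> P"
  proof (rule kconv_unique[OF kconv_kcomp[OF cv cv]])
    show "kconv (\<lambda>n. u (2 * n + 2)) P"
      by (rule kconv_subseq[OF cv]) (simp add: strict_mono_def)
    show "kcomp (u n) (u n) \<doteq> u (2 * n + 2)" for n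
    proof (rule keqI)
      fix z assume z: "z \<in> space (M \<Otimes>\<^sub>M M)"
      have e: "2 * n + 3 + (2 * n + 3) + 1 = 2 * (2 * n + 2) + 3" by simp
      have "kcomp (u n) (u n) z = of_real (1 / l ^ (n + 2)) * (of_real (1 / l ^ (n + 2)) * kpow R (2 * (2 * n + 2) + 3) z)"
        unfolding u_def kcomp_scale_left kcomp_scale_right kcomp_kpow[OF Rk z] e ..
      also have "\<dots> = of_real (1 / l ^ (n + 2) * (1 / l ^ (n + 2))) * kpow R (2 * (2 * n + 2) + 3) z"
        by (simp only: of_real_mult mult.assoc)
      also have "1 / l ^ (n + 2) * (1 / l ^ (n + 2)) = 1 / l ^ (2 * n + 2 + 2)"
      proof -
        have "n + 2 + (n + 2) = 2 * n + 2 + 2" by simp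
        then have "l ^ (n + 2) * l ^ (n + 2) = l ^ (2 * n + 2 + 2)" by (simp only: power_add[symmetric])
        then show ?thesis by (simp only: times_divide_times_eq mult_1)
      qed
      finally show "kcomp (u n) (u n) z = u (2 * n + 2) z" by (simp add: u_def)
    qed
  qed
  moreover have "knorm P \<ge> 1"
  proof (rule LIMSEQ_le_const)
    show "(\<lambda>n. knorm (u n)) \<longlonglongrightarrow> knorm P" by (rule L2_norm_tendsto[OF kernels_L2[OF uk] P(1,2)])
    have "1 \<le> knorm (u n)" for n
    proof (rule power2_le_imp_le[OF _ L2_norm_nonneg])
      show "1\<^sup>2 \<le> (knorm (u n))\<^sup>2" unfolding u_norm power_one by (rule q1)
    qed
    then show "\<exists>N. \<forall>n\<ge>N. 1 \<le> knorm (u n)" by blast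
  qed
  moreover have "kcomp P (kcomp R R) \<doteq> (\<lambda>z. of_real l * P z)"
  proof (rule kconv_unique[OF kconv_kcomp[OF cv kconv_const[OF kcomp_kernels[OF Rk Rk]]]])
    show "kconv (\<lambda>n z. of_real l * u (n + 1) z) (\<lambda>z. of_real l * P z)"
      by (rule kconv_scale, rule kconv_subseq[OF cv]) (simp add: strict_mono_def)
    show "kcomp (u n) (kcomp R R) \<doteq> (\<lambda>z. of_real l * u (n + 1) z)" for n
    proof (rule keqI)
      fix z assume z: "z \<in> space (M \<Otimes>\<^sub>M M)"
      have e: "2 * n + 3 + 1 + 1 = 2 * (n + 1) + 3" by simp
      have "kcomp (u n) (kcomp R R) z = of_real (1 / l ^ (n + 2)) * kpow R (2 * (n + 1) + 3) z"
        unfolding u_def pow[symmetric] kcomp_scale_left kcomp_kpow[OF Rk z] e ..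
      also have "1 / l ^ (n + 2) = l * (1 / l ^ (n + 1 + 2))" using l(2) by simp
      finally show "kcomp (u n) (kcomp R R) z = of_real l * u (n + 1) z" by (simp add: u_def)
    qed
  qed
  moreover have "kcomp P R \<doteq> kcomp R P"
  proof (rule kconv_unique[OF kconv_kcomp[OF cv kconv_const[OF Rk]] kconv_kcomp[OF kconv_const[OF Rk] cv]])
    show "kcomp (u n) R \<doteq> kcomp R (u n)" for n
    proof (rule keqI)
      fix z assume z: "z \<in> space (M \<Otimes>\<^sub>M M)"
      from kcomp_kpow[OF Rk z, of 0 "2 * n + 3"] kcomp_kpow[OF Rk z, of "2 * n + 3" 0]
      show "kcomp (u n) R z = kcomp R (u n) z"
        unfolding u_def kcomp_scale_left kcomp_scale_right by (simp add: kpow_0)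
    qed
  qed
  \<comment> \<open>\<open>Z\<close> is absorbed by the leftmost factor \<open>R\<close> of every
    power, and therefore by the limit.\<close>
  moreover have "kcomp Z P \<doteq> P" if Z: "Z \<in> kernels" "kcomp Z R \<doteq> R" for Z
  proof (rule kconv_unique[OF kconv_kcomp[OF kconv_const[OF Z(1)] cv] cv])
    show "kcomp Z (u n) \<doteq> u n" for n
    proof -
      let ?K = "kpow R (2 * n + 2)"
      have "kcomp (kcomp Z R) ?K \<doteq> kcomp R ?K"
        by (intro kcomp_cong kcomp_kernels pk Z Rk) auto
      moreover have "kcomp (kcomp Z R) ?K \<doteq> kcomp Z (kcomp R ?K)" by (rule kcomp_assoc_eq[OF Z(1) Rk pk])
      moreover have "kcomp R ?K = kpow R (2 * n + 3)" by (simp add: kpow_Suc numeral_3_eq_3)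
      ultimately have "kcomp Z (kpow R (2 * n + 3)) \<doteq> kpow R (2 * n + 3)" by (auto elim!: keq_trans[OF keq_sym])
      then show ?thesis unfolding u_def kcomp_scale_kernels by eventually_elim simp
    qed
  qed
  ultimately show thesis
    using that[of l P] l Ps pow by (simp add: r_def kpow_0)
qed

section \<open>Kernels acting as operators on functions\<close>

lemma kapp_cong:
  assumes "K \<in> kernels" "L \<in> kernels" "h \<in> L2 M" "K \<doteq> L"
  shows "AE x in M. kapp K h x = kapp L h x"
  using MM.AE_pair[OF assms(4)] AE_space
proof eventually_elim
  case (elim x)
  have "(\<lambda>y. K (x, y) * h y) \<in> borel_measurable M" "(\<lambda>y. L (x, y) * h y) \<in> borel_measurable M"
    using kernels_section(1)[OF assms(1) elim(2)] kernels_section(1)[OF assms(2) elim(2)] L2_measurable[OF assms(3)]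
    by measurable
  then show ?case
    unfolding kapp_def by (rule integral_cong_AE) (use elim(1) in eventually_elim, simp)
qed

lemma kapp_kadj:
  assumes K: "K \<in> kernels" and h: "h \<in> L2 M" and g: "g \<in> L2 M"
  shows "L2_inner M (kapp K h) g = L2_inner M h (kapp (kadj K) g)"
proof -
  have "L2_inner M h (kapp (kadj K) g) = cnj (kip (kadj K) (tensor h g))"
    by (subst L2_inner_commute) (simp add: kapp_inner[OF kadj_kernels[OF K] g h])
  also have "\<dots> = (LINT z|(M \<Otimes>\<^sub>M M). K (snd z, fst z) * cnj (tensor g h (snd z, fst z)))"
    unfolding L2_inner_def Bochner_Integration.integral_cnj[symmetric]
    by (simp add: kadj_def tensor_def mult_ac)
  also have "\<dots> = (LINT (x, y)|(M \<Otimes>\<^sub>M M). (\<lambda>z. K z * cnj (tensor g h z)) (y, x))"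
    by (simp add: case_prod_beta')
  also have "\<dots> = kip K (tensor g h)"
    unfolding L2_inner_def
  proof (rule MM.integral_product_swap)
    show "(\<lambda>z. K z * cnj (tensor g h z)) \<in> borel_measurable (M \<Otimes>\<^sub>M M)"
      using L2_mult_cnj_integrable[OF kernels_L2[OF K] tensor_L2(1)[OF g h]] by simp
  qed
  finally show ?thesis by (simp add: kapp_inner[OF K h g])
qed

lemma kapp_selfadjoint:
  assumes K: "K \<in> inv_kernels" and h: "h \<in> L2 M" and g: "g \<in> L2 M"
  shows "L2_inner M (kapp K h) g = L2_inner M h (kapp K g)"
proof -
  note k = inv_kernelsD[OF K]
  show ?thesis
    unfolding kapp_kadj[OF k(1) h g]
    by (rule L2_inner_cong_AE[OF _ kapp_cong[OF kadj_kernels[OF k(1)] k(1) g k(2)]])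
      (use k h g in \<open>auto intro!: kapp_measurable kadj_kernels\<close>)
qed

lemma kapp_kcomp_inner:
  assumes K: "K \<in> kernels" and L: "L \<in> kernels" and h: "h \<in> L2 M" and g: "g \<in> L2 M"
  shows "L2_inner M (kapp (kcomp K L) h) g = L2_inner M (kapp K (kapp L h)) g"
  unfolding L2_inner_def
  by (rule Bochner_Integration.integral_cong[OF refl]) (simp add: kapp_kcomp[OF K L h])

lemma kapp_diff:
  assumes K: "K \<in> kernels" and L: "L \<in> kernels" and h: "h \<in> L2 M" and x: "x \<in> space M"
  shows "kapp (\<lambda>z. K z - L z) h x = kapp K h x - kapp L h x"
proof -
  have "integrable M (\<lambda>y. J (x, y) * h y)" if J: "J \<in> kernels" for J
  proof -
    obtain B where B: "B \<ge> 0" "\<And>x y. x \<in> space M \<Longrightarrow> y \<in> space M \<Longrightarrow> cmod (J (x, y)) \<le> B"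
      using kernels_bound[OF J] by blast
    show ?thesis
    proof (rule Bochner_Integration.integrable_bound)
      show "integrable M (\<lambda>y. of_real B * h y)" using L2_integrable[OF h] by simp
      show "(\<lambda>y. J (x, y) * h y) \<in> borel_measurable M"
        using kernels_section(1)[OF J x] L2_measurable[OF h] by measurable
      show "AE y in M. norm (J (x, y) * h y) \<le> norm (of_real B * h y)"
        using B x by (intro AE_I2) (auto simp: norm_mult mult_right_mono)
    qed
  qed
  from this[OF K] this[OF L] show ?thesis by (simp add: kapp_def left_diff_distrib)
qed

lemma kapp_inner_norm_le:
  assumes "K \<in> kernels" "h \<in> L2 M"
  shows "cmod (L2_inner M (kapp K h) h) \<le> knorm K * (L2_norm M h)\<^sup>2"
  using L2_Cauchy_Schwarz[OF kernels_L2[OF assms(1)] tensor_L2(1)[OF assms(2,2)]] assms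
  by (simp add: kapp_inner tensor_L2(2) power2_eq_square)

text \<open>A spectral projection \<open>P\<close> of \<open>L\<close> with \<open>P h = 0\<close> can be subtracted from \<open>L\<close> without changing
  \<open>\<langle>L h, h\<rangle>\<close>. This decreases the Hilbert-Schmidt norm by a fixed amount, which is impossible when \<open>L\<close>
  almost minimises it.\<close>

lemma projection_nonzero:
  assumes h: "h \<in> L2 M" and K: "K \<in> inv_kernels" and nz: "L2_inner M (kapp K h) h \<noteq> 0"
  obtains P where "P \<in> inv_kernels" "kcomp P P \<doteq> P" "\<not> (AE x in M. kapp P h x = 0)"
proof (rule ccontr)
  assume "\<not> thesis"
  then have none: "\<And>P. P \<in> inv_kernels \<Longrightarrow> kcomp P P \<doteq> P \<Longrightarrow> AE x in M. kapp P h x = 0"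
    using that by metis
  define \<kappa> where "\<kappa> = L2_inner M (kapp K h) h"
  define S where "S = {L \<in> inv_kernels. L2_inner M (kapp L h) h = \<kappa>}"
  define N where "N = (L2_norm M h)\<^sup>2"
  define I where "I = (INF L\<in>S. (knorm L)\<^sup>2)"
  have KS: "K \<in> S" using K by (simp add: S_def \<kappa>_def)
  have bdd: "bdd_below ((\<lambda>L. (knorm L)\<^sup>2) ` S)" by (rule bdd_belowI[of _ 0]) auto
  have I: "I \<le> (knorm L)\<^sup>2" if "L \<in> S" for L unfolding I_def by (rule cINF_lower[OF bdd that])
  have I0: "I \<ge> 0" unfolding I_def using KS by (intro cINF_greatest) auto
  have Npos: "N > 0"
  proof -
    have "0 < cmod \<kappa>" using nz by (simp add: \<kappa>_def)
    also have "\<dots> \<le> knorm K * N" unfolding \<kappa>_def N_def by (rule kapp_inner_norm_le[OF inv_kernelsD(1)[OF K] h])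
    finally have "N \<noteq> 0" by auto
    then show ?thesis by (simp add: N_def)
  qed
  \<comment> \<open>Two uses of Cauchy-Schwarz: |\<kappa>| is at most |L h| |h|, and |L h|^2 = <L L
    h, h> is at most \<open>N\<close> times the norm of \<open>kcomp L L\<close>. So
    \<open>a\<close> bounds that norm from below on all of \<open>S\<close>.\<close>
  define a where "a = (cmod \<kappa>)\<^sup>2 / N\<^sup>2"
  have a: "a > 0" using nz Npos by (simp add: a_def \<kappa>_def)
  have LL: "knorm (kcomp L L) \<ge> a" if L: "L \<in> S" for L
  proof -
    have Ls: "L \<in> inv_kernels" and Lk: "L \<in> kernels" using L inv_kernelsD by (auto simp: S_def)
    have Lh: "kapp L h \<in> L2 M" by (rule kapp_L2[OF Lk h])
    have "L2_inner M (kapp (kcomp L L) h) h = L2_inner M (kapp L h) (kapp L h)"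
      by (simp add: kapp_kcomp_inner[OF Lk Lk h h] kapp_selfadjoint[OF Ls Lh h])
    then have 1: "(L2_norm M (kapp L h))\<^sup>2 \<le> knorm (kcomp L L) * N"
      using kapp_inner_norm_le[OF kcomp_kernels[OF Lk Lk] h] by (simp add: L2_inner_self N_def norm_power)
    have "cmod \<kappa> \<le> L2_norm M (kapp L h) * L2_norm M h"
      using L2_Cauchy_Schwarz[OF Lh h] L by (simp add: S_def)
    then have "(cmod \<kappa>)\<^sup>2 \<le> (L2_norm M (kapp L h) * L2_norm M h)\<^sup>2" by (intro power_mono) auto
    also have "\<dots> \<le> (knorm (kcomp L L) * N) * N"
      unfolding power_mult_distrib N_def[symmetric] using 1 Npos by (intro mult_right_mono) auto
    finally show ?thesis using Npos by (simp add: a_def field_simps power2_eq_square)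
  qed
  \<comment> \<open>A member of \<open>S\<close> with squared norm below I + 1 has top eigenvalue
    \<open>l\<close> at least a^2 / (I + 1), hence at least \<open>\<delta>\<close>. Removing the
    projected part lowers the squared norm by at least \<open>l\<close>, which exceeds the distance
    of a near minimiser from \<open>I\<close>.\<close>
  define \<delta> where "\<delta> = min 1 (a\<^sup>2 / (I + 1))"
  have \<delta>: "\<delta> > 0" "\<delta> \<le> 1" "\<delta> \<le> a\<^sup>2 / (I + 1)" using a I0 by (auto simp: \<delta>_def)
  have "\<exists>L\<in>S. (knorm L)\<^sup>2 < I + \<delta>"
    using cINF_less_iff[of S "\<lambda>L. (knorm L)\<^sup>2" "I + \<delta>"] bdd KS \<delta>(1) unfolding I_def by auto
  then obtain L where L: "L \<in> S" "(knorm L)\<^sup>2 < I + \<delta>" by blast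
  have Ls: "L \<in> inv_kernels" and Lk: "L \<in> kernels" using L inv_kernelsD by (auto simp: S_def)
  have LLpos: "knorm (kcomp L L) > 0" using LL[OF L(1)] a by linarith
  obtain l :: real and P where P: "l \<ge> (knorm (kcomp L L))\<^sup>2 / (knorm L)\<^sup>2" "l > 0" "P \<in> inv_kernels"
    "kcomp P P \<doteq> P" "knorm P \<ge> 1" "kcomp P (kcomp L L) \<doteq> (\<lambda>z. of_real l * P z)"
    "kcomp P L \<doteq> kcomp L P"
    by (rule spectral_projection[OF Ls LLpos])
  have Pk: "P \<in> kernels" using P(3) by (rule inv_kernelsD)
  note kk = Lk Pk kcomp_kernels
  have Lpos: "knorm L > 0"
    using knorm_kcomp[OF Lk Lk] LLpos L2_norm_nonneg[of "M \<Otimes>\<^sub>M M" L] by (cases "knorm L = 0") auto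
  have "\<delta> \<le> l"
  proof -
    have "a\<^sup>2 / (I + 1) \<le> (knorm (kcomp L L))\<^sup>2 / (knorm L)\<^sup>2"
      using LL[OF L(1)] a L(2) \<delta>(2) Lpos by (intro frac_le power_mono) auto
    then show ?thesis using \<delta>(3) P(1) by linarith
  qed
  define L' where "L' = (\<lambda>z. L z - kcomp P L z)"
  have PL: "kcomp P L \<in> inv_kernels" by (rule inv_kernels_kcomp_commuting[OF P(3) Ls P(7)])
  have Ph: "AE x in M. kapp P h x = 0" by (rule none[OF P(3,4)])
  have "L2_inner M (kapp (kcomp P L) h) h = L2_inner M (kapp L h) (kapp P h)"
    by (simp add: kapp_kcomp_inner[OF Pk Lk h h] kapp_selfadjoint[OF P(3) kapp_L2[OF Lk h] h])
  also have "\<dots> = L2_inner M (kapp L h) (\<lambda>x. 0)"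
    using Ph kapp_measurable[OF Pk h] kapp_measurable[OF Lk h] by (intro L2_inner_cong_AE) auto
  finally have PL0: "L2_inner M (kapp (kcomp P L) h) h = 0" by (simp add: L2_inner_def)
  have "L2_inner M (kapp L' h) h = L2_inner M (\<lambda>x. kapp L h x - kapp (kcomp P L) h x) h"
    unfolding L2_inner_def L'_def
    by (rule Bochner_Integration.integral_cong[OF refl]) (simp add: kapp_diff h kk)
  also have "\<dots> = \<kappa>"
    using L(1) PL0 by (simp add: L2_inner_diff_left kapp_L2 h kk S_def)
  finally have "L' \<in> S" using inv_kernels_diff[OF Ls PL] by (simp add: S_def L'_def)
  then have "I \<le> (knorm L')\<^sup>2" by (rule I)
  also have "\<dots> = (knorm L)\<^sup>2 - (knorm (kcomp P L))\<^sup>2"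
  proof -
    have "kip (kcomp P L) (kcomp P L) = kip L (kcomp P (kcomp P L))"
      by (intro kip_kcomp_selfadjoint P kk)
    also have "\<dots> = kip L (kcomp P L)"
    proof (rule kip_cong)
      have "kcomp (kcomp P P) L \<doteq> kcomp P L" by (intro kcomp_cong kk P) auto
      then show "kcomp P (kcomp P L) \<doteq> kcomp P L"
        by (rule keq_trans[OF keq_sym[OF kcomp_assoc_eq[OF Pk Pk Lk]]])
    qed (auto intro!: kk)
    finally have "Re (kip L (kcomp P L)) = (knorm (kcomp P L))\<^sup>2"
      unfolding L2_inner_self by (metis Re_complex_of_real)
    then show ?thesis
      using L2_norm_diff_square[OF kernels_L2[OF Lk] kernels_L2[OF kcomp_kernels[OF Pk Lk]]] by (simp add: L'_def)
  qed
  \<comment> \<open>One factor \<open>L\<close> is moved to the other side, where P L L is the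
    multiple \<open>l\<close> of P.\<close>
  also have "(knorm (kcomp P L))\<^sup>2 = l * (knorm P)\<^sup>2"
  proof -
    have "kip (kcomp P L) (kcomp P L) = kip P (kcomp (kcomp P L) (kadj L))"
      by (intro kip_kcomp_right kk)
    also have "\<dots> = kip P (\<lambda>z. of_real l * P z)"
    proof (rule kip_cong)
      have "kcomp (kcomp P L) (kadj L) \<doteq> kcomp (kcomp P L) L"
        by (intro kcomp_cong kk kadj_kernels inv_kernelsD(2)[OF Ls]) auto
      from keq_trans[OF this kcomp_assoc_eq[OF Pk Lk Lk]]
      show "kcomp (kcomp P L) (kadj L) \<doteq> (\<lambda>z. of_real l * P z)" by (rule keq_trans[OF _ P(6)])
    qed (auto intro!: kk kadj_kernels kernels_scale)
    also have "\<dots> = of_real (l * (knorm P)\<^sup>2)"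
      by (simp add: L2_inner_scale_right L2_inner_self)
    finally show ?thesis unfolding L2_inner_self of_real_eq_iff .
  qed
  also have "(knorm L)\<^sup>2 - l * (knorm P)\<^sup>2 < I"
  proof -
    have "l \<le> l * (knorm P)\<^sup>2" using P(2,5) by simp
    then show ?thesis using L(2) \<open>\<delta> \<le> l\<close> by linarith
  qed
  finally show False by simp
qed

section \<open>Invariant projections that do not split\<close>

lemma projection_norm_ge_1:
  assumes "P \<in> kernels" "kcomp P P \<doteq> P" "knorm P \<noteq> 0"
  shows "knorm P \<ge> 1"
proof -
  have "knorm P = knorm (kcomp P P)"
    using assms by (intro L2_norm_cong_AE[OF keq_sym[OF assms(2)]] kernels_measurable kcomp_kernels)
  also have "\<dots> \<le> knorm P * knorm P" by (rule knorm_kcomp[OF assms(1,1)])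
  finally show ?thesis using assms(3) L2_norm_nonneg[of "M \<Otimes>\<^sub>M M" P] by (simp add: less_le)
qed

lemma keq_kadj_kcomp:
  assumes P: "P \<in> inv_kernels" and Q: "Q \<in> inv_kernels" and PQ: "kcomp P Q \<doteq> Q"
  shows "kcomp Q P \<doteq> Q"
proof -
  note p = inv_kernelsD[OF P] and q = inv_kernelsD[OF Q]
  have "kcomp Q P \<doteq> kadj (kcomp P Q)"
    unfolding kadj_kcomp using p q by (intro kcomp_cong kadj_kernels) (auto intro: keq_sym)
  moreover have "kadj (kcomp P Q) \<doteq> kadj Q"
    by (intro kadj_cong kcomp_kernels p q PQ)
  ultimately show ?thesis by (rule keq_trans[OF keq_trans _ ]) (rule q(2))
qed

text \<open>P Q = Q says that the range of Q lies in that of P; taking adjoints, Q P = Q as well.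
  This gives idempotence of the difference, and since the inner product of P and Q is the squared
  norm of Q, also Pythagoras.\<close>

lemma projection_diff:
  assumes P: "P \<in> inv_kernels" "kcomp P P \<doteq> P" and Q: "Q \<in> inv_kernels" "kcomp Q Q \<doteq> Q" and PQ: "kcomp P Q \<doteq> Q"
  defines "D \<equiv> \<lambda>z. P z - Q z"
  shows "D \<in> inv_kernels" "kcomp D D \<doteq> D" "(knorm D)\<^sup>2 = (knorm P)\<^sup>2 - (knorm Q)\<^sup>2"
proof -
  note p = inv_kernelsD(1)[OF P(1)] and q = inv_kernelsD(1)[OF Q(1)]
  show D: "D \<in> inv_kernels" unfolding D_def by (rule inv_kernels_diff[OF P(1) Q(1)])
  note d = inv_kernelsD(1)[OF D]
  have "kcomp D D z = kcomp P P z - kcomp P Q z - (kcomp Q P z - kcomp Q Q z)"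
    if z: "z \<in> space (M \<Otimes>\<^sub>M M)" for z
  proof -
    have "kcomp D D z = kcomp P D z - kcomp Q D z"
      using kcomp_diff_left[OF p q d z] by (simp add: D_def[symmetric])
    also have "kcomp P D z = kcomp P P z - kcomp P Q z"
      unfolding D_def by (rule kcomp_diff_right[OF p p q z])
    also have "kcomp Q D z = kcomp Q P z - kcomp Q Q z"
      unfolding D_def by (rule kcomp_diff_right[OF q p q z])
    finally show ?thesis .
  qed
  then have "kcomp D D \<doteq> (\<lambda>z. kcomp P P z - kcomp P Q z - (kcomp Q P z - kcomp Q Q z))"
    by (rule keqI)
  then show "kcomp D D \<doteq> D"
    using P(2) Q(2) PQ keq_kadj_kcomp[OF P(1) Q(1) PQ] by eventually_elim (simp add: D_def)
  have "kip Q Q = kip (kcomp P Q) Q"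
    by (intro kip_cong keq_sym[OF PQ] kcomp_kernels p q) auto
  also have "\<dots> = kip P (kcomp Q (kadj Q))" by (rule kip_kcomp_right[OF p q q])
  also have "\<dots> = kip P Q"
  proof (rule kip_cong)
    have "kcomp Q (kadj Q) \<doteq> kcomp Q Q"
      using inv_kernelsD(2)[OF Q(1)] by (intro kcomp_cong kadj_kernels q) auto
    then show "kcomp Q (kadj Q) \<doteq> Q" by (rule keq_trans[OF _ Q(2)])
  qed (auto intro!: p q kcomp_kernels kadj_kernels)
  finally have "Re (kip P Q) = (knorm Q)\<^sup>2" unfolding L2_inner_self by (metis Re_complex_of_real)
  then show "(knorm D)\<^sup>2 = (knorm P)\<^sup>2 - (knorm Q)\<^sup>2"
    using L2_norm_diff_square[OF kernels_L2[OF p] kernels_L2[OF q]] by (simp add: D_def)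
qed

text \<open>The condition \<open>knorm Q \<ge> 1\<close> expresses that the projection
  \<open>Q\<close> is nonzero, by \<open>projection_norm_ge_1\<close>. Subprojections are considered
  regardless of their effect on \<open>h\<close>, since the arguments below may produce any of
  them.\<close>

definition minimal_projection :: "('x \<Rightarrow> complex) \<Rightarrow> ('x \<times> 'x \<Rightarrow> complex) \<Rightarrow> bool" where
  "minimal_projection h P \<longleftrightarrow> P \<in> inv_kernels \<and> kcomp P P \<doteq> P \<and> \<not> (AE x in M. kapp P h x = 0) \<and>
    (\<forall>Q\<in>inv_kernels. kcomp Q Q \<doteq> Q \<longrightarrow> kcomp P Q \<doteq> Q \<longrightarrow> knorm Q \<ge> 1 \<longrightarrow> Q \<doteq> P)"

text \<open>Nonzero projections have Hilbert-Schmidt norm at least 1, and a proper subprojection is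
  orthogonal to its complement. Hence a projection whose squared norm is within 1 of the infimum does
  not split.\<close>

lemma minimal_projection_exists:
  assumes h: "h \<in> L2 M" and P0: "P0 \<in> inv_kernels" "kcomp P0 P0 \<doteq> P0" "\<not> (AE x in M. kapp P0 h x = 0)"
  obtains P where "minimal_projection h P"
proof -
  define S where "S = {P \<in> inv_kernels. kcomp P P \<doteq> P \<and> \<not> (AE x in M. kapp P h x = 0)}"
  define I where "I = (INF L\<in>S. (knorm L)\<^sup>2)"
  have PS: "P0 \<in> S" using P0 by (simp add: S_def)
  have bdd: "bdd_below ((\<lambda>L. (knorm L)\<^sup>2) ` S)" by (rule bdd_belowI[of _ 0]) auto
  have I: "I \<le> (knorm L)\<^sup>2" if "L \<in> S" for L unfolding I_def by (rule cINF_lower[OF bdd that])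
  have "\<exists>P\<in>S. (knorm P)\<^sup>2 < I + 1"
    using cINF_less_iff[of S "\<lambda>L. (knorm L)\<^sup>2" "I + 1"] bdd PS unfolding I_def by auto
  then obtain P where PS: "P \<in> S" and PI: "(knorm P)\<^sup>2 < I + 1" by blast
  have P: "P \<in> inv_kernels" "kcomp P P \<doteq> P" "\<not> (AE x in M. kapp P h x = 0)" using PS by (auto simp: S_def)
  have "Q \<doteq> P" if Q: "Q \<in> inv_kernels" "kcomp Q Q \<doteq> Q" "kcomp P Q \<doteq> Q" "knorm Q \<ge> 1" for Q
  proof -
    define D where "D = (\<lambda>z. P z - Q z)"
    have D: "D \<in> inv_kernels" "kcomp D D \<doteq> D" "(knorm D)\<^sup>2 = (knorm P)\<^sup>2 - (knorm Q)\<^sup>2"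
      unfolding D_def by (rule projection_diff[OF P(1,2) Q(1-3)])+
    have Q1: "(knorm Q)\<^sup>2 \<ge> 1" using Q(4) by simp
    show ?thesis
    proof (cases "AE x in M. kapp Q h x = 0")
      case True
      have "\<not> (AE x in M. kapp D h x = 0)"
      proof
        assume "AE x in M. kapp D h x = 0"
        with True AE_space have "AE x in M. kapp P h x = 0"
          by eventually_elim (simp add: D_def kapp_diff[OF inv_kernelsD(1)[OF P(1)] inv_kernelsD(1)[OF Q(1)] h])
        with P(3) show False by simp
      qed
      then have "D \<in> S" using D(1,2) by (simp only: S_def mem_Collect_eq simp_thms)
      then show ?thesis using I[of D] D(3) Q1 PI by linarith
    next
      case False
      then have "I \<le> (knorm Q)\<^sup>2" using Q by (intro I) (simp add: S_def)
      then have "(knorm D)\<^sup>2 < 1" using D(3) PI by linarith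
      then have "knorm D < 1" by (simp add: power_less_one_iff L2_norm_nonneg)
      then have "knorm D = 0" using projection_norm_ge_1[OF inv_kernelsD(1)[OF D(1)] D(2)] by linarith
      then have "P \<doteq> Q"
        using inv_kernelsD(1)[OF P(1)] inv_kernelsD(1)[OF Q(1)] by (simp add: keq_iff_knorm D_def)
      then show ?thesis by (rule keq_sym)
    qed
  qed
  then have "minimal_projection h P" using P by (simp add: minimal_projection_def)
  then show thesis by (rule that)
qed

text \<open>If the square of \<open>R\<close> is nonzero, its top spectral projection Q lies below P
  because P absorbs \<open>R\<close>, and by minimality it is P. Then R R = P R R = Q R R, which is
  a multiple of Q.\<close>

lemma minimal_projection_square:
  assumes P: "minimal_projection h P" and R: "R \<in> inv_kernels" "kcomp P R \<doteq> R"
  obtains l :: real where "kcomp R R \<doteq> (\<lambda>z. of_real l * P z)"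
proof -
  have Ps: "P \<in> inv_kernels" using P by (simp add: minimal_projection_def)
  note p = inv_kernelsD(1)[OF Ps] and r = inv_kernelsD(1)[OF R(1)]
  show thesis
  proof (cases "knorm (kcomp R R) = 0")
    case True
    then have "kcomp R R \<doteq> (\<lambda>z. of_real 0 * P z)"
      using L2_norm_eq_0_iff[OF kernels_L2[OF kcomp_kernels[OF r r]]] by simp
    then show thesis by (rule that)
  next
    case False
    then have "knorm (kcomp R R) > 0" using L2_norm_nonneg[of "M \<Otimes>\<^sub>M M" "kcomp R R"] by linarith
    then obtain l :: real and Q where Q: "l \<ge> (knorm (kcomp R R))\<^sup>2 / (knorm R)\<^sup>2" "l > 0" "Q \<in> inv_kernels"
      "kcomp Q Q \<doteq> Q" "knorm Q \<ge> 1" "kcomp Q (kcomp R R) \<doteq> (\<lambda>z. of_real l * Q z)"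
      "kcomp P Q \<doteq> Q"
      by (rule spectral_projection[OF R(1)]) (use p R(2) in blast)
    note q = inv_kernelsD(1)[OF Q(3)]
    have "Q \<doteq> P"
      using P Q(3,4,5,7) by (simp add: minimal_projection_def)
    have "kcomp R R \<doteq> kcomp (kcomp P R) R"
      by (intro kcomp_cong kcomp_kernels p r keq_sym[OF R(2)]) auto
    then have "kcomp R R \<doteq> kcomp P (kcomp R R)" by (rule keq_trans[OF _ kcomp_assoc_eq[OF p r r]])
    moreover have "kcomp P (kcomp R R) \<doteq> kcomp Q (kcomp R R)"
      by (intro kcomp_cong kcomp_kernels p q r keq_sym[OF \<open>Q \<doteq> P\<close>]) auto
    ultimately have "kcomp R R \<doteq> (\<lambda>z. of_real l * P z)"
      using Q(6) \<open>Q \<doteq> P\<close> by eventually_elim simp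
    then show thesis by (rule that)
  qed
qed

lemma kernels_integrable_product:
  assumes "K \<in> kernels" "L \<in> kernels" "x \<in> space M" "y \<in> space M"
  shows "integrable M (\<lambda>w. K (x, w) * L (w, y))"
proof -
  obtain B1 where B1: "B1 \<ge> 0" "\<And>x y. x \<in> space M \<Longrightarrow> y \<in> space M \<Longrightarrow> cmod (K (x, y)) \<le> B1"
    using kernels_bound[OF assms(1)] by blast
  obtain B2 where B2: "B2 \<ge> 0" "\<And>x y. x \<in> space M \<Longrightarrow> y \<in> space M \<Longrightarrow> cmod (L (x, y)) \<le> B2"
    using kernels_bound[OF assms(2)] by blast
  have "(\<lambda>w. K (x, w) * L (w, y)) \<in> borel_measurable M"
    using kernels_section(1)[OF assms(1,3)] kernels_section(2)[OF assms(2,4)] by (rule borel_measurable_times)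
  then show ?thesis
    using assms(3,4) B1 B2
    by (intro integrable_const_bound[of _ "B1 * B2"]) (auto simp: norm_mult intro!: AE_I2 mult_mono)
qed

text \<open>Polarization: the squares of \<open>Q\<close> and of \<open>Q + P\<close> are multiples of \<open>P\<close>, hence so is \<open>Q\<close>.\<close>

lemma minimal_projection_scalar:
  assumes P: "minimal_projection h P" and Q: "Q \<in> inv_kernels" "kcomp P Q \<doteq> Q"
  obtains c :: real where "Q \<doteq> (\<lambda>z. of_real c * P z)"
proof -
  have Ps: "P \<in> inv_kernels" and PP: "kcomp P P \<doteq> P" using P by (auto simp: minimal_projection_def)
  note p = inv_kernelsD(1)[OF Ps] and q = inv_kernelsD(1)[OF Q(1)]
  let ?R = "\<lambda>z. Q z + P z"
  have R: "?R \<in> inv_kernels" by (rule inv_kernels_add[OF Q(1) Ps])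
  have add_left: "kcomp ?R J z = kcomp Q J z + kcomp P J z"
    if "J \<in> kernels" "z \<in> space (M \<Otimes>\<^sub>M M)" for J z
    using kernels_integrable_product[OF q that(1), of "fst z" "snd z"]
      kernels_integrable_product[OF p that(1), of "fst z" "snd z"] that(2)
    by (simp add: kcomp_def distrib_right space_pair_measure mem_Times_iff)
  have add_right: "kcomp J ?R z = kcomp J Q z + kcomp J P z"
    if "J \<in> kernels" "z \<in> space (M \<Otimes>\<^sub>M M)" for J z
    using kernels_integrable_product[OF that(1) q, of "fst z" "snd z"]
      kernels_integrable_product[OF that(1) p, of "fst z" "snd z"] that(2)
    by (simp add: kcomp_def distrib_left space_pair_measure mem_Times_iff)
  have "kcomp P ?R \<doteq> (\<lambda>z. kcomp P Q z + kcomp P P z)" by (rule keqI) (rule add_right[OF p])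
  then have PR: "kcomp P ?R \<doteq> ?R" using Q(2) PP by eventually_elim simp
  obtain l0 :: real where l0: "kcomp Q Q \<doteq> (\<lambda>z. of_real l0 * P z)"
    by (rule minimal_projection_square[OF P Q])
  obtain l1 :: real where l1: "kcomp ?R ?R \<doteq> (\<lambda>z. of_real l1 * P z)"
    by (rule minimal_projection_square[OF P R PR])
  have "kcomp ?R ?R \<doteq> (\<lambda>z. kcomp Q Q z + kcomp Q P z + (kcomp P Q z + kcomp P P z))"
    by (rule keqI) (simp add: add_left[OF inv_kernelsD(1)[OF R]] add_right[OF q] add_right[OF p])
  \<comment> \<open>Both cross terms in the square of Q + P are Q, because P Q = Q and Q P = Q.
    Hence 2 Q = (l1 - l0 - 1) P.\<close>
  then have "Q \<doteq> (\<lambda>z. of_real ((l1 - l0 - 1) / 2) * P z)"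
    using l0 l1 Q(2) PP keq_kadj_kcomp[OF Ps Q]
  proof eventually_elim
    case (elim z)
    then have "2 * Q z = (of_real l1 - of_real l0 - 1) * P z" by (simp add: algebra_simps)
    then show ?case by (simp add: field_simps)
  qed
  then show thesis by (rule that)
qed

text \<open>Translating a single variable is not the product action; that it respects a.e. equality
  follows section by section from invariance of the measure on \<open>M\<close>.\<close>

lemma AE_T_fst:
  assumes K: "K \<in> kernels" and L: "L \<in> kernels" and eq: "K \<doteq> L"
  shows "(\<lambda>z. K (T j (fst z), snd z)) \<doteq> (\<lambda>z. L (T j (fst z), snd z))"
proof (rule MM.AE_pair_measure)
  note [measurable] = kernels_measurable[OF K] kernels_measurable[OF L]
  show "{z \<in> space (M \<Otimes>\<^sub>M M). K (T j (fst z), snd z) = L (T j (fst z), snd z)} \<in> sets (M \<Otimes>\<^sub>M M)"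
    by measurable
  show "AE x in M. AE y in M. K (T j (fst (x, y)), snd (x, y)) = L (T j (fst (x, y)), snd (x, y))"
    using AE_T[OF MM.AE_pair[OF eq], of j] by simp
qed

text \<open>The kernel \<open>V\<close> is the translation by \<open>j\<close> composed with P. It
  is invariant and commutes with P, but it is not self-adjoint. Its real and imaginary parts are, so
  each is a real multiple of P, and \<open>V\<close> is a complex one.\<close>

lemma minimal_projection_character:
  assumes P: "minimal_projection h P"
  shows "\<exists>w. (\<lambda>z. P (T j (fst z), snd z)) \<doteq> (\<lambda>z. w * P z)"
proof -
  have Ps: "P \<in> inv_kernels" and PP: "kcomp P P \<doteq> P" using P by (auto simp: minimal_projection_def)
  note p = inv_kernelsD(1)[OF Ps]
  note [measurable] = kernels_measurable[OF p]
  obtain B where B: "B \<ge> 0" "\<And>x y. x \<in> space M \<Longrightarrow> y \<in> space M \<Longrightarrow> cmod (P (x, y)) \<le> B"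
    using kernels_bound[OF p] by blast
  define V where "V = (\<lambda>z. P (T j (fst z), snd z))"
  define W where "W = (\<lambda>z. P (fst z, T (-j) (snd z)))"
  have V: "V \<in> kernels" and W: "W \<in> kernels"
    unfolding V_def W_def using B T_space by (auto intro!: kernelsI[of _ B])
  have inv: "T (-j) (T j x) = x" if "x \<in> space M" for x
    using T_add[OF that, of "-j" j] T_zero[OF that] by simp
  \<comment> \<open>Here the group is used to be abelian: translation by \<open>j\<close> commutes
    with the action, which makes \<open>V\<close> an invariant kernel.\<close>
  have com: "T i (T j x) = T j (T i x)" if "x \<in> space M" for i x
    using T_add[OF that, of i j] T_add[OF that, of j i] by (simp add: add.commute)
  have VW: "W \<doteq> V"
  proof -
    have "(\<lambda>z. kshift (-j) P (T j (fst z), snd z)) \<doteq> V"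
      unfolding V_def by (rule AE_T_fst[OF kshift_kernels[OF p] p inv_kernelsD(3)[OF Ps]])
    moreover have "W \<doteq> (\<lambda>z. kshift (-j) P (T j (fst z), snd z))"
      by (rule keqI) (auto simp: W_def kshift_def inv space_pair_measure)
    ultimately show ?thesis by (rule keq_trans[rotated])
  qed
  have VP: "kcomp V P \<doteq> V"
    using AE_T_fst[OF kcomp_kernels[OF p p] p PP, of j] by (simp add: V_def kcomp_def)
  \<comment> \<open>Substituting \<open>T j w\<close> for the integration variable \<open>w\<close>
    moves the translation from one factor to the other.\<close>
  have "kcomp P V \<doteq> kcomp W P"
  proof (rule keqI)
    fix z assume "z \<in> space (M \<Otimes>\<^sub>M M)"
    then have z: "fst z \<in> space M" "snd z \<in> space M" by (auto simp: space_pair_measure)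
    have "(\<lambda>w. P (fst z, T (-j) w) * P (w, snd z)) \<in> borel_measurable M"
      using measurable_compose[OF T_measurable kernels_section(1)[OF p z(1)]] kernels_section(2)[OF p z(2)]
      by (rule borel_measurable_times)
    from integral_T[OF this, of j]
    have "(LINT w|M. P (fst z, T (-j) (T j w)) * P (T j w, snd z)) = kcomp W P z"
      by (simp add: kcomp_def W_def)
    moreover have "(LINT w|M. P (fst z, T (-j) (T j w)) * P (T j w, snd z)) = kcomp P V z"
      unfolding kcomp_def V_def by (rule Bochner_Integration.integral_cong) (simp_all add: inv)
    ultimately show "kcomp P V z = kcomp W P z" by simp
  qed
  note PVW = this
  have "kcomp W P \<doteq> kcomp V P" by (intro kcomp_cong V W p VW) auto
  then have PV: "kcomp P V \<doteq> V" using PVW VP by eventually_elim simp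
  have "kcomp P (kadj V) \<doteq> kadj V"
  proof -
    have "kcomp P (kadj V) \<doteq> kcomp (kadj P) (kadj V)"
      by (intro kcomp_cong kadj_kernels V p keq_sym[OF inv_kernelsD(2)[OF Ps]]) auto
    moreover have "kadj (kcomp V P) \<doteq> kadj V" by (intro kadj_cong kcomp_kernels V p VP)
    ultimately show ?thesis unfolding kadj_kcomp by (rule keq_trans)
  qed
  note PV' = this
  have shV: "kshift i V \<doteq> V" for i
  proof -
    have "(\<lambda>z. kshift i P (T j (fst z), snd z)) \<doteq> V"
      unfolding V_def by (rule AE_T_fst[OF kshift_kernels[OF p] p inv_kernelsD(3)[OF Ps]])
    moreover have "kshift i V \<doteq> (\<lambda>z. kshift i P (T j (fst z), snd z))"
      by (rule keqI) (auto simp: V_def kshift_def com space_pair_measure)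
    ultimately show ?thesis by (rule keq_trans[rotated])
  qed
  have shV': "kshift i (kadj V) \<doteq> kadj V" for i
    using kadj_cong[OF kshift_kernels[OF V] V shV[of i]] by (simp add: kadj_def kshift_def)
  \<comment> \<open>The coefficients \<open>a\<close> and \<open>cnj a\<close> make the combination
    self-adjoint. The choices 1 and \<open>\<i>\<close> yield real and imaginary part, up to
    constants.\<close>
  have comb: "\<exists>c::real. (\<lambda>z. a * V z + cnj a * kadj V z) \<doteq> (\<lambda>z. of_real c * P z)" for a
  proof -
    let ?Q = "\<lambda>z. a * V z + cnj a * kadj V z"
    have Qk: "?Q \<in> kernels" by (intro kernels_add kernels_scale V kadj_kernels)
    have "kshift i ?Q \<doteq> ?Q" for i
      using shV[of i] shV'[of i] by eventually_elim (simp add: kshift_def)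
    moreover have "kadj ?Q \<doteq> ?Q" by (rule keqI) (simp add: kadj_def)
    ultimately have Q: "?Q \<in> inv_kernels" using Qk by (simp add: inv_kernels_def)
    have "kcomp P ?Q \<doteq> (\<lambda>z. a * kcomp P V z + cnj a * kcomp P (kadj V) z)"
    proof (rule keqI)
      fix z assume "z \<in> space (M \<Otimes>\<^sub>M M)"
      then have z: "fst z \<in> space M" "snd z \<in> space M" by (auto simp: space_pair_measure)
      have "kcomp P ?Q z = kcomp P (\<lambda>z. a * V z) z + kcomp P (\<lambda>z. cnj a * kadj V z) z"
        using kernels_integrable_product[OF p kernels_scale[OF V, of a] z]
          kernels_integrable_product[OF p kernels_scale[OF kadj_kernels[OF V], of "cnj a"] z]
        by (simp add: kcomp_def distrib_left)
      then show "kcomp P ?Q z = a * kcomp P V z + cnj a * kcomp P (kadj V) z"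
        by (simp add: kcomp_scale_right)
    qed
    then have "kcomp P ?Q \<doteq> ?Q" using PV PV' by eventually_elim simp
    then obtain c :: real where "?Q \<doteq> (\<lambda>z. of_real c * P z)"
      by (rule minimal_projection_scalar[OF P Q])
    then show ?thesis by blast
  qed
  obtain c1 :: real where c1: "(\<lambda>z. V z + kadj V z) \<doteq> (\<lambda>z. of_real c1 * P z)"
    using comb[of 1] by auto
  obtain c2 :: real where c2: "(\<lambda>z. \<i> * V z - \<i> * kadj V z) \<doteq> (\<lambda>z. of_real c2 * P z)"
    using comb[of \<i>] by auto
  have "V \<doteq> (\<lambda>z. ((of_real c1 - \<i> * of_real c2) / 2) * P z)"
    using c1 c2
  proof eventually_elim
    case (elim z)
    have "2 * V z = (V z + kadj V z) - \<i> * (\<i> * V z - \<i> * kadj V z)" by (simp add: algebra_simps)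
    also have "\<dots> = (of_real c1 - \<i> * of_real c2) * P z" unfolding elim by (simp add: algebra_simps)
    finally show ?case by (simp add: field_simps)
  qed
  then show ?thesis unfolding V_def by blast
qed

end

section \<open>Measurable characters are continuous\<close>

text \<open>Tube argument: addition is continuous at each (0, k), finitely many of the resulting
  neighbourhoods of points of \<open>K\<close> cover it, and the intersection of the matching
  neighbourhoods of 0 serves all of \<open>K\<close>.\<close>

lemma compact_translate_subset_open:
  fixes K :: "'g::topological_ab_group_add set"
  assumes K: "compact K" and W: "open W" "K \<subseteq> W"
  obtains U where "open U" "0 \<in> U" "\<And>g k. g \<in> U \<Longrightarrow> k \<in> K \<Longrightarrow> g + k \<in> W"
proof -
  have "\<exists>U V. open U \<and> open V \<and> 0 \<in> U \<and> k \<in> V \<and> (\<forall>u\<in>U. \<forall>v\<in>V. u + v \<in> W)" if k: "k \<in> K" for k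
  proof -
    have "open ((\<lambda>p::'g \<times> 'g. fst p + snd p) -` W)"
      using W(1) by (rule open_vimage) (intro continuous_intros)
    moreover have "(0, k) \<in> (\<lambda>p. fst p + snd p) -` W" using k W(2) by auto
    ultimately obtain U V where "open U" "open V" "(0, k) \<in> U \<times> V" "U \<times> V \<subseteq> (\<lambda>p. fst p + snd p) -` W"
      by (rule open_prod_elim)
    then show ?thesis by (intro exI[of _ U] exI[of _ V]) auto
  qed
  then have "\<forall>k\<in>K. \<exists>p. open (fst p) \<and> open (snd p) \<and> 0 \<in> fst p \<and> k \<in> snd p \<and> (\<forall>u\<in>fst p. \<forall>v\<in>snd p. u + v \<in> W)"
    by simp
  from bchoice[OF this] obtain p where p: "\<forall>k\<in>K. open (fst (p k)) \<and> open (snd (p k)) \<and> 0 \<in> fst (p k) \<and>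
      k \<in> snd (p k) \<and> (\<forall>u\<in>fst (p k). \<forall>v\<in>snd (p k). u + v \<in> W)"
    by (rule exE)
  define U V where "U k = fst (p k)" and "V k = snd (p k)" for k
  have UV: "\<And>k. k \<in> K \<Longrightarrow> open (U k)" "\<And>k. k \<in> K \<Longrightarrow> open (V k)"
    "\<And>k. k \<in> K \<Longrightarrow> 0 \<in> U k" "\<And>k. k \<in> K \<Longrightarrow> k \<in> V k"
    "\<And>k u v. k \<in> K \<Longrightarrow> u \<in> U k \<Longrightarrow> v \<in> V k \<Longrightarrow> u + v \<in> W"
    using p by (simp_all add: U_def V_def)
  have cover: "K \<subseteq> (\<Union>k\<in>K. V k)" using UV(4) by auto
  obtain C where C: "C \<subseteq> K" "finite C" "K \<subseteq> (\<Union>k\<in>C. V k)"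
    by (rule compactE_image[OF K UV(2) cover])
  show thesis
  proof (rule that[of "\<Inter>k\<in>C. U k"])
    show "open (\<Inter>k\<in>C. U k)" using C UV(1) by (intro open_INT) auto
    show "0 \<in> (\<Inter>k\<in>C. U k)" using C UV(3) by auto
    show "g + k \<in> W" if g: "g \<in> (\<Inter>k\<in>C. U k)" and k: "k \<in> K" for g k
    proof -
      obtain c where "c \<in> C" "k \<in> V c" using C(3) k by blast
      with g C(1) show ?thesis by (intro UV(5)[of c]) auto
    qed
  qed
qed

lemma haar_measureD:
  fixes \<nu> :: "'g::{topological_ab_group_add, t2_space} measure"
  assumes "haar_measure \<nu>"
  shows "sets \<nu> = sets borel" "emeasure \<nu> UNIV \<noteq> 0"
    "\<And>g A. A \<in> sets borel \<Longrightarrow> emeasure \<nu> ((+) g ` A) = emeasure \<nu> A"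
    "\<And>K. compact K \<Longrightarrow> emeasure \<nu> K < \<infinity>"
    "\<And>A. A \<in> sets borel \<Longrightarrow> emeasure \<nu> A = (INF U\<in>{U. open U \<and> A \<subseteq> U}. emeasure \<nu> U)"
    "\<And>U. open U \<Longrightarrow> emeasure \<nu> U = (SUP K\<in>{K. compact K \<and> K \<subseteq> U}. emeasure \<nu> K)"
proof -
  note h = assms[unfolded haar_measure_def]
  show "sets \<nu> = sets borel" using h by (rule conjunct1)
  note h = h[THEN conjunct2]
  show "emeasure \<nu> UNIV \<noteq> 0" using h by (rule conjunct1)
  note h = h[THEN conjunct2]
  show "emeasure \<nu> ((+) g ` A) = emeasure \<nu> A" if "A \<in> sets borel" for g A
    using h[THEN conjunct1] that by simp
  note h = h[THEN conjunct2]
  show "emeasure \<nu> K < \<infinity>" if "compact K" for K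
    using h[THEN conjunct1] that by simp
  note h = h[THEN conjunct2]
  show "emeasure \<nu> A = (INF U\<in>{U. open U \<and> A \<subseteq> U}. emeasure \<nu> U)" if "A \<in> sets borel" for A
    using h[THEN conjunct1, THEN bspec, OF that] .
  show "emeasure \<nu> U = (SUP K\<in>{K. compact K \<and> K \<subseteq> U}. emeasure \<nu> K)" if "open U" for U
    using h[THEN conjunct2, THEN spec, THEN mp, OF that] .
qed

lemma translate_borel:
  fixes A :: "'g::{topological_ab_group_add, t2_space} set"
  assumes "A \<in> sets borel"
  shows "(+) g ` A \<in> sets borel"
proof -
  have "(\<lambda>x. - g + x) \<in> borel_measurable (borel :: 'g measure)"
    by (intro borel_measurable_continuous_onI continuous_intros)
  from measurable_sets[OF this assms] have "(\<lambda>x. - g + x) -` A \<in> sets borel" by simp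
  moreover have "(+) g ` A = (\<lambda>x. - g + x) -` A"
  proof (intro equalityI subsetI)
    fix x assume "x \<in> (\<lambda>x. - g + x) -` A"
    then show "x \<in> (+) g ` A" by (intro image_eqI[of _ _ "- g + x"]) auto
  qed auto
  ultimately show ?thesis by simp
qed

text \<open>Inner regularity is assumed for open sets only, so the compact set \<open>K\<close> is
  chosen inside an open \<open>W\<close> slightly larger than \<open>A\<close>, not inside
  \<open>A\<close>. The intersection \<open>S\<close> of \<open>K\<close> and \<open>A\<close> fills
  more than half of \<open>W\<close>. A small translate of \<open>S\<close> stays in
  \<open>W\<close>, so it cannot be disjoint from \<open>S\<close>.\<close>

lemma steinhaus:
  fixes \<nu> :: "'g::{topological_ab_group_add, t2_space} measure"
  assumes \<nu>: "haar_measure \<nu>" and A: "A \<in> sets borel" "emeasure \<nu> A \<noteq> 0" "emeasure \<nu> A < \<infinity>"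
  obtains U where "open U" "0 \<in> U" "\<And>g. g \<in> U \<Longrightarrow> \<exists>a\<in>A. g + a \<in> A"
proof -
  note h = haar_measureD[OF \<nu>]
  \<comment> \<open>With the measure of \<open>A\<close> equal to 4 d, that of \<open>W\<close>
    equal to m < 5 d and that of \<open>K\<close> above m - d, the intersection has measure above 3
    d > m - 2 d. Twice m - 2 d is at least m, because m is at least 4 d.\<close>
  define d where "d = measure \<nu> A / 4"
  have mA: "emeasure \<nu> A = ennreal (4 * d)" using A(3) by (simp add: d_def emeasure_eq_ennreal_measure less_top)
  have d: "d > 0" using A(2) mA by (simp add: ennreal_eq_0_iff not_le)
  have "emeasure \<nu> A < ennreal (5 * d)" unfolding mA using d by (simp add: ennreal_less_iff)
  then obtain W where W: "open W" "A \<subseteq> W" "emeasure \<nu> W < ennreal (5 * d)"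
    unfolding h(5)[OF A(1)] INF_less_iff by blast
  define m where "m = measure \<nu> W"
  have mW: "emeasure \<nu> W = ennreal m"
    using W(3) less_trans[OF W(3) ennreal_less_top] by (simp add: m_def emeasure_eq_ennreal_measure)
  have sW: "W \<in> sets \<nu>" "A \<in> sets \<nu>" using W(1) A(1) h(1) by auto
  have m: "4 * d \<le> m" "m < 5 * d"
  proof -
    have "emeasure \<nu> A \<le> emeasure \<nu> W" using W(2) sW(1) by (rule emeasure_mono)
    then show "4 * d \<le> m" unfolding mA mW by (simp add: m_def)
    show "m < 5 * d" using W(3) unfolding mW by (simp add: ennreal_less_iff m_def)
  qed
  have "ennreal (m - d) < emeasure \<nu> W" unfolding mW using d m by (simp add: ennreal_less_iff)
  then obtain K where K: "compact K" "K \<subseteq> W" "ennreal (m - d) < emeasure \<nu> K"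
    unfolding h(6)[OF W(1)] less_SUP_iff by blast
  have sK: "K \<in> sets \<nu>" using K(1) h(1) by (simp add: borel_closed compact_imp_closed)
  have fin: "emeasure \<nu> X \<noteq> \<infinity>" if "X \<subseteq> W" for X
    using emeasure_mono[OF that sW(1)] mW by (auto simp: top_unique)
  have mX: "emeasure \<nu> X = ennreal (measure \<nu> X)" if "X \<subseteq> W" for X
    using fin[OF that] by (simp add: emeasure_eq_ennreal_measure)
  have Kgt: "m - d < measure \<nu> K" using K(3) mX[OF K(2)] d m by (simp add: ennreal_less_iff)
  define S where "S = K \<inter> A"
  have sS: "S \<in> sets \<nu>" using sK sW by (simp add: S_def)
  have SW: "S \<subseteq> W" using K(2) by (auto simp: S_def)
  have Sgt: "m - 2 * d < measure \<nu> S"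
  proof -
    have "K \<in> fmeasurable \<nu>" "A \<in> fmeasurable \<nu>"
      using fin[OF K(2)] fin[OF W(2)] sK sW by (auto simp: fmeasurable_def less_top)
    then have "measure \<nu> K + measure \<nu> A = measure \<nu> (K \<union> A) + measure \<nu> S"
      unfolding S_def by (simp add: measure_Un3)
    moreover have "measure \<nu> (K \<union> A) \<le> m"
      unfolding m_def using K(2) W(2) sK sW fin[of W]
      by (intro measure_mono_fmeasurable) (auto simp: fmeasurable_def less_top)
    ultimately show ?thesis using Kgt m(2) by (simp add: d_def)
  qed
  obtain U where U: "open U" "0 \<in> U" "\<And>g k. g \<in> U \<Longrightarrow> k \<in> K \<Longrightarrow> g + k \<in> W"
    using compact_translate_subset_open[OF K(1) W(1) K(2)] by metis
  have "\<exists>a\<in>A. g + a \<in> A" if g: "g \<in> U" for g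
  proof (rule ccontr)
    assume neg: "\<not> ?thesis"
    let ?S = "(+) g ` S"
    have "S \<inter> ?S = {}" using neg by (auto simp: S_def)
    have sS': "?S \<in> sets \<nu>" using translate_borel[of S g] sS h(1) by simp
    have S'W: "?S \<subseteq> W" using U(3)[OF g] by (auto simp: S_def)
    have "measure \<nu> ?S = measure \<nu> S" using h(3)[of S g] sS h(1) by (simp add: measure_def)
    moreover have "measure \<nu> (S \<union> ?S) = measure \<nu> S + measure \<nu> ?S"
      using sS sS' SW S'W fin \<open>S \<inter> ?S = {}\<close> by (intro measure_Union) auto
    moreover have "measure \<nu> (S \<union> ?S) \<le> m"
      unfolding m_def using SW S'W sS sS' sW fin[of W]
      by (intro measure_mono_fmeasurable) (auto simp: fmeasurable_def less_top)
    ultimately show False using Sgt m by simp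
  qed
  with U(1,2) show thesis by (rule that)
qed

text \<open>Among countably many sets \<open>A d\<close> on which \<open>w\<close> is nearly
  constant, covering a compact set of positive measure, one has positive measure. By Steinhaus its
  differences contain a neighbourhood of 0, on which the homomorphism \<open>w\<close> is close to
  1; continuity at other points follows by translation.\<close>

lemma measurable_character_continuous:
  fixes \<nu> :: "'g::{topological_ab_group_add, t2_space} measure" and w :: "'g \<Rightarrow> complex"
  assumes \<nu>: "haar_measure \<nu>" and w [measurable]: "w \<in> borel_measurable borel"
    and w1: "\<And>j. cmod (w j) = 1" and hom: "\<And>i j. w (i + j) = w i * w j"
  shows "continuous_on UNIV w"
proof -
  note h = haar_measureD[OF \<nu>]
  have near: "\<exists>U. open U \<and> 0 \<in> U \<and> (\<forall>g\<in>U. cmod (w g - 1) < e)" if e: "e > 0" for e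
  proof -
    have "0 < emeasure \<nu> UNIV" using h(2) by (simp add: zero_less_iff_neq_zero)
    then obtain K where K: "compact K" "0 < emeasure \<nu> K"
      unfolding h(6)[OF open_UNIV] less_SUP_iff by blast
    have sK [measurable]: "K \<in> sets borel" using K(1) by (simp add: borel_closed compact_imp_closed)
    obtain D :: "complex set" where D: "countable D" "\<And>X. open X \<Longrightarrow> X \<noteq> {} \<Longrightarrow> \<exists>d\<in>D. d \<in> X"
      using countable_dense_setE[where 'a = complex] by blast
    define A where "A d = {j \<in> K. cmod (w j - d) < e / 2}" for d
    have sA: "A d \<in> sets borel" for d
    proof -
      have "A d = K \<inter> {j \<in> space borel. cmod (w j - d) < e / 2}" by (auto simp: A_def)
      also have "\<dots> \<in> sets borel" by measurable
      finally show ?thesis .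
    qed
    have cover: "K \<subseteq> (\<Union>d\<in>D. A d)"
    proof
      fix j assume j: "j \<in> K"
      obtain d where "d \<in> D" "d \<in> ball (w j) (e / 2)"
        using D(2)[of "ball (w j) (e / 2)"] e by auto
      then show "j \<in> (\<Union>d\<in>D. A d)" using j by (auto simp: A_def dist_norm)
    qed
    have "\<exists>d. emeasure \<nu> (A d) \<noteq> 0"
    proof (rule ccontr)
      assume "\<not> ?thesis"
      then have "A d \<in> null_sets \<nu>" for d using sA h(1) by (simp add: null_sets_def)
      then have "(\<Union>d\<in>D. A d) \<in> null_sets \<nu>" using D(1) by (intro null_sets_UN')
      then have "K \<in> null_sets \<nu>" using cover sK h(1) by (intro null_sets_subset[of _ _ K]) simp_all
      then show False using K(2) by (simp add: null_sets_def)
    qed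
    then obtain d where d: "emeasure \<nu> (A d) \<noteq> 0" by (rule exE)
    have "emeasure \<nu> (A d) \<le> emeasure \<nu> K" using sK h(1) by (intro emeasure_mono) (auto simp: A_def)
    then have "emeasure \<nu> (A d) < \<infinity>" using h(4)[OF K(1)] by (rule le_less_trans)
    then obtain U where U: "open U" "0 \<in> U" "\<And>g. g \<in> U \<Longrightarrow> \<exists>a\<in>A d. g + a \<in> A d"
      using steinhaus[OF \<nu> sA d] by metis
    have "cmod (w g - 1) < e" if g: "g \<in> U" for g
    proof -
      obtain a where a: "a \<in> A d" "g + a \<in> A d" using U(3)[OF g] by blast
      have "w (g + a) - w a = (w g - 1) * w a" by (simp add: hom left_diff_distrib)
      then have "cmod (w g - 1) = cmod (w (g + a) - w a)" by (simp add: norm_mult w1)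
      also have "\<dots> \<le> cmod (w (g + a) - d) + cmod (w a - d)"
        using norm_triangle_ineq4[of "w (g + a) - d" "w a - d"] by simp
      also have "\<dots> < e" using a by (auto simp: A_def)
      finally show ?thesis .
    qed
    with U(1,2) show ?thesis by blast
  qed
  show ?thesis
  proof (rule continuous_at_imp_continuous_on, rule ballI)
    fix x
    show "isCont w x"
      unfolding isCont_def tendsto_iff
    proof (intro allI impI)
      fix e :: real assume "e > 0"
      then obtain U where U: "open U" "0 \<in> U" "\<And>g. g \<in> U \<Longrightarrow> cmod (w g - 1) < e" using near by metis
      have "open ((\<lambda>y. y - x) -` U)" using U(1) by (rule open_vimage) (intro continuous_intros)
      moreover have "dist (w y) (w x) < e" if "y \<in> (\<lambda>y. y - x) -` U" for y
      proof -
        have "w y = w (y - x) * w x" using hom[of "y - x" x] by simp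
        then have "w y - w x = (w (y - x) - 1) * w x" by (simp add: left_diff_distrib)
        then show ?thesis using U(3)[of "y - x"] that by (simp add: dist_norm norm_mult w1)
      qed
      ultimately show "\<forall>\<^sub>F y in at x. dist (w y) (w x) < e"
        unfolding eventually_at_topological using U(2) by (intro exI[of _ "(\<lambda>y. y - x) -` U"]) auto
    qed
  qed
qed

section \<open>Eigenfunctions from invariant kernels\<close>

context folner_mps
begin

text \<open>The eigenfunction is P h for a minimal projection P. Its eigenvalue has modulus 1
  because the action preserves norms, and it is multiplicative because P h is not zero.\<close>

lemma eigenfunction_of_kernel:
  assumes h: "h \<in> L2 M" and K: "K \<in> inv_kernels" and nz: "L2_inner M (kapp K h) h \<noteq> 0"
  obtains \<phi> where "eigenfunction M T \<phi>" "L2_inner M \<phi> h \<noteq> 0"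
proof -
  obtain P0 where P0: "P0 \<in> inv_kernels" "kcomp P0 P0 \<doteq> P0" "\<not> (AE x in M. kapp P0 h x = 0)"
    by (rule projection_nonzero[OF h K nz])
  obtain P where P: "minimal_projection h P"
    by (rule minimal_projection_exists[OF h P0])
  have Ps: "P \<in> inv_kernels" and PP: "kcomp P P \<doteq> P" and Ph: "\<not> (AE x in M. kapp P h x = 0)"
    using P by (auto simp: minimal_projection_def)
  note p = inv_kernelsD(1)[OF Ps]
  define \<phi> where "\<phi> = kapp P h"
  have \<phi>: "\<phi> \<in> L2 M" unfolding \<phi>_def by (rule kapp_L2[OF p h])
  have \<phi>nz: "\<not> (AE x in M. \<phi> x = 0)" using Ph by (simp add: \<phi>_def)
  have [measurable]: "\<phi> \<in> borel_measurable M" using \<phi> by (simp add: L2_def)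
  have npos: "L2_norm M \<phi> > 0" using L2_norm_eq_0_iff[OF \<phi>] \<phi>nz L2_norm_nonneg[of M \<phi>] by (simp add: less_le)
  obtain w where w: "\<And>j. (\<lambda>z. P (T j (fst z), snd z)) \<doteq> (\<lambda>z. w j * P z)"
    using minimal_projection_character[OF P] by metis
  have eig: "AE x in M. \<phi> (T j x) = w j * \<phi> x" for j
  proof -
    have V: "(\<lambda>z. P (T j (fst z), snd z)) \<in> kernels"
    proof -
      obtain B where B: "B \<ge> 0" "\<And>x y. x \<in> space M \<Longrightarrow> y \<in> space M \<Longrightarrow> cmod (P (x, y)) \<le> B"
        using kernels_bound[OF p] by blast
      note [measurable] = kernels_measurable[OF p]
      show ?thesis using B T_space by (auto intro!: kernelsI[of _ B])
    qed
    have "AE x in M. kapp (\<lambda>z. P (T j (fst z), snd z)) h x = kapp (\<lambda>z. w j * P z) h x"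
      by (rule kapp_cong[OF V kernels_scale[OF p] h w])
    then show ?thesis by (simp add: kapp_def \<phi>_def mult.assoc)
  qed
  have w1: "cmod (w j) = 1" for j
  proof -
    have "L2_norm M \<phi> = L2_norm M (\<lambda>x. \<phi> (T j x))" by (rule L2_norm_T[symmetric]) simp
    also have "\<dots> = L2_norm M (\<lambda>x. w j * \<phi> x)" by (rule L2_norm_cong_AE[OF eig]) measurable
    also have "\<dots> = cmod (w j) * L2_norm M \<phi>" by (rule L2_norm_scale)
    finally show ?thesis using npos by simp
  qed
  have hom: "w (i + j) = w i * w j" for i j
  proof (rule ccontr)
    assume ne: "w (i + j) \<noteq> w i * w j"
    have "AE x in M. \<phi> x = 0"
      using eig[of "i + j"] eig[of j] AE_T[OF eig[of i], of j] AE_space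
    proof eventually_elim
      case (elim x)
      then have "(w (i + j) - w i * w j) * \<phi> x = 0" by (auto simp: T_add algebra_simps)
      then show ?case using ne by auto
    qed
    with \<phi>nz show False by simp
  qed
  \<comment> \<open>\<open>w\<close> was chosen separately for every group element. It is recovered
    as a normalised correlation of \<phi> with its translates, an integral that depends measurably
    on \<open>j\<close>.\<close>
  have "w \<in> borel_measurable borel"
  proof -
    have "L2_inner M (\<lambda>x. \<phi> (T j x)) \<phi> = w j * of_real ((L2_norm M \<phi>)\<^sup>2)" for j
    proof -
      have "L2_inner M (\<lambda>x. \<phi> (T j x)) \<phi> = L2_inner M (\<lambda>x. w j * \<phi> x) \<phi>"
        by (rule L2_inner_cong_AE[OF eig]) auto
      then show ?thesis by (simp add: L2_inner_scale_left L2_inner_self)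
    qed
    then have "w = (\<lambda>j. (LINT x|M. \<phi> (T j x) * cnj (\<phi> x)) / of_real ((L2_norm M \<phi>)\<^sup>2))"
      using npos by (auto simp: L2_inner_def)
    also have "\<dots> \<in> borel_measurable borel" by measurable
    finally show ?thesis .
  qed
  then have "continuous_on UNIV w" using haar w1 hom by (intro measurable_character_continuous)
  then have "eigenfunction M T \<phi>"
    unfolding eigenfunction_def using \<phi> \<phi>nz w1 hom eig by blast
  \<comment> \<open>By idempotence and self-adjointness of P this inner product is the squared norm
    of P h.\<close>
  moreover have "L2_inner M \<phi> h \<noteq> 0"
  proof -
    have "L2_inner M \<phi> h = L2_inner M (kapp (kcomp P P) h) h"
    proof (rule L2_inner_cong_AE)
      show "AE x in M. \<phi> x = kapp (kcomp P P) h x"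
        using kapp_cong[OF kcomp_kernels[OF p p] p h PP] by eventually_elim (simp add: \<phi>_def)
      show "kapp (kcomp P P) h \<in> borel_measurable M" by (rule kapp_measurable[OF kcomp_kernels[OF p p] h])
    qed (use h in \<open>auto simp: L2_def\<close>)
    also have "\<dots> = L2_inner M \<phi> \<phi>"
      unfolding \<phi>_def by (simp add: kapp_kcomp_inner[OF p p h h] kapp_selfadjoint[OF Ps kapp_L2[OF p h] h])
    finally show ?thesis using npos by (simp add: L2_inner_self)
  qed
  ultimately show thesis by (rule that)
qed

end

section \<open>The mean ergodic dichotomy\<close>

context folner_mps
begin

text \<open>Closing under midpoints gives dyadic convex combinations of the orbit. Each property of
  the hull is then a two-case induction, without sums of weights.\<close>

inductive_set orbit_hull :: "('x \<times> 'x \<Rightarrow> complex) \<Rightarrow> ('x \<times> 'x \<Rightarrow> complex) set" for k where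
  shift: "kshift g k \<in> orbit_hull k"
| mid: "c \<in> orbit_hull k \<Longrightarrow> c' \<in> orbit_hull k \<Longrightarrow> (\<lambda>z. (c z + c' z) / 2) \<in> orbit_hull k"

lemma hull_kernels:
  assumes "c \<in> orbit_hull k" and k: "k \<in> kernels"
  shows "c \<in> kernels"
  using assms(1)
proof induction
  case (mid c c')
  then show ?case using kernels_scale[OF kernels_add, of c c' "1 / 2"] by simp
qed (rule kshift_kernels[OF k])

lemma hull_bound:
  assumes "c \<in> orbit_hull k" and B: "\<And>x y. x \<in> space M \<Longrightarrow> y \<in> space M \<Longrightarrow> cmod (k (x, y)) \<le> B"
    and xy: "x \<in> space M" "y \<in> space M"
  shows "cmod (c (x, y)) \<le> B"
  using assms(1)
proof induction
  case (mid c c')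
  have "cmod ((c (x, y) + c' (x, y)) / 2) \<le> (cmod (c (x, y)) + cmod (c' (x, y))) / 2"
    using norm_triangle_ineq[of "c (x, y)" "c' (x, y)"] by (simp add: norm_divide)
  moreover have "(cmod (c (x, y)) + cmod (c' (x, y))) / 2 \<le> B" using mid.IH by simp
  ultimately show ?case by (rule order_trans)
qed (simp add: kshift_def B T_space xy)

lemma hull_kadj:
  assumes "c \<in> orbit_hull k" "kadj k = k"
  shows "kadj c = c"
  using assms(1)
proof induction
  case (shift g)
  have "kadj (kshift g k) = kshift g (kadj k)" by (simp add: kadj_def kshift_def)
  then show ?case by (simp add: assms(2))
next
  case (mid c c')
  have "kadj (\<lambda>z. (c z + c' z) / 2) = (\<lambda>z. (kadj c z + kadj c' z) / 2)" by (simp add: kadj_def)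
  then show ?case by (simp add: mid.IH)
qed

text \<open>Only agreement on the space is claimed, because \<open>T\<close> is known to be an
  action only there.\<close>

lemma hull_kshift:
  assumes "c \<in> orbit_hull k"
  shows "\<exists>c'\<in>orbit_hull k. \<forall>z\<in>space (M \<Otimes>\<^sub>M M). c' z = kshift j c z"
  using assms
proof induction
  case (shift g)
  have "kshift (g + j) k z = kshift j (kshift g k) z" if "z \<in> space (M \<Otimes>\<^sub>M M)" for z
    using that by (auto simp: kshift_def T_add space_pair_measure)
  then show ?case by (intro bexI[of _ "kshift (g + j) k"]) (auto intro: orbit_hull.shift)
next
  case (mid c c')
  then obtain d d' where d: "d \<in> orbit_hull k" "\<forall>z\<in>space (M \<Otimes>\<^sub>M M). d z = kshift j c z"
    "d' \<in> orbit_hull k" "\<forall>z\<in>space (M \<Otimes>\<^sub>M M). d' z = kshift j c' z" by blast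
  then show ?case by (intro bexI[of _ "\<lambda>z. (d z + d' z) / 2"]) (auto intro: orbit_hull.mid simp: kshift_def)
qed

text \<open>Against an invariant kernel all translates of \<open>k\<close> have the same inner
  product, and midpoints preserve it. This is how the squared norm of the least element gets
  expressed through \<open>k\<close>.\<close>

lemma hull_kip:
  assumes "c \<in> orbit_hull k" and k: "k \<in> kernels" and L: "L \<in> inv_kernels"
  shows "kip L c = kip L k"
  using assms(1)
proof induction
  case (shift g)
  note l = inv_kernelsD[OF L]
  have "kip L (kshift g k) = kip (kshift g L) (kshift g k)"
    by (rule kip_cong[OF keq_sym[OF l(3)]]) (auto intro: k l kshift_kernels)
  then show ?case by (simp add: kip_kshift kernels_measurable k l)
next
  case (mid c c')
  have "kip L (\<lambda>z. (c z + c' z) / 2) = kip L (\<lambda>z. (1/2) * (c z + c' z))" by simp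
  also have "\<dots> = (kip L c + kip L c') / 2"
    by (simp only: L2_inner_scale_right L2_inner_add_right[OF kernels_L2[OF hull_kernels[OF mid.hyps(1) k]]
        kernels_L2[OF hull_kernels[OF mid.hyps(2) k]] kernels_L2[OF inv_kernelsD(1)[OF L]]]) simp
  finally show ?case by (simp add: mid.IH)
qed

text \<open>Midpoint convexity suffices for the parallelogram argument; uniqueness of the element of least
  norm makes it invariant.\<close>

lemma hull_min_element:
  assumes k: "k \<in> kernels" and herm: "kadj k = k"
  obtains K c where "K \<in> inv_kernels" "(knorm K)\<^sup>2 = Re (kip K k)" "\<And>n. c n \<in> orbit_hull k" "kconv c K"
proof -
  define d where "d = (INF c\<in>orbit_hull k. (knorm c)\<^sup>2)"
  have ne: "orbit_hull k \<noteq> {}" using orbit_hull.shift by blast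
  have bdd: "bdd_below ((\<lambda>L. (knorm L)\<^sup>2) ` orbit_hull k)" by (rule bdd_belowI[of _ 0]) auto
  have d: "d \<le> (knorm c)\<^sup>2" if "c \<in> orbit_hull k" for c unfolding d_def by (rule cINF_lower[OF bdd that])
  note hk = hull_kernels[OF _ k]
  \<comment> \<open>Parallelogram law: the midpoint lies in the hull, so its squared norm is at
    least \<open>d\<close>, and two almost minimal elements must be close.\<close>
  have par: "(knorm (\<lambda>z. c z - c' z))\<^sup>2 \<le> 2 * (knorm c)\<^sup>2 + 2 * (knorm c')\<^sup>2 - 4 * d"
    if c: "c \<in> orbit_hull k" "c' \<in> orbit_hull k" for c c'
  proof -
    note l2 = kernels_L2[OF hk[OF c(1)]] kernels_L2[OF hk[OF c(2)]]
    have "d \<le> (knorm (\<lambda>z. (c z + c' z) / 2))\<^sup>2" by (rule d[OF orbit_hull.mid[OF c]])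
    also have "knorm (\<lambda>z. (c z + c' z) / 2) = knorm (\<lambda>z. c z + c' z) / 2"
      using L2_norm_scale[of "M \<Otimes>\<^sub>M M" "1 / 2" "\<lambda>z. c z + c' z"] by simp
    finally have "4 * d \<le> (knorm (\<lambda>z. c z + c' z))\<^sup>2" by (simp add: power_divide)
    then show ?thesis
      using L2_norm_add_square[OF l2] L2_norm_diff_square[OF l2] by linarith
  qed
  have "\<exists>c\<in>orbit_hull k. (knorm c)\<^sup>2 < d + 1 / real (Suc n)" for n
    using cINF_less_iff[OF ne bdd, of "d + 1 / real (Suc n)"] unfolding d_def by auto
  then obtain c where c: "\<And>n. c n \<in> orbit_hull k" "\<And>n. (knorm (c n))\<^sup>2 < d + 1 / real (Suc n)" by metis
  have small: "(knorm (\<lambda>z. c n z - c' z))\<^sup>2 \<le> 4 / real (Suc N)"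
    if "n \<ge> N" "c' \<in> orbit_hull k" "(knorm c')\<^sup>2 < d + 1 / real (Suc N)" for n N c'
  proof -
    have "1 / real (Suc n) \<le> 1 / real (Suc N)" using that(1) by (simp add: frac_le)
    then show ?thesis using par[OF c(1) that(2), of n] c(2)[of n] that(3) by linarith
  qed
  have inv: "1 / real (Suc n) \<le> 1 / real (Suc N)" if "n \<ge> N" for n N using that by (simp add: frac_le)
  have cauchy: "\<exists>N. \<forall>m\<ge>N. \<forall>n\<ge>N. knorm (\<lambda>z. c m z - c n z) < e" if e: "e > 0" for e
  proof -
    obtain N where N: "1 / real (Suc N) < e\<^sup>2 / 4" using nat_approx_posE[of "e\<^sup>2 / 4"] e by auto
    have "knorm (\<lambda>z. c m z - c n z) < e" if "m \<ge> N" "n \<ge> N" for m n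
    proof -
      have "(knorm (\<lambda>z. c m z - c n z))\<^sup>2 \<le> 4 / real (Suc N)"
        using c(2)[of n] inv[OF that(2)] by (intro small[OF that(1) c(1)]) linarith
      then have lt: "(knorm (\<lambda>z. c m z - c n z))\<^sup>2 < e\<^sup>2" using N by simp
      show ?thesis by (rule power2_less_imp_less[OF lt]) (use e in simp)
    qed
    then show ?thesis by blast
  qed
  obtain B where B: "B \<ge> 0" "\<And>x y. x \<in> space M \<Longrightarrow> y \<in> space M \<Longrightarrow> cmod (k (x, y)) \<le> B"
    using kernels_bound[OF k] by blast
  obtain K where K: "K \<in> L2 (M \<Otimes>\<^sub>M M)" "(\<lambda>n. knorm (\<lambda>z. c n z - K z)) \<longlonglongrightarrow> 0"
    "\<And>z C. (\<And>n. cmod (c n z) \<le> C) \<Longrightarrow> cmod (K z) \<le> C"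
  proof (rule MM.L2_complete[of c, OF kernels_L2[OF hk[OF c(1)]] cauchy])
    fix v
    assume a: "v \<in> L2 (M \<Otimes>\<^sub>M M)" "(\<lambda>n. knorm (\<lambda>z. c n z - v z)) \<longlonglongrightarrow> 0"
      and b: "\<And>z C. (\<And>n. cmod (c n z) \<le> C) \<Longrightarrow> cmod (v z) \<le> C"
    show thesis by (rule that[OF a b])
  qed
  have Kk: "K \<in> kernels"
    using K(1) by (intro kernelsI[of _ B] K(3) hull_bound[OF c(1) B(2)]) (auto simp: L2_def)
  have cv: "kconv c K" using hk[OF c(1)] Kk K(2) by (simp add: kconv_def)
  have "kadj K \<doteq> K"
    by (rule kconv_unique[OF kconv_kadj[OF cv] cv]) (simp add: hull_kadj[OF c(1) herm])
  \<comment> \<open>The shifted sequence agrees with elements of the hull of the same norms. It is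
    thus minimising too, gets close to \<open>c\<close> and has the same limit.\<close>
  moreover have "kshift j K \<doteq> K" for j
  proof -
    have "\<exists>c'. c' \<in> orbit_hull k \<and> (\<forall>z\<in>space (M \<Otimes>\<^sub>M M). c' z = kshift j (c n) z)" for n
      using hull_kshift[OF c(1)] by blast
    then obtain c' where c': "\<And>n. c' n \<in> orbit_hull k" "\<And>n z. z \<in> space (M \<Otimes>\<^sub>M M) \<Longrightarrow> c' n z = kshift j (c n) z"
      by metis
    have c'_eq: "kshift j (c n) \<doteq> c' n" for n by (rule keqI) (simp add: c'(2))
    have "knorm (c' n) = knorm (c n)" for n
      using L2_norm_cong_AE[OF c'_eq[of n]] knorm_kshift[of "c n" j]
      by (simp add: kernels_measurable hk c(1) c'(1) kshift_kernels)
    then have sm: "(knorm (\<lambda>z. c n z - c' n z))\<^sup>2 \<le> 4 / real (Suc n)" for n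
      using small[of n n "c' n"] c'(1) c(2)[of n] by simp
    have "(\<lambda>n. (knorm (\<lambda>z. c n z - c' n z))\<^sup>2) \<longlonglongrightarrow> 0"
    proof (rule Lim_null_comparison)
      show "\<forall>\<^sub>F n in sequentially. norm ((knorm (\<lambda>z. c n z - c' n z))\<^sup>2) \<le> 4 * (1 / real (Suc n))"
        using sm by (simp add: always_eventually)
      show "(\<lambda>n. 4 * (1 / real (Suc n))) \<longlonglongrightarrow> 0"
        using tendsto_mult_right_zero[OF LIMSEQ_Suc[OF lim_1_over_n]] by simp
    qed
    from tendsto_real_sqrt[OF this] have l0: "(\<lambda>n. knorm (\<lambda>z. c n z - c' n z)) \<longlonglongrightarrow> 0"
      by (simp add: L2_norm_nonneg)
    have "kconv c' K"
    proof -
      have "norm (knorm (\<lambda>z. c' n z - K z)) \<le> knorm (\<lambda>z. c n z - c' n z) + knorm (\<lambda>z. c n z - K z)" for n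
        using L2_norm_triangle_diff[OF kernels_L2[OF hk[OF c'(1)]] kernels_L2[OF hk[OF c(1)]] K(1), of n n]
          L2_norm_minus_commute[of "M \<Otimes>\<^sub>M M" "c n" "c' n"] by (simp add: L2_norm_nonneg)
      moreover have l1: "(\<lambda>n. knorm (\<lambda>z. c n z - c' n z) + knorm (\<lambda>z. c n z - K z)) \<longlonglongrightarrow> 0"
        using tendsto_add[OF l0 K(2)] by simp
      ultimately have "(\<lambda>n. knorm (\<lambda>z. c' n z - K z)) \<longlonglongrightarrow> 0"
        by (rule Lim_null_comparison[OF always_eventually[OF allI]])
      then show ?thesis using hk[OF c'(1)] Kk by (simp add: kconv_def)
    qed
    then show ?thesis by (rule kconv_unique[OF kconv_kshift[OF cv] _ c'_eq])
  qed
  ultimately have Ks: "K \<in> inv_kernels" using Kk by (simp add: inv_kernels_def)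
  \<comment> \<open>Testing against the invariant \<open>K\<close> does not see the averaging, so
    this number is constant in \<open>n\<close> and equals its limit \<open>kip K K\<close>.\<close>
  have "kip (c n) K = cnj (kip K k)" for n
    using hull_kip[OF c(1) k Ks] L2_inner_commute[of _ "c n" K] by simp
  then have "(\<lambda>n. cnj (kip K k)) \<longlonglongrightarrow> kip K K"
    using L2_inner_tendsto[OF kernels_L2[OF hk[OF c(1)]] K(1,2) K(1)] by simp
  then have "cnj (kip K k) = kip K K" by (simp add: LIMSEQ_const_iff)
  then have "(knorm K)\<^sup>2 = Re (kip K k)"
    unfolding L2_inner_self by (metis Re_complex_of_real complex_cnj_cnj complex_cnj_complex_of_real)
  then show thesis using that Ks c(1) cv by metis
qed

text \<open>Translating the argument amounts to translating the Foelner set, so the difference is an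
  integral over the symmetric difference, with a bounded integrand.\<close>

lemma U_translate:
  fixes \<phi> :: "'g \<Rightarrow> complex"
  assumes [measurable]: "\<phi> \<in> borel_measurable borel" and B: "\<And>j. cmod (\<phi> j) \<le> B"
  shows "cmod ((LINT j|U n. \<phi> (g + j)) - (LINT j|U n. \<phi> j))
    \<le> B * (measure \<nu> (sym_diff ((+) g ` F n) (F n)) / measure \<nu> (F n))"
proof -
  note h = haar_measureD[OF haar]
  let ?G = "(+) g ` F n" and ?S = "sym_diff ((+) g ` F n) (F n)"
  have [measurable]: "F n \<in> sets borel" "?G \<in> sets borel"
    using folner_pos(1) translate_borel[OF folner_pos(1)] by auto
  have [measurable]: "(\<lambda>j. g + j) \<in> borel_measurable borel"
    by (intro borel_measurable_continuous_onI continuous_intros)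
  have dist: "distr \<nu> \<nu> (\<lambda>j. g + j) = \<nu>"
  proof (rule measure_eqI)
    fix A assume A: "A \<in> sets (distr \<nu> \<nu> (\<lambda>j. g + j))"
    have "(\<lambda>j. g + j) -` A = (+) (-g) ` A"
    proof (intro equalityI subsetI)
      fix x assume "x \<in> (\<lambda>j. g + j) -` A"
      then show "x \<in> (+) (-g) ` A" by (intro image_eqI[of _ _ "g + x"]) auto
    qed auto
    then show "emeasure (distr \<nu> \<nu> (\<lambda>j. g + j)) A = emeasure \<nu> A"
      using A h(3)[of A "-g"] by (simp add: emeasure_distr)
  qed simp
  have fG: "emeasure \<nu> ?G < \<infinity>" using h(3)[OF folner_pos(1)] folner_pos(3)[of n] by (simp add: less_top)
  have fF: "emeasure \<nu> (F n) < \<infinity>" using folner_pos(3)[of n] by (simp add: less_top)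
  have int: "integrable \<nu> (\<lambda>j. indicator A j *\<^sub>R \<phi> j)" if [measurable]: "A \<in> sets borel" and "emeasure \<nu> A < \<infinity>" for A
  proof (rule Bochner_Integration.integrable_bound)
    show "integrable \<nu> (\<lambda>j. B * indicator A j)" using that by (intro integrable_mult_right) (simp add: integrable_indicator_iff)
    show "AE j in \<nu>. norm (indicator A j *\<^sub>R \<phi> j) \<le> norm (B * indicator A j)"
      using B order_trans[OF norm_ge_zero B] by (intro AE_I2) (auto simp: indicator_def)
  qed measurable
  have fS: "emeasure \<nu> ?S < \<infinity>"
  proof -
    have "emeasure \<nu> ?S \<le> emeasure \<nu> (?G \<union> F n)" by (rule emeasure_mono) auto
    also have "\<dots> \<le> emeasure \<nu> ?G + emeasure \<nu> (F n)" by (rule emeasure_subadditive) auto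
    also have "\<dots> < \<infinity>" using fG fF by simp
    finally show ?thesis .
  qed
  have avg: "(LINT j|U n. \<psi> j) = (LINT j|\<nu>. indicator (F n) j *\<^sub>R \<psi> j) /\<^sub>R measure \<nu> (F n)"
    if "\<psi> \<in> borel_measurable borel" for \<psi> :: "'g \<Rightarrow> complex"
    using folner_avg_eq[OF that, of n] by (simp add: folner_avg_def set_lebesgue_integral_def)
  have "(LINT j|\<nu>. indicator (F n) j *\<^sub>R \<phi> (g + j)) = (LINT j|\<nu>. (\<lambda>j. indicator ?G j *\<^sub>R \<phi> j) (g + j))"
  proof (rule Bochner_Integration.integral_cong[OF refl])
    fix j
    have "g + j \<in> ?G \<longleftrightarrow> j \<in> F n" by auto
    then show "indicator (F n) j *\<^sub>R \<phi> (g + j) = indicator ?G (g + j) *\<^sub>R \<phi> (g + j)" by (simp add: indicator_def)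
  qed
  also have "\<dots> = (LINT j|distr \<nu> \<nu> (\<lambda>j. g + j). indicator ?G j *\<^sub>R \<phi> j)"
    by (rule integral_distr[symmetric]) measurable
  also have "\<dots> = (LINT j|\<nu>. indicator ?G j *\<^sub>R \<phi> j)" unfolding dist ..
  finally have "(LINT j|\<nu>. indicator (F n) j *\<^sub>R \<phi> (g + j)) - (LINT j|\<nu>. indicator (F n) j *\<^sub>R \<phi> j) =
      (LINT j|\<nu>. indicator ?G j *\<^sub>R \<phi> j - indicator (F n) j *\<^sub>R \<phi> j)"
    using int[OF _ fG] int[OF _ fF] by simp
  also have "cmod \<dots> \<le> (LINT j|\<nu>. norm (indicator ?G j *\<^sub>R \<phi> j - indicator (F n) j *\<^sub>R \<phi> j))"
    by (rule integral_norm_bound)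
  also have "\<dots> \<le> (LINT j|\<nu>. B * indicator ?S j)"
  proof (rule integral_mono')
    show "integrable \<nu> (\<lambda>j. B * indicator ?S j)"
      using fS by (intro integrable_mult_right) (simp add: integrable_indicator_iff)
    show "norm (indicator ?G j *\<^sub>R \<phi> j - indicator (F n) j *\<^sub>R \<phi> j) \<le> B * indicator ?S j" for j
      using B[of j] by (auto simp: indicator_def)
    show "0 \<le> B * indicator ?S j" for j
      using order_trans[OF norm_ge_zero B] by (simp add: indicator_def)
  qed
  also have "\<dots> = B * measure \<nu> ?S" by simp
  finally have *: "cmod ((LINT j|\<nu>. indicator (F n) j *\<^sub>R \<phi> (g + j)) - (LINT j|\<nu>. indicator (F n) j *\<^sub>R \<phi> j))
      \<le> B * measure \<nu> ?S" .
  have "(LINT j|U n. \<phi> (g + j)) - (LINT j|U n. \<phi> j) =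
      ((LINT j|\<nu>. indicator (F n) j *\<^sub>R \<phi> (g + j)) - (LINT j|\<nu>. indicator (F n) j *\<^sub>R \<phi> j)) /\<^sub>R measure \<nu> (F n)"
    by (simp add: avg scaleR_diff_right)
  then show ?thesis
    using * measure_folner_pos[of n] by (simp add: divide_simps mult.commute)
qed

definition kmean :: "nat \<Rightarrow> ('x \<times> 'x \<Rightarrow> complex) \<Rightarrow> 'x \<times> 'x \<Rightarrow> complex" where
  "kmean n K = (\<lambda>z. LINT j|U n. K (T j (fst z), T j (snd z)))"

text \<open>The Foelner property makes the averages of \<open>k\<close> and of its translates
  asymptotically equal, uniformly in the pair of points; midpoints keep this. It replaces a
  pointwise theorem on the square.\<close>

lemma hull_kmean:
  assumes "c \<in> orbit_hull k" and k: "k \<in> kernels"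
  shows "\<exists>\<delta>. \<delta> \<longlonglongrightarrow> 0 \<and> (\<forall>n. \<forall>z\<in>space (M \<Otimes>\<^sub>M M). cmod (kmean n k z - kmean n c z) \<le> \<delta> n)"
proof -
  obtain B where B: "B \<ge> 0" "\<And>x y. x \<in> space M \<Longrightarrow> y \<in> space M \<Longrightarrow> cmod (k (x, y)) \<le> B"
    using kernels_bound[OF k] by blast
  have orb: "(\<lambda>j. c (T j (fst z), T j (snd z))) \<in> borel_measurable borel"
    if "c \<in> kernels" "z \<in> space (M \<Otimes>\<^sub>M M)" for c z
  proof -
    note [measurable] = kernels_measurable[OF that(1)]
    have [simp]: "fst z \<in> space M" "snd z \<in> space M" using that(2) by (auto simp: space_pair_measure)
    show ?thesis by measurable
  qed
  show ?thesis
    using assms(1)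
  proof induction
    case (shift g)
    let ?\<delta> = "\<lambda>n. B * (measure \<nu> (sym_diff ((+) g ` F n) (F n)) / measure \<nu> (F n))"
    have "?\<delta> \<longlonglongrightarrow> 0"
      using folner unfolding folner_seq_def by (intro tendsto_mult_right_zero) blast
    moreover have "cmod (kmean n k z - kmean n (kshift g k) z) \<le> ?\<delta> n" if z: "z \<in> space (M \<Otimes>\<^sub>M M)" for n z
    proof -
      have sp: "fst z \<in> space M" "snd z \<in> space M" using z by (auto simp: space_pair_measure)
      have "kmean n (kshift g k) z = (LINT j|U n. (\<lambda>j. k (T j (fst z), T j (snd z))) (g + j))"
        by (simp add: kmean_def kshift_def T_add sp)
      then show ?thesis
        using U_translate[OF orb[OF k z], of B n g] B(2) T_space sp
        by (simp add: kmean_def norm_minus_commute)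
    qed
    ultimately show ?case by blast
  next
    case (mid c c')
    then obtain \<delta> \<delta>' where \<delta>: "\<delta> \<longlonglongrightarrow> 0" "\<And>n z. z \<in> space (M \<Otimes>\<^sub>M M) \<Longrightarrow> cmod (kmean n k z - kmean n c z) \<le> \<delta> n"
      "\<delta>' \<longlonglongrightarrow> 0" "\<And>n z. z \<in> space (M \<Otimes>\<^sub>M M) \<Longrightarrow> cmod (kmean n k z - kmean n c' z) \<le> \<delta>' n" by blast
    have "(\<lambda>n. (\<delta> n + \<delta>' n) / 2) \<longlonglongrightarrow> (0 + 0) / 2" by (intro tendsto_divide tendsto_add \<delta> tendsto_const) simp
    moreover have "cmod (kmean n k z - kmean n (\<lambda>z. (c z + c' z) / 2) z) \<le> (\<delta> n + \<delta>' n) / 2"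
      if z: "z \<in> space (M \<Otimes>\<^sub>M M)" for n z
    proof -
      interpret Un: prob_space "U n" by (rule prob_space_U)
      have int: "integrable (U n) (\<lambda>j. e (T j (fst z), T j (snd z)))" if e: "e \<in> orbit_hull k" for e
        using orb[OF hull_kernels[OF e k] z] hull_bound[OF e B(2)] T_space z
        by (intro Un.integrable_const_bound[of _ B]) (auto simp: space_pair_measure)
      have "kmean n (\<lambda>z. (c z + c' z) / 2) z = (kmean n c z + kmean n c' z) / 2"
        using int[OF mid.hyps(1)] int[OF mid.hyps(2)] by (simp add: kmean_def)
      then have "kmean n k z - kmean n (\<lambda>z. (c z + c' z) / 2) z =
          ((kmean n k z - kmean n c z) + (kmean n k z - kmean n c' z)) / 2" by (simp add: field_simps)
      also have "cmod \<dots> \<le> (cmod (kmean n k z - kmean n c z) + cmod (kmean n k z - kmean n c' z)) / 2"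
        unfolding norm_divide norm_numeral by (intro divide_right_mono norm_triangle_ineq) simp
      also have "\<dots> \<le> (\<delta> n + \<delta>' n) / 2" using \<delta>(2,4)[OF z] by (intro divide_right_mono add_mono) auto
      finally show ?thesis .
    qed
    ultimately show ?case by (intro exI[of _ "\<lambda>n. (\<delta> n + \<delta>' n) / 2"]) simp
  qed
qed

lemma kmean_L2:
  assumes "K \<in> L2 (M \<Otimes>\<^sub>M M)"
  shows "kmean n K \<in> L2 (M \<Otimes>\<^sub>M M)" "knorm (kmean n K) \<le> knorm K"
proof -
  interpret P: folner_mps \<nu> F "M \<Otimes>\<^sub>M M" "\<lambda>j (x, y). (T j x, T j y)" by (rule prod_folner_mps)
  have "kmean n K = P.mean n K"
    by (rule ext) (unfold kmean_def P.mean_def, simp add: case_prod_beta')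
  then show "kmean n K \<in> L2 (M \<Otimes>\<^sub>M M)" "knorm (kmean n K) \<le> knorm K"
    using P.mean_L2[OF assms, of n] by simp_all
qed

text \<open>Linearity holds only almost everywhere: for a null set of pairs the functions along the
  orbit may fail to be integrable, and then the integral is 0 by convention.\<close>

lemma kmean_diff:
  assumes K: "K \<in> L2 (M \<Otimes>\<^sub>M M)" and L: "L \<in> L2 (M \<Otimes>\<^sub>M M)"
  shows "kmean n (\<lambda>z. K z - L z) \<doteq> (\<lambda>z. kmean n K z - kmean n L z)"
proof -
  interpret P: folner_mps \<nu> F "M \<Otimes>\<^sub>M M" "\<lambda>j (x, y). (T j x, T j y)" by (rule prod_folner_mps)
  show ?thesis
    using P.AE_integrable_orbit[OF MM.L2_integrable[OF K]] P.AE_integrable_orbit[OF MM.L2_integrable[OF L]]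
    by eventually_elim (simp add: kmean_def case_prod_beta')
qed

lemma tensor_kernels:
  assumes f: "f \<in> borel_measurable M" and B: "\<And>x. x \<in> space M \<Longrightarrow> cmod (f x) \<le> B"
  shows "tensor f f \<in> kernels"
proof (rule kernelsI)
  show "tensor f f \<in> borel_measurable (M \<Otimes>\<^sub>M M)" unfolding tensor_def using f by measurable
  show "cmod (tensor f f (x, y)) \<le> B * B" if "x \<in> space M" "y \<in> space M" for x y
    using B[OF that(1)] B[OF that(2)] order_trans[OF norm_ge_zero B[OF that(1)]]
    by (auto simp: tensor_def norm_mult intro: mult_mono)
qed

lemma L2_truncation_tendsto:
  assumes h: "h \<in> L2 M"
  shows "(\<lambda>N. L2_norm M (\<lambda>x. h x - (if cmod (h x) \<le> real N then h x else 0))) \<longlonglongrightarrow> 0"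
proof -
  have [measurable]: "h \<in> borel_measurable M" using h by (simp add: L2_def)
  let ?u = "\<lambda>N x. (cmod (h x - (if cmod (h x) \<le> real N then h x else 0)))\<^sup>2"
  have "(\<lambda>N. LINT x|M. ?u N x) \<longlonglongrightarrow> (LINT x|M. 0)"
  proof (rule integral_dominated_convergence)
    show "integrable M (\<lambda>x. (cmod (h x))\<^sup>2)" using h by (rule L2_square_integrable)
    show "AE x in M. (\<lambda>N. ?u N x) \<longlonglongrightarrow> 0"
    proof (rule AE_I2)
      fix x
      obtain N0 :: nat where "cmod (h x) \<le> real N0" using real_arch_simple by blast
      then have "?u N x = 0" if "N \<ge> N0" for N using that by simp
      then have "\<forall>\<^sub>F N in sequentially. ?u N x = 0"
        unfolding eventually_sequentially by blast
      then show "(\<lambda>N. ?u N x) \<longlonglongrightarrow> 0" by (rule tendsto_eventually)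
    qed
    show "AE x in M. norm (?u N x) \<le> (cmod (h x))\<^sup>2" for N by (intro AE_I2) simp
  qed measurable
  from tendsto_real_sqrt[OF this] show ?thesis by (simp add: L2_norm_def)
qed

lemma tensor_diff_norm:
  assumes f: "f \<in> L2 M" and h: "h \<in> L2 M"
  shows "knorm (\<lambda>z. tensor h h z - tensor f f z) \<le> L2_norm M (\<lambda>x. h x - f x) * (L2_norm M h + L2_norm M f)"
proof -
  let ?d = "\<lambda>x. h x - f x"
  have d: "?d \<in> L2 M" by (rule L2_diff[OF h f])
  have "(\<lambda>z. tensor h h z - tensor f f z) = (\<lambda>z. tensor ?d h z + tensor f ?d z)"
    by (simp add: tensor_def fun_eq_iff algebra_simps)
  then show ?thesis
    using L2_norm_triangle[OF tensor_L2(1)[OF d h] tensor_L2(1)[OF f d]]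
    by (simp add: tensor_L2(2)[OF d h] tensor_L2(2)[OF f d] algebra_simps)
qed

text \<open>\<open>tensor h h\<close> may be unbounded, so the least element \<open>K\<close> is
  built for a truncation \<open>f\<close>. As \<open>K\<close> is orthogonal to
  \<open>tensor h h\<close>, its norm is at most the truncation error. The three errors
  \<open>e\<close> are the passage from \<open>h\<close> to \<open>f\<close>, the passage from the
  kernel to an element \<open>q\<close> of its hull, and the norm of \<open>q\<close>.\<close>

lemma kmean_tensor_small:
  assumes h: "h \<in> L2 M" and orth: "\<And>K. K \<in> inv_kernels \<Longrightarrow> L2_inner M (kapp K h) h = 0"
    and f: "f \<in> borel_measurable M" "\<And>x. x \<in> space M \<Longrightarrow> cmod (f x) \<le> B"
    and close: "knorm (\<lambda>z. tensor h h z - tensor f f z) < e"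
  shows "\<forall>\<^sub>F n in sequentially. knorm (kmean n (tensor h h)) < 3 * e"
proof -
  let ?k = "tensor f f" and ?h = "tensor h h"
  have f2: "f \<in> L2 M" by (rule L2_bounded[OF f])
  have k: "?k \<in> kernels" by (rule tensor_kernels[OF f])
  note kL = kernels_L2[OF k] and hL = tensor_L2(1)[OF h h]
  have e: "e > 0" using close L2_norm_nonneg[of "M \<Otimes>\<^sub>M M"] by (meson le_less_trans)
  have herm: "kadj ?k = ?k" by (simp add: kadj_def tensor_def fun_eq_iff mult.commute)
  obtain K c where K: "K \<in> inv_kernels" "(knorm K)\<^sup>2 = Re (kip K ?k)" and c: "\<And>n. c n \<in> orbit_hull ?k" "kconv c K"
  proof (rule hull_min_element[OF k herm])
    fix K c
    assume a: "K \<in> inv_kernels" "(knorm K)\<^sup>2 = Re (kip K ?k)" and b: "\<And>n. c n \<in> orbit_hull ?k" and c: "kconv c K"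
    show thesis by (rule that[OF a b c])
  qed
  have Kk: "K \<in> kernels" by (rule inv_kernelsD(1)[OF K(1)])
  have "knorm K < e"
  proof -
    have "kip K ?h = 0" using orth[OF K(1)] by (simp add: kapp_inner[OF Kk h h])
    then have "(knorm K)\<^sup>2 = - Re (kip K (\<lambda>z. ?h z - ?k z))"
      using K(2) L2_inner_diff_right[OF hL kL kernels_L2[OF Kk]] by simp
    also have "\<dots> \<le> cmod (kip K (\<lambda>z. ?h z - ?k z))" using abs_Re_le_cmod by (smt (verit))
    also have "\<dots> \<le> knorm K * knorm (\<lambda>z. ?h z - ?k z)"
      by (rule L2_Cauchy_Schwarz[OF kernels_L2[OF Kk] L2_diff[OF hL kL]])
    finally have "knorm K * knorm K \<le> knorm K * knorm (\<lambda>z. ?h z - ?k z)" by (simp add: power2_eq_square)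
    then have "knorm K = 0 \<or> knorm K \<le> knorm (\<lambda>z. ?h z - ?k z)"
      using L2_norm_nonneg[of "M \<Otimes>\<^sub>M M" K] by (auto simp: mult_le_cancel_left)
    then show ?thesis using close e by auto
  qed
  moreover have "(\<lambda>n. knorm (c n)) \<longlonglongrightarrow> knorm K"
    using c(2) by (intro L2_norm_tendsto) (auto simp: kconv_def intro: kernels_L2)
  ultimately have "\<forall>\<^sub>F n in sequentially. knorm (c n) < e" by (rule order_tendstoD(2)[rotated])
  then obtain m where m: "knorm (c m) < e" by (auto simp: eventually_sequentially)
  define q where "q = c m"
  have q: "q \<in> orbit_hull ?k" "knorm q < e" using c(1) m by (simp_all add: q_def)
  have qL: "q \<in> L2 (M \<Otimes>\<^sub>M M)" by (rule kernels_L2[OF hull_kernels[OF q(1) k]])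
  obtain \<delta> where \<delta>: "\<delta> \<longlonglongrightarrow> 0" "\<And>n z. z \<in> space (M \<Otimes>\<^sub>M M) \<Longrightarrow> cmod (kmean n ?k z - kmean n q z) \<le> \<delta> n"
    using hull_kmean[OF q(1) k] by blast
  have "\<forall>\<^sub>F n in sequentially. \<delta> n < e" using order_tendstoD(2)[OF \<delta>(1) e] .
  then show ?thesis
  proof eventually_elim
    case (elim n)
    note mL = kmean_L2(1)[OF hL, of n] kmean_L2(1)[OF kL, of n] kmean_L2(1)[OF qL, of n]
    have "knorm (\<lambda>z. kmean n ?h z - kmean n ?k z) = knorm (kmean n (\<lambda>z. ?h z - ?k z))"
      using L2_diff[OF mL(1,2)] kmean_L2(1)[OF L2_diff[OF hL kL]]
      by (intro L2_norm_cong_AE[OF keq_sym[OF kmean_diff[OF hL kL]]]) (auto simp: L2_def)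
    also have "\<dots> < e" using kmean_L2(2)[OF L2_diff[OF hL kL], of n] close by linarith
    finally have 1: "knorm (\<lambda>z. kmean n ?h z - kmean n ?k z) < e" .
    have "(knorm (\<lambda>z. kmean n ?k z - kmean n q z))\<^sup>2 \<le> (LINT z|(M \<Otimes>\<^sub>M M). (\<delta> n)\<^sup>2)"
      unfolding L2_norm_square by (intro integral_mono' power_mono \<delta>(2)) auto
    also have "\<dots> = (\<delta> n)\<^sup>2" by (simp add: MM.prob_space)
    also have "\<dots> \<le> e\<^sup>2"
    proof -
      obtain z where "z \<in> space (M \<Otimes>\<^sub>M M)" using MM.not_empty by blast
      then have "0 \<le> \<delta> n" using \<delta>(2)[of z n] norm_ge_zero order_trans by blast
      then show ?thesis using elim by (intro power_mono) auto
    qed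
    finally have 2: "knorm (\<lambda>z. kmean n ?k z - kmean n q z) \<le> e"
      by (rule power2_le_imp_le) (use e in simp)
    have 3: "knorm (kmean n q) < e" using kmean_L2(2)[OF qL, of n] q(2) by linarith
    have "knorm (kmean n ?h) \<le> knorm (\<lambda>z. kmean n ?h z - kmean n ?k z) + knorm (kmean n ?k)"
      using L2_norm_triangle[OF L2_diff[OF mL(1,2)] mL(2)] by simp
    moreover have "knorm (kmean n ?k) \<le> knorm (\<lambda>z. kmean n ?k z - kmean n q z) + knorm (kmean n q)"
      using L2_norm_triangle[OF L2_diff[OF mL(2,3)] mL(3)] by simp
    ultimately show ?case using 1 2 3 by linarith
  qed
qed

lemma kmean_tensor_tendsto_0:
  assumes h: "h \<in> L2 M" and orth: "\<And>K. K \<in> inv_kernels \<Longrightarrow> L2_inner M (kapp K h) h = 0"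
  shows "(\<lambda>n. knorm (kmean n (tensor h h))) \<longlonglongrightarrow> 0"
proof (rule order_tendstoI)
  fix e :: real assume "e > 0"
  define f where "f N x = (if cmod (h x) \<le> real N then h x else 0)" for N x
  have [measurable]: "h \<in> borel_measurable M" using h by (simp add: L2_def)
  have fm: "f N \<in> borel_measurable M" for N unfolding f_def[abs_def] by measurable
  have fb: "cmod (f N x) \<le> real N" for N x by (simp add: f_def)
  have f2: "f N \<in> L2 M" for N by (rule L2_bounded[OF fm fb])
  have l0: "(\<lambda>N. L2_norm M (\<lambda>x. h x - f N x)) \<longlonglongrightarrow> 0"
    unfolding f_def by (rule L2_truncation_tendsto[OF h])
  have "(\<lambda>N. L2_norm M (f N)) \<longlonglongrightarrow> L2_norm M h"
    using l0 by (intro L2_norm_tendsto f2 h) (simp add: L2_norm_minus_commute[of M h])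
  then have "(\<lambda>N. L2_norm M (\<lambda>x. h x - f N x) * (L2_norm M h + L2_norm M (f N))) \<longlonglongrightarrow> 0 * (L2_norm M h + L2_norm M h)"
    by (intro tendsto_mult tendsto_add l0 tendsto_const)
  then have "(\<lambda>N. L2_norm M (\<lambda>x. h x - f N x) * (L2_norm M h + L2_norm M (f N))) \<longlonglongrightarrow> 0" by simp
  from order_tendstoD(2)[OF this, of "e / 3"] \<open>e > 0\<close>
  obtain N where "L2_norm M (\<lambda>x. h x - f N x) * (L2_norm M h + L2_norm M (f N)) < e / 3"
    by (auto simp: eventually_sequentially)
  then have "knorm (\<lambda>z. tensor h h z - tensor (f N) (f N) z) < e / 3"
    using tensor_diff_norm[OF f2 h, of N] by linarith
  from kmean_tensor_small[OF h orth fm fb this]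
  show "\<forall>\<^sub>F n in sequentially. knorm (kmean n (tensor h h)) < e" by simp
next
  fix a :: real assume "a < 0"
  then show "\<forall>\<^sub>F n in sequentially. a < knorm (kmean n (tensor h h))"
    using L2_norm_nonneg[of "M \<Otimes>\<^sub>M M"] by (intro always_eventually allI) (rule less_le_trans)
qed

end

section \<open>From vanishing averages on the square to sensitivity\<close>

context ergodic_folner_mps
begin

text \<open>Expanding |h(x) - h(y)|^2 along the orbits, the two square terms converge at generic
  points and the cross term is \<open>kmean\<close> of \<open>tensor h h\<close>. Its L2 convergence
  gives a.e. convergence only along a subsequence, which suffices to bound the limsup from
  below.\<close>

lemma mean_sensitive_of_kmean:
  assumes h: "h \<in> L2 M" and nz: "L2_norm M h > 0" and lim: "(\<lambda>n. knorm (kmean n (tensor h h))) \<longlonglongrightarrow> 0"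
  shows "mean_sensitive \<nu> F M T h"
proof -
  define c where "c = L2_norm M h"
  have c: "c > 0" using nz by (simp add: c_def)
  have [measurable]: "h \<in> borel_measurable M" using h by (simp add: L2_def)
  let ?q = "\<lambda>x. (cmod (h x))\<^sup>2"
  have q: "integrable M ?q" by (rule L2_square_integrable[OF h])
  note mL = kmean_L2(1)[OF tensor_L2(1)[OF h h]]
  have "(\<lambda>n. LINT z|(M \<Otimes>\<^sub>M M). norm (kmean n (tensor h h) z)) \<longlonglongrightarrow> 0"
  proof (rule Lim_null_comparison[OF _ lim])
    show "\<forall>\<^sub>F n in sequentially. norm (LINT z|(M \<Otimes>\<^sub>M M). norm (kmean n (tensor h h) z)) \<le> knorm (kmean n (tensor h h))"
      using MM.L2_integral_norm_le[OF mL] by (simp add: MM.prob_space)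
  qed
  from tendsto_L1_AE_subseq[OF MM.L2_integrable[OF mL] this]
  obtain r :: "nat \<Rightarrow> nat" where r: "strict_mono r"
    "AE z in M \<Otimes>\<^sub>M M. (\<lambda>n. kmean (r n) (tensor h h) z) \<longlonglongrightarrow> 0" by blast
  have gen: "AE x in M. generic_point \<nu> F M T ?q x" by (rule AE_generic_real[OF q])
  have "AE z in M \<Otimes>\<^sub>M M. mean_dist \<nu> F T h (fst z) (snd z) > ereal c"
    using r(2) AE_fst[OF gen] AE_snd[OF gen] AE_space
  proof eventually_elim
    case (elim z)
    define x y where "x = fst z" and "y = snd z"
    have sp: "x \<in> space M" "y \<in> space M" using elim(4) by (auto simp: x_def y_def space_pair_measure)
    note [measurable] = orbit_measurable[OF sp(1)] orbit_measurable[OF sp(2)]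
    have gen': "generic_point \<nu> F M T ?q x" "generic_point \<nu> F M T ?q y"
      using elim(2,3) by (simp_all add: x_def y_def)
    have int: "\<And>n. integrable (U n) (\<lambda>j. ?q (T j x))" "\<And>n. integrable (U n) (\<lambda>j. ?q (T j y))"
      and av: "(\<lambda>n. LINT j|U n. ?q (T j x)) \<longlonglongrightarrow> c\<^sup>2" "(\<lambda>n. LINT j|U n. ?q (T j y)) \<longlonglongrightarrow> c\<^sup>2"
      using gen' by (simp_all add: generic_point_def set_integrable_eq folner_avg_eq c_def L2_norm_square)
    have L2: "(\<lambda>j. h (T j x)) \<in> L2 (U n)" "(\<lambda>j. h (T j y)) \<in> L2 (U n)" for n
      using int by (simp_all add: L2_def)
    let ?D = "\<lambda>n. folner_avg \<nu> (F n) (\<lambda>j. (cmod (h (T j x) - h (T j y)))\<^sup>2)"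
    have D: "?D n = (LINT j|U n. ?q (T j x)) + (LINT j|U n. ?q (T j y)) - 2 * Re (kmean n (tensor h h) z)" for n
    proof -
      have "?D n = (LINT j|U n. (cmod (h (T j x) - h (T j y)))\<^sup>2)" by (rule folner_avg_eq) measurable
      also have "\<dots> = (L2_norm (U n) (\<lambda>j. h (T j x)))\<^sup>2 - 2 * Re (L2_inner (U n) (\<lambda>j. h (T j x)) (\<lambda>j. h (T j y)))
          + (L2_norm (U n) (\<lambda>j. h (T j y)))\<^sup>2"
        using L2_norm_diff_square[OF L2] by (simp add: L2_norm_square)
      also have "L2_inner (U n) (\<lambda>j. h (T j x)) (\<lambda>j. h (T j y)) = kmean n (tensor h h) z"
        by (simp add: L2_inner_def kmean_def tensor_def x_def y_def)
      finally show ?thesis by (simp add: L2_norm_square)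
    qed
    have "(\<lambda>n. ?D (r n)) \<longlonglongrightarrow> c\<^sup>2 + c\<^sup>2 - 2 * Re 0"
      unfolding D using LIMSEQ_subseq_LIMSEQ[OF av(1) r(1)] LIMSEQ_subseq_LIMSEQ[OF av(2) r(1)] elim(1)
      by (intro tendsto_diff tendsto_add tendsto_mult tendsto_const tendsto_Re) (simp_all add: o_def)
    then have "(\<lambda>n. ereal (sqrt (?D (r n)))) \<longlonglongrightarrow> ereal (sqrt (2 * c\<^sup>2))"
      by (intro tendsto_ereal tendsto_real_sqrt) simp
    then have "limsup ((\<lambda>n. ereal (sqrt (?D n))) \<circ> r) = ereal (sqrt (2 * c\<^sup>2))"
      by (intro lim_imp_Limsup) (simp_all add: o_def)
    then have "ereal (sqrt (2 * c\<^sup>2)) \<le> mean_dist \<nu> F T h x y"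
      unfolding mean_dist_def using limsup_subseq_mono[OF r(1), of "\<lambda>n. ereal (sqrt (?D n))"] by simp
    moreover have "c < sqrt (2 * c\<^sup>2)" using c by (intro real_less_rsqrt) simp
    ultimately show ?case by (auto simp: x_def y_def intro: less_le_trans[of _ "ereal (sqrt (2 * c\<^sup>2))"])
  qed
  then show ?thesis by (rule mean_sensitiveI[OF h c])
qed

lemma eigenfunction_exists:
  assumes h: "h \<in> L2 M" and nz: "L2_norm M h > 0" and ns: "\<not> mean_sensitive \<nu> F M T h"
  obtains \<phi> where "eigenfunction M T \<phi>" "L2_inner M \<phi> h \<noteq> 0"
proof -
  have "\<exists>K\<in>inv_kernels. L2_inner M (kapp K h) h \<noteq> 0"
    using mean_sensitive_of_kmean[OF h nz kmean_tensor_tendsto_0[OF h]] ns by blast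
  then show thesis using eigenfunction_of_kernel[OF h] that by metis
qed

text \<open>Ergodicity speaks of strictly invariant sets, whereas \<open>u\<close> is invariant only
  up to a null set for each \<open>j\<close>. The pointwise theorem bridges this: at almost every
  \<open>x\<close> the averages of \<open>u\<close> equal \<open>u x\<close> and converge to the
  integral.\<close>

lemma invariant_const:
  fixes u :: "_ \<Rightarrow> complex"
  assumes u: "integrable M u" and inv: "\<And>j. AE x in M. u (T j x) = u x"
  shows "AE x in M. u x = (LINT x|M. u x)"
proof -
  have [measurable]: "u \<in> borel_measurable M" using u by simp
  have [measurable]: "(\<lambda>z. T (fst z) (snd z)) \<in> borel \<Otimes>\<^sub>M M \<rightarrow>\<^sub>M M" by (rule T_joint_measurable)
  have "AE x in M. \<forall>n. AE j in U n. u (T j x) = u x"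
    by (rule AE_orbit[OF _ inv]) measurable
  then show ?thesis
    using AE_generic[OF u] AE_space
  proof eventually_elim
    case (elim x)
    note [measurable] = orbit_measurable[OF elim(3)]
    have "folner_avg \<nu> (F n) (\<lambda>j. u (T j x)) = u x" for n
    proof -
      interpret Un: prob_space "U n" by (rule prob_space_U)
      have "folner_avg \<nu> (F n) (\<lambda>j. u (T j x)) = (LINT j|U n. u (T j x))" by (rule folner_avg_eq) measurable
      also have "\<dots> = (LINT j|U n. u x)" using elim(1) by (intro integral_cong_AE) auto
      finally show ?thesis by (simp add: Un.prob_space[simplified])
    qed
    then show ?case using elim(2) by (simp add: generic_point_def LIMSEQ_const_iff)
  qed
qed

section \<open>Simplicity of eigenvalues and a basis of eigenfunctions\<close>

definition eigen :: "('a \<Rightarrow> complex) \<Rightarrow> ('b \<Rightarrow> complex) \<Rightarrow> bool" where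
  "eigen w f \<longleftrightarrow> f \<in> L2 M \<and> L2_norm M f = 1 \<and> (\<forall>j. AE x in M. f (T j x) = w j * f x)"

definition characters :: "('a \<Rightarrow> complex) set" where
  "characters = {w. continuous_on UNIV w \<and> (\<forall>j. cmod (w j) = 1) \<and> (\<forall>i j. w (i + j) = w i * w j) \<and> (\<exists>f. eigen w f)}"

text \<open>One normalised eigenfunction is picked for each eigenvalue. By ergodicity eigenvalues
  are simple, so nothing is lost.\<close>

definition eigenbasis :: "('b \<Rightarrow> complex) set" where
  "eigenbasis = (\<lambda>w. SOME f. eigen w f) ` characters"

lemma eigen_some: "w \<in> characters \<Longrightarrow> eigen w (SOME f. eigen w f)"
  unfolding characters_def using someI_ex[of "eigen w"] by blast

lemma eigenD:
  assumes "eigen w f"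
  shows "f \<in> L2 M" "L2_norm M f = 1" "AE x in M. f (T j x) = w j * f x" "f \<in> borel_measurable M"
  using assms by (auto simp: eigen_def L2_def)

lemma eigenbasis_eigenfunction:
  assumes "b \<in> eigenbasis"
  shows "eigenfunction M T b"
proof -
  obtain w where w: "w \<in> characters" "b = (SOME f. eigen w f)" using assms by (auto simp: eigenbasis_def)
  then have e: "eigen w b" using eigen_some by simp
  have "\<not> (AE x in M. b x = 0)" using L2_norm_eq_0_iff[OF eigenD(1)[OF e]] eigenD(2)[OF e] by simp
  then show ?thesis
    unfolding eigenfunction_def using w(1) eigenD(1,3)[OF e] by (auto simp: characters_def)
qed

lemma eigen_orthogonal:
  assumes w: "w \<in> characters" "w' \<in> characters" "w \<noteq> w'" and f: "eigen w f" and g: "eigen w' g"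
  shows "L2_inner M f g = 0"
proof -
  obtain j where j: "w j \<noteq> w' j" using w(3) by auto
  have w1: "cmod (w' j) = 1" using w(2) by (simp add: characters_def)
  note [measurable] = eigenD(4)[OF f] eigenD(4)[OF g]
  have "L2_inner M f g = L2_inner M (\<lambda>x. f (T j x)) (\<lambda>x. g (T j x))"
    by (rule L2_inner_T[symmetric]) (rule eigenD(4)[OF f] eigenD(4)[OF g])+
  also have "\<dots> = L2_inner M (\<lambda>x. w j * f x) (\<lambda>x. w' j * g x)"
    by (rule L2_inner_cong_AE[OF eigenD(3)[OF f] eigenD(3)[OF g]]) measurable
  also have "\<dots> = w j * cnj (w' j) * L2_inner M f g" by (simp add: L2_inner_scale_left L2_inner_scale_right)
  finally have "(w j * cnj (w' j) - 1) * L2_inner M f g = 0" by (simp add: left_diff_distrib)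
  moreover have "w j * cnj (w' j) \<noteq> 1"
  proof
    assume "w j * cnj (w' j) = 1"
    then have "w j * (cnj (w' j) * w' j) = w' j" by (simp flip: mult.assoc)
    moreover have "cnj (w' j) * w' j = 1" using complex_norm_square[of "w' j"] w1 by (simp add: mult.commute)
    ultimately show False using j by simp
  qed
  ultimately show ?thesis by simp
qed

text \<open>The product of \<open>g\<close> with the conjugate of \<open>f\<close> is invariant,
  hence constant, and so is |f|^2, which the normalisation makes 1; multiplying by \<open>f\<close>
  isolates \<open>g\<close>.\<close>

lemma eigen_simple:
  assumes w1: "\<And>j. cmod (w j) = 1" and f: "eigen w f" and g: "g \<in> L2 M" "\<And>j. AE x in M. g (T j x) = w j * g x"
  shows "AE x in M. g x = L2_inner M g f * f x"
proof -
  have ww: "w j * cnj (w j) = 1" for j using complex_norm_square[of "w j"] w1[of j] by simp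
  have mult: "w j * a * cnj (w j * b) = a * cnj b" for j a b
  proof -
    have "w j * a * cnj (w j * b) = (w j * cnj (w j)) * (a * cnj b)" by (simp add: mult_ac)
    then show ?thesis by (simp add: ww)
  qed
  have 1: "AE x in M. g x * cnj (f x) = L2_inner M g f"
    unfolding L2_inner_def
  proof (rule invariant_const[OF L2_mult_cnj_integrable[OF g(1) eigenD(1)[OF f]]])
    show "AE x in M. g (T j x) * cnj (f (T j x)) = g x * cnj (f x)" for j
      using g(2)[of j] eigenD(3)[OF f, of j] by eventually_elim (simp only: mult)
  qed
  have "AE x in M. f x * cnj (f x) = L2_inner M f f"
    unfolding L2_inner_def
  proof (rule invariant_const[OF L2_mult_cnj_integrable[OF eigenD(1)[OF f] eigenD(1)[OF f]]])
    show "AE x in M. f (T j x) * cnj (f (T j x)) = f x * cnj (f x)" for j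
      using eigenD(3)[OF f, of j] by eventually_elim (simp only: mult)
  qed
  with 1 show ?thesis
  proof eventually_elim
    case (elim x)
    have "L2_inner M g f * f x = g x * (f x * cnj (f x))" unfolding elim(1)[symmetric] by (simp add: mult_ac)
    also have "f x * cnj (f x) = 1" using elim(2) eigenD(2)[OF f] by (simp add: L2_inner_self)
    finally show ?case by simp
  qed
qed

lemma eigenbasis_orthonormal:
  assumes "f \<in> eigenbasis" "g \<in> eigenbasis"
  shows "L2_inner M f g = (if f = g then 1 else 0)"
proof -
  obtain w w' where w: "w \<in> characters" "f = (SOME f. eigen w f)" "w' \<in> characters" "g = (SOME f. eigen w' f)"
    using assms by (auto simp: eigenbasis_def)
  then have e: "eigen w f" "eigen w' g" using eigen_some by simp_all
  show ?thesis
  proof (cases "f = g")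
    case True
    then show ?thesis using eigenD(2)[OF e(1)] by (simp add: L2_inner_self)
  next
    case False
    then have "w \<noteq> w'" using w by auto
    then show ?thesis using False eigen_orthogonal[OF w(1,3) _ e] by simp
  qed
qed

lemma eigenbasis_L2: "eigenbasis \<subseteq> L2 M"
  using eigenbasis_eigenfunction by (auto simp: eigenfunction_def)

text \<open>An arbitrary eigenfunction is a multiple of the chosen one with the same eigenvalue, so
  orthogonality to the chosen ones implies orthogonality to all.\<close>

lemma eigenbasis_total:
  assumes \<phi>: "eigenfunction M T \<phi>" and h: "h \<in> L2 M" and orth: "\<And>b. b \<in> eigenbasis \<Longrightarrow> L2_inner M b h = 0"
  shows "L2_inner M \<phi> h = 0"
proof -
  have \<phi>2: "\<phi> \<in> L2 M" and \<phi>nz: "\<not> (AE x in M. \<phi> x = 0)" using \<phi> by (auto simp: eigenfunction_def)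
  obtain w where w: "continuous_on UNIV w" "\<And>j. cmod (w j) = 1" "\<And>i j. w (i + j) = w i * w j"
    "\<And>j. AE x in M. \<phi> (T j x) = w j * \<phi> x"
    using \<phi> unfolding eigenfunction_def by blast
  have npos: "L2_norm M \<phi> > 0" using L2_norm_eq_0_iff[OF \<phi>2] \<phi>nz L2_norm_nonneg[of M \<phi>] by (simp add: less_le)
  define \<psi> where "\<psi> = (\<lambda>x. of_real (1 / L2_norm M \<phi>) * \<phi> x)"
  have "eigen w \<psi>"
    unfolding eigen_def
  proof (intro conjI allI)
    show "\<psi> \<in> L2 M" unfolding \<psi>_def by (rule L2_scale[OF \<phi>2])
    show "L2_norm M \<psi> = 1" unfolding \<psi>_def L2_norm_scale using npos by (simp add: norm_divide)
    show "AE x in M. \<psi> (T j x) = w j * \<psi> x" for j using w(4)[of j] by eventually_elim (simp add: \<psi>_def)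
  qed
  then have wc: "w \<in> characters" using w(1-3) by (auto simp: characters_def)
  define b where "b = (SOME f. eigen w f)"
  have b: "b \<in> eigenbasis" "eigen w b" using wc eigen_some[OF wc] by (auto simp: b_def eigenbasis_def)
  have "L2_inner M \<phi> h = L2_inner M (\<lambda>x. L2_inner M \<phi> b * b x) h"
    using \<phi>2 eigenD(4)[OF b(2)] h by (intro L2_inner_cong_AE eigen_simple[OF w(2) b(2) \<phi>2 w(4)]) (auto simp: L2_def)
  also have "\<dots> = 0" by (simp add: L2_inner_scale_left orth[OF b(1)])
  finally show ?thesis .
qed

end

text \<open>\<open>B\<close> is not known to be countable, so there is no series to sum. Instead
  finite subsets are taken whose Bessel sums approach the supremum over all finite subsets.\<close>

lemma (in finite_measure) orthonormal_projection:
  assumes B: "B \<subseteq> L2 M" and on: "\<And>f g. f \<in> B \<Longrightarrow> g \<in> B \<Longrightarrow> L2_inner M f g = (if f = g then 1 else 0)"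
    and f: "f \<in> L2 M"
  obtains g S c where "g \<in> L2 M" "\<And>b. b \<in> B \<Longrightarrow> L2_inner M b (\<lambda>x. f x - g x) = 0"
    "\<And>n::nat. finite (S n) \<and> S n \<subseteq> B" "(\<lambda>n. L2_norm M (\<lambda>x. (\<Sum>b\<in>S n. c b * b x) - g x)) \<longlonglongrightarrow> 0"
proof -
  define a where "a b = L2_inner M f b" for b
  define P where "P S = (\<lambda>x. \<Sum>b\<in>S. a b * b x)" for S
  define s where "s S = (\<Sum>b\<in>S. (cmod (a b))\<^sup>2)" for S
  define \<S> where "\<S> = {S. finite S \<and> S \<subseteq> B}"
  have PL: "P S \<in> L2 M" if "S \<in> \<S>" for S
    unfolding P_def using that B by (intro L2_sum L2_scale) (auto simp: \<S>_def)
  have Pb: "L2_inner M (P S) b = (if b \<in> S then a b else 0)" if S: "S \<in> \<S>" and b: "b \<in> B" for S b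
  proof -
    have "L2_inner M (P S) b = (\<Sum>b'\<in>S. a b' * L2_inner M b' b)"
      unfolding P_def using S B b by (subst L2_inner_sum_left) (auto simp: \<S>_def L2_inner_scale_left intro!: L2_scale)
    also have "\<dots> = (\<Sum>b'\<in>S. if b' = b then a b else 0)"
      using S b by (intro sum.cong) (auto simp: on \<S>_def)
    finally show ?thesis using S by (simp add: \<S>_def)
  qed
  have bP: "L2_inner M b (P S) = (if b \<in> S then cnj (a b) else 0)" if "S \<in> \<S>" "b \<in> B" for S b
    using Pb[OF that] L2_inner_commute[of M b "P S"] by simp
  have PP: "L2_inner M (P S) (P S') = of_real (s (S \<inter> S'))" if S: "S \<in> \<S>" "S' \<in> \<S>" for S S'
  proof -
    have "L2_inner M (P S) (P S') = (\<Sum>b\<in>S. a b * L2_inner M b (P S'))"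
      unfolding P_def[of S] using S B PL[OF S(2)] by (subst L2_inner_sum_left) (auto simp: \<S>_def L2_inner_scale_left intro!: L2_scale)
    also have "\<dots> = (\<Sum>b\<in>S. if b \<in> S' then of_real ((cmod (a b))\<^sup>2) else 0)"
      using S by (intro sum.cong refl) (auto simp: bP[OF S(2)] \<S>_def complex_norm_square simp del: of_real_power)
    also have "\<dots> = (\<Sum>b\<in>S \<inter> S'. of_real ((cmod (a b))\<^sup>2))"
      using S by (simp add: sum.inter_restrict \<S>_def del: of_real_power)
    finally show ?thesis by (simp add: s_def)
  qed
  have fP: "L2_inner M f (P S) = of_real (s S)" if S: "S \<in> \<S>" for S
  proof -
    have "L2_inner M (P S) f = (\<Sum>b\<in>S. a b * L2_inner M b f)"
      unfolding P_def using S B f by (subst L2_inner_sum_left) (auto simp: \<S>_def L2_inner_scale_left intro!: L2_scale)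
    also have "\<dots> = (\<Sum>b\<in>S. of_real ((cmod (a b))\<^sup>2))"
      by (intro sum.cong refl) (simp only: complex_norm_square a_def L2_inner_commute[of M _ f])
    finally have "L2_inner M (P S) f = of_real (s S)" by (simp add: s_def)
    then show ?thesis using L2_inner_commute[of M f "P S"] by simp
  qed
  have Pn: "(L2_norm M (P S))\<^sup>2 = s S" if "S \<in> \<S>" for S
    using PP[OF that that] unfolding L2_inner_self of_real_eq_iff by simp
  have bessel: "s S \<le> (L2_norm M f)\<^sup>2" if S: "S \<in> \<S>" for S
  proof -
    have "0 \<le> (L2_norm M (\<lambda>x. f x - P S x))\<^sup>2" by simp
    also have "\<dots> = (L2_norm M f)\<^sup>2 - s S"
      using L2_norm_diff_square[OF f PL[OF S]] by (simp add: fP[OF S] Pn[OF S])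
    finally show ?thesis by simp
  qed
  define \<sigma> where "\<sigma> = (SUP S\<in>\<S>. s S)"
  have ne: "\<S> \<noteq> {}" by (auto simp: \<S>_def)
  have bdd: "bdd_above (s ` \<S>)" using bessel by (intro bdd_aboveI2)
  have \<sigma>: "s S \<le> \<sigma>" if "S \<in> \<S>" for S unfolding \<sigma>_def by (rule cSUP_upper[OF that bdd])
  have "\<exists>S\<in>\<S>. \<sigma> - 1 / real (Suc n) < s S" for n
    using less_cSUP_iff[OF ne bdd, of "\<sigma> - 1 / real (Suc n)"] unfolding \<sigma>_def by auto
  then obtain S where S: "\<And>n. S n \<in> \<S>" "\<And>n. \<sigma> - 1 / real (Suc n) < s (S n)" by metis
  have inv: "1 / real (Suc n) \<le> 1 / real (Suc N)" if "n \<ge> N" for n N using that by (simp add: frac_le)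
  \<comment> \<open>The squared distance of two partial sums is twice the Bessel sum of the union
    minus the two single ones. The union cannot exceed \<open>\<sigma>\<close>, and each single sum
    is close to it.\<close>
  have cauchy: "\<exists>N. \<forall>m\<ge>N. \<forall>n\<ge>N. L2_norm M (\<lambda>x. P (S m) x - P (S n) x) < e" if e: "e > 0" for e
  proof -
    obtain N where N: "1 / real (Suc N) < e\<^sup>2 / 2" using nat_approx_posE[of "e\<^sup>2 / 2"] e by auto
    have "L2_norm M (\<lambda>x. P (S m) x - P (S n) x) < e" if mn: "m \<ge> N" "n \<ge> N" for m n
    proof -
      have fin: "finite (S m)" "finite (S n)" using S(1) by (auto simp: \<S>_def)
      have un: "S m \<union> S n \<in> \<S>" using S(1)[of m] S(1)[of n] by (auto simp: \<S>_def)
      have "s (S m \<union> S n) + s (S m \<inter> S n) = s (S m) + s (S n)"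
        unfolding s_def by (rule sum.union_inter[OF fin])
      moreover have "(L2_norm M (\<lambda>x. P (S m) x - P (S n) x))\<^sup>2 = s (S m) - 2 * s (S m \<inter> S n) + s (S n)"
        using L2_norm_diff_square[OF PL[OF S(1)] PL[OF S(1)], of m n] by (simp add: PP S(1) Pn)
      ultimately have lt: "(L2_norm M (\<lambda>x. P (S m) x - P (S n) x))\<^sup>2 < e\<^sup>2"
        using \<sigma>[OF un] S(2)[of m] S(2)[of n] inv[OF mn(1)] inv[OF mn(2)] N by linarith
      show ?thesis by (rule power2_less_imp_less[OF lt]) (use e in simp)
    qed
    then show ?thesis by blast
  qed
  obtain g where g: "g \<in> L2 M" "(\<lambda>n. L2_norm M (\<lambda>x. P (S n) x - g x)) \<longlonglongrightarrow> 0"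
  proof (rule L2_complete[of "\<lambda>n. P (S n)", OF PL[OF S(1)] cauchy])
    fix v
    assume v: "v \<in> L2 M" "(\<lambda>n. L2_norm M (\<lambda>x. P (S n) x - v x)) \<longlonglongrightarrow> 0"
    show thesis by (rule that[OF v])
  qed
  have "L2_inner M b (\<lambda>x. f x - g x) = 0" if b: "b \<in> B" for b
  proof -
    have bL: "b \<in> L2 M" using b B by auto
    have "(\<lambda>n. L2_inner M (P (S n)) b) \<longlonglongrightarrow> L2_inner M g b"
      by (rule L2_inner_tendsto[OF PL[OF S(1)] g bL])
    \<comment> \<open>A vector \<open>b\<close> missing from \<open>S n\<close> could be added,
      which must not lift the Bessel sum above \<open>\<sigma>\<close>; so its coefficient is
      small.\<close>
    moreover have "(\<lambda>n. L2_inner M (P (S n)) b) \<longlonglongrightarrow> a b"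
    proof (rule LIM_zero_cancel, rule Lim_null_comparison)
      show "\<forall>\<^sub>F n in sequentially. norm (L2_inner M (P (S n)) b - a b) \<le> sqrt (1 / real (Suc n))"
      proof (intro always_eventually allI)
        fix n
        show "norm (L2_inner M (P (S n)) b - a b) \<le> sqrt (1 / real (Suc n))"
        proof (cases "b \<in> S n")
          case True
          then show ?thesis by (simp add: Pb[OF S(1) b])
        next
          case False
          have ins: "insert b (S n) \<in> \<S>" using S(1)[of n] b by (auto simp: \<S>_def)
          have "s (insert b (S n)) = (cmod (a b))\<^sup>2 + s (S n)"
            using False S(1)[of n] by (simp add: s_def \<S>_def)
          then have "(cmod (a b))\<^sup>2 \<le> 1 / real (Suc n)" using \<sigma>[OF ins] S(2)[of n] by linarith
          then have "cmod (a b) \<le> sqrt (1 / real (Suc n))" by (rule real_le_rsqrt)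
          then show ?thesis using False by (simp add: Pb[OF S(1) b])
        qed
      qed
      show "(\<lambda>n. sqrt (1 / real (Suc n))) \<longlonglongrightarrow> 0"
        using tendsto_real_sqrt[OF LIMSEQ_Suc[OF lim_1_over_n]] by simp
    qed
    ultimately have "L2_inner M g b = L2_inner M f b"
      unfolding a_def by (rule LIMSEQ_unique)
    then show ?thesis
      using L2_inner_commute[of M b f] L2_inner_commute[of M b g] by (simp add: L2_inner_diff_right[OF f g(1) bL])
  qed
  moreover have "finite (S n) \<and> S n \<subseteq> B" for n using S(1)[of n] by (simp add: \<S>_def)
  ultimately show thesis using that[of g S a] g unfolding P_def by blast
qed

context ergodic_folner_mps
begin

text \<open>What remains of \<open>f\<close> after projecting onto the span of the eigenfunctions is
  itself not sensitive. If it were nonzero, some eigenfunction would correlate with it, although it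
  is orthogonal to all of them.\<close>

theorem not_mean_sensitive_imp_discrete_spectrum:
  assumes ns: "\<And>f. f \<in> L2 M \<Longrightarrow> \<not> mean_sensitive \<nu> F M T f"
  shows "discrete_spectrum M T"
  unfolding discrete_spectrum_def orthonormal_basis_def
proof (rule exI[of _ eigenbasis], intro conjI ballI allI impI)
  fix f and e :: real assume f: "f \<in> L2 M" and e: "e > 0"
  obtain g S c where g: "g \<in> L2 M" "\<And>b. b \<in> eigenbasis \<Longrightarrow> L2_inner M b (\<lambda>x. f x - g x) = 0"
    and S: "\<And>n::nat. finite (S n) \<and> S n \<subseteq> eigenbasis"
      "(\<lambda>n. L2_norm M (\<lambda>x. (\<Sum>b\<in>S n. c b * b x) - g x)) \<longlonglongrightarrow> 0"
  proof (rule orthonormal_projection[OF eigenbasis_L2 eigenbasis_orthonormal f])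
    fix g S c
    assume a: "g \<in> L2 M" "\<And>b. b \<in> eigenbasis \<Longrightarrow> L2_inner M b (\<lambda>x. f x - g x) = 0"
      "\<And>n::nat. finite (S n) \<and> S n \<subseteq> eigenbasis"
      "(\<lambda>n. L2_norm M (\<lambda>x. (\<Sum>b\<in>S n. c b * b x) - g x)) \<longlonglongrightarrow> 0"
    show thesis by (rule that[OF a])
  qed
  let ?h = "\<lambda>x. f x - g x"
  have h: "?h \<in> L2 M" by (rule L2_diff[OF f g(1)])
  have "L2_norm M ?h = 0"
  proof (rule ccontr)
    assume "L2_norm M ?h \<noteq> 0"
    then have "L2_norm M ?h > 0" using L2_norm_nonneg[of M ?h] by linarith
    then obtain \<phi> where "eigenfunction M T \<phi>" "L2_inner M \<phi> ?h \<noteq> 0"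
      by (rule eigenfunction_exists[OF h _ ns[OF h]])
    with eigenbasis_total[OF _ h g(2)] show False by blast
  qed
  obtain n where n: "L2_norm M (\<lambda>x. (\<Sum>b\<in>S n. c b * b x) - g x) < e"
    using order_tendstoD(2)[OF S(2) e] by (auto simp: eventually_sequentially)
  have PL: "(\<lambda>x. \<Sum>b\<in>S n. c b * b x) \<in> L2 M"
    using S(1)[of n] eigenbasis_L2 by (intro L2_sum L2_scale) auto
  have "L2_norm M (\<lambda>x. f x - (\<Sum>b\<in>S n. c b * b x)) < e"
    using L2_norm_triangle_diff[OF f g(1) PL] \<open>L2_norm M ?h = 0\<close> n
      L2_norm_minus_commute[of M "\<lambda>x. \<Sum>b\<in>S n. c b * b x" g] by simp
  then show "\<exists>S c. finite S \<and> S \<subseteq> eigenbasis \<and> L2_norm M (\<lambda>x. f x - (\<Sum>b\<in>S. c b * b x)) < e"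
    using S(1)[of n] by blast
qed (use eigenbasis_L2 eigenbasis_orthonormal eigenbasis_eigenfunction in auto)

end

theorem corollary1p16:
  fixes \<nu> :: "'g::{topological_ab_group_add, t2_space} measure"
    and F :: "nat \<Rightarrow> 'g set"
    and M :: "'x measure"
    and T :: "'g \<Rightarrow> 'x \<Rightarrow> 'x"
  assumes "locally_compact_space (euclidean :: 'g topology)"
    and "haar_measure \<nu>"
    and "folner_seq \<nu> F"
    and "pointwise_ergodic_seq \<nu> F"
    and "ergodic_mps M T"
  shows "(discrete_spectrum M T \<longleftrightarrow> L2 M = L2 M - H_ms \<nu> F M T) \<and>
         (weakly_mixing M T \<longleftrightarrow>
            (\<forall>f\<in>L2 M. \<not> (\<exists>c. AE x in M. f x = c) \<longrightarrow> f \<in> H_ms \<nu> F M T))"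
proof -
  interpret ergodic_folner_mps \<nu> F M T
    using assms(2-5) by unfold_locales (auto simp: ergodic_mps_def)
  have "discrete_spectrum M T \<longleftrightarrow> (\<forall>f\<in>L2 M. \<not> mean_sensitive \<nu> F M T f)"
    using discrete_spectrum_imp_not_mean_sensitive not_mean_sensitive_imp_discrete_spectrum by blast
  moreover have "weakly_mixing M T \<longleftrightarrow> (\<forall>f\<in>L2 M. \<not> (\<exists>c. AE x in M. f x = c) \<longrightarrow> mean_sensitive \<nu> F M T f)"
    using weakly_mixing_imp_mean_sensitive mean_sensitive_imp_weakly_mixing by blast
  \<comment> \<open>As \<open>H_ms\<close> is contained in \<open>L2 M\<close>, the set equation
    says that \<open>H_ms\<close> is empty.\<close>
  ultimately show ?thesis by (auto simp: H_ms_def)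
qed

end
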